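(* Let $K$ be a field, $(Q,\sigma)$ a rooted tree quiver and $V$ a representation of $Q$. Let $N\in L_{Q,\sigma}$ be maximal such that $\operatorname{rank}_N V\neq0$. Then for some $l>0$ there exists a subrepresentation $U\subseteq V^{\otimes l}$ with $$U\simeq \Omega_N\otimes_K(\operatorname{rank}_N V^{\otimes l})$$ such that $$V^{\otimes l}\simeq U\oplus W$$ for some subrepresentation $W\subseteq V^{\otimes l}$, necessarily with $\operatorname{rank}_N W=0$.
   Context: Fix a field $K$. A quiver $Q=(Q_0,Q_1,t,h)$ is a finite directed graph with tail and head maps. A representation $V$ of $Q$ assigns a finite-dimensional $K$-vector space $V_x$ to each vertex $x$ and a $K$-linear map $V_a:V_{ta}\to V_{ha}$ to each arrow $a$. $\mathbf{1}_Q$ has $K$ at every vertex and the identity at every arrow. Tensor product is pointwise: $(V\otimes W)_x=V_x\otimes W_x$, $(V\otimes W)_a=V_a\otimes W_a$. A rooted tree quiver $(Q,\sigma)$ is a quiver whose underlying graph is a tree and which has a unique sink $\sigma$ (the root). For a vertex $x$, $Q^{\to x}$ is the maximal connected subquiver with sink $x$; its vertices are those having a path to $x$. For a map of directed graphs $c:Q'\to Q$ (vertices to vertices, arrows to arrows, compatible with heads and tails), the pullback is $(c^*W)_x=W_{c(x)}$, $(c^*W)_a=W_{c(a)}$, and the pushforward is $(c_*V)_x=\bigoplus_{y\in c^{-1}(x)}V_y$, $(c_*V)_a=\sum_{b\in c^{-1}(a)}V_b$ (each $V_b$ extended by $0$). Lattices and reduced quivers. For a finite poset $A$, $J(A)$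 is the lattice of order ideals (down-sets, including $\emptyset$ and $A$) ordered by inclusion, and $\max(I)$ is the set of maximal elements of an ideal $I$. For a rooted tree $(Q,\sigma)$ define finite lattices $L_{Q,x}$ ($x\in Q_0$) recursively: if $Q$ has one vertex, $L_{Q,\sigma}$ has one element. If $x\ne\sigma$, $L_{Q,x}:=L_{Q^{\to x},x}$. Otherwise, removing $\sigma$ and its adjacent arrows $\alpha_i:\sigma_i\to\sigma$ leaves rooted trees $(Q_i,\sigma_i)$, and $L_{Q,\sigma}:=\prod_i J(L_{Q_i,\sigma_i})$ with the product order. For $M\in L_{Q,x}$ define recursively a rooted tree quiver $(Q_M,\sigma_M)$ and a map $c_M:Q_M\to Q$ with $c_M(\sigma_M)=x$: if $Q$ has one vertex, $c_M=\mathrm{id}_Q$; if $x\neq\sigma$, take the quiver over $Q^{\to x}$ already defined, composed with the inclusion $Q^{\to x}\subset Q$; if $x=\sigma$ and $M=(M_i)$ with $M_i\in J(L_{Q_i,\sigma_i})$, $Q_M$ is the disjoint union of the quivers $(Q_i)_S$ over all $i$ and all $S\in\max(M_i)$, together with one new vertex $\sigma_M\mapsto\sigma$ and, for each such $(i,S)$, one new arrow from the root of $(Q_i)_S$ to $\sigma_M$, mapped to $\alpha_i$; on $(Q_i)_S$ the map $c_M$ is the structure map to $Q_i\subset Q$. The reduced representation attached to $M$ is $\Omega_M:=c_{M*}\mathbf 1_{Q_M}$. Rank functors. For a rooted tree $(Q,\sigma)$ and $V\in\mathrm{rep}(Q)$, let $E(V)\subseteq V$ be the unique maximal subrepresentation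 all of whose arrow maps are surjective; the global rank functor is $\operatorname{rank}_QV=E(V)_\sigma\subseteq V_\sigma$. For $M\in L_{Q,x}$, $\operatorname{rank}_MV:=\operatorname{rank}_{Q_M}(c_M^*V)\subseteq (c_M^*V)_{\sigma_M}=V_x$. Inside $(V_x)^{\otimes n}$ one has $\operatorname{rank}_M(V^{\otimes n})=(\operatorname{rank}_MV)^{\otimes n}$, written $\operatorname{rank}_MV^{\otimes n}$. Notation. For a subrepresentation $U$ of a representation $X$ and a subspace $Z\subseteq X_\sigma$, "$U\simeq\Omega_N\otimes_KZ$" means $U\simeq\Omega_N^{\oplus\dim_KZ}$ and $U_\sigma=Z$. For subrepresentations $U,W\subseteq X$, "$X\simeq U\oplus W$" means that $X$ is the internal direct sum of $U$ and $W$. *)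

theory Defs
  imports
    Complex_Main
    "HOL-Library.FSet"
    "HOL-Library.Function_Algebras"
    "Graph_Theory.Digraph_Component"
begin

section \<open>Rooted tree quivers\<close>

text \<open>
  The library predicate \<^const>\<open>tree\<close> only excludes \<^emph>\<open>directed\<close> cycles. For the underlying
  undirected (multi)graph every arrow is doubled by a reverse copy, and a cycle must not use
  the two copies of one arrow. A loop is a cycle of length 1 and a pair of parallel or
  opposite arrows is a cycle of length 2.
\<close>

definition double :: "('v, 'e) pre_digraph \<Rightarrow> ('v, 'e \<times> bool) pre_digraph" where
  "double Q = \<lparr> verts = verts Q, arcs = arcs Q \<times> UNIV,
     tail = (\<lambda>(a, r). if r then head Q a else tail Q a),
     head = (\<lambda>(a, r). if r then tail Q a else head Q a) \<rparr>"

definition underlying_tree :: "('v, 'e) pre_digraph \<Rightarrow> bool" where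
  "underlying_tree Q \<longleftrightarrow> connected Q \<and>
     \<not> (\<exists>p. pre_digraph.cycle (double Q) p \<and> distinct (map fst p))"

definition rooted_tree :: "('v, 'e) pre_digraph \<Rightarrow> 'v \<Rightarrow> bool" where
  "rooted_tree Q \<sigma> \<longleftrightarrow> fin_digraph Q \<and> underlying_tree Q \<and>
     {x \<in> verts Q. out_arcs Q x = {}} = {\<sigma>}"


section \<open>Representations\<close>

text \<open>
  All vector spaces of one representation are finite-dimensional subspaces of a common ambient
  \<open>'k\<close>-vector space carried by the type \<open>'m\<close>, which is no restriction because one may take the
  direct sum of the spaces at the vertices. The map at an arrow is only required to be linear
  on the space at its tail; its values elsewhere, and the spaces at indices that are not
  vertices, are irrelevant.
\<close>

record ('k, 'm, 'v, 'e) rep =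
  scl :: "'k \<Rightarrow> 'm \<Rightarrow> 'm"
  spc :: "'v \<Rightarrow> 'm set"
  map_at :: "'e \<Rightarrow> 'm \<Rightarrow> 'm"

definition linear_on ::
    "('k \<Rightarrow> 'm \<Rightarrow> 'm) \<Rightarrow> ('k \<Rightarrow> 'n \<Rightarrow> 'n) \<Rightarrow> 'm set \<Rightarrow> ('m::ab_group_add \<Rightarrow> 'n::ab_group_add) \<Rightarrow> bool" where
  "linear_on s t A f \<longleftrightarrow>
     (\<forall>u\<in>A. \<forall>v\<in>A. f (u + v) = f u + f v) \<and> (\<forall>c. \<forall>u\<in>A. f (s c u) = t c (f u))"

definition is_rep :: "('v, 'e) pre_digraph \<Rightarrow> ('k::field, 'm::ab_group_add, 'v, 'e) rep \<Rightarrow> bool" where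
  "is_rep Q V \<longleftrightarrow> vector_space (scl V) \<and>
     (\<forall>x\<in>verts Q. \<exists>B. finite B \<and> module.span (scl V) B = spc V x) \<and>
     (\<forall>a\<in>arcs Q. linear_on (scl V) (scl V) (spc V (tail Q a)) (map_at V a) \<and>
        map_at V a ` spc V (tail Q a) \<subseteq> spc V (head Q a))"

definition unit_rep :: "('k::field, 'k, 'v, 'e) rep" where
  "unit_rep = \<lparr> scl = (*), spc = (\<lambda>x. UNIV), map_at = (\<lambda>a. id) \<rparr>"

definition rep_iso ::
    "('v, 'e) pre_digraph \<Rightarrow> ('k::field, 'm::ab_group_add, 'v, 'e) rep \<Rightarrow> ('k, 'n::ab_group_add, 'v, 'e) rep \<Rightarrow> bool" where
  "rep_iso Q V W \<longleftrightarrow> (\<exists>\<phi>.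
     (\<forall>x\<in>verts Q. linear_on (scl V) (scl W) (spc V x) (\<phi> x) \<and>
        bij_betw (\<phi> x) (spc V x) (spc W x)) \<and>
     (\<forall>a\<in>arcs Q. \<forall>v\<in>spc V (tail Q a).
        \<phi> (head Q a) (map_at V a v) = map_at W a (\<phi> (tail Q a) v)))"

definition copies :: "nat \<Rightarrow> ('k::field, 'm::ab_group_add, 'v, 'e) rep \<Rightarrow> ('k, nat \<Rightarrow> 'm, 'v, 'e) rep" where
  "copies n V = \<lparr> scl = (\<lambda>c f i. scl V c (f i)),
     spc = (\<lambda>x. {f. (\<forall>i<n. f i \<in> spc V x) \<and> (\<forall>i\<ge>n. f i = 0)}),
     map_at = (\<lambda>a f i. if i < n then map_at V a (f i) else 0) \<rparr>"

definition subrep ::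
    "('v, 'e) pre_digraph \<Rightarrow> ('k::field, 'm::ab_group_add, 'v, 'e) rep \<Rightarrow> ('v \<Rightarrow> 'm set) \<Rightarrow> bool" where
  "subrep Q V U \<longleftrightarrow>
     (\<forall>x\<in>verts Q. module.subspace (scl V) (U x) \<and> U x \<subseteq> spc V x) \<and>
     (\<forall>a\<in>arcs Q. map_at V a ` U (tail Q a) \<subseteq> U (head Q a))"

definition restr :: "('k, 'm, 'v, 'e) rep \<Rightarrow> ('v \<Rightarrow> 'm set) \<Rightarrow> ('k, 'm, 'v, 'e) rep" where
  "restr V U = V\<lparr>spc := U\<rparr>"

definition internal_direct_sum ::
    "('v, 'e) pre_digraph \<Rightarrow> ('k::field, 'm::ab_group_add, 'v, 'e) rep \<Rightarrow> ('v \<Rightarrow> 'm set) \<Rightarrow> ('v \<Rightarrow> 'm set) \<Rightarrow> bool" where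
  "internal_direct_sum Q V U W \<longleftrightarrow> subrep Q V U \<and> subrep Q V W \<and>
     (\<forall>x\<in>verts Q. U x \<inter> W x = {0} \<and> spc V x = {u + w | u w. u \<in> U x \<and> w \<in> W x})"


section \<open>Pullback and pushforward\<close>

definition pullback ::
    "('v' \<Rightarrow> 'v) \<Rightarrow> ('e' \<Rightarrow> 'e) \<Rightarrow> ('k, 'm, 'v, 'e) rep \<Rightarrow> ('k, 'm, 'v', 'e') rep" where
  "pullback cv ca W = \<lparr> scl = scl W, spc = spc W \<circ> cv, map_at = map_at W \<circ> ca \<rparr>"

text \<open>An element of the direct sum over the fibre of \<open>x\<close> is a function on \<open>'v'\<close> that is 0 off the fibre.\<close>

definition pushforward ::
    "('v', 'e') pre_digraph \<Rightarrow> ('v' \<Rightarrow> 'v) \<Rightarrow> ('e' \<Rightarrow> 'e) \<Rightarrow>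
     ('k::field, 'm::ab_group_add, 'v', 'e') rep \<Rightarrow> ('k, 'v' \<Rightarrow> 'm, 'v, 'e) rep" where
  "pushforward Q' cv ca V = \<lparr> scl = (\<lambda>c f y. scl V c (f y)),
     spc = (\<lambda>x. {f. \<forall>y. if y \<in> verts Q' \<and> cv y = x then f y \<in> spc V y else f y = 0}),
     map_at = (\<lambda>a f z. \<Sum>b | b \<in> arcs Q' \<and> ca b = a \<and> head Q' b = z. map_at V b (f (tail Q' b))) \<rparr>"


section \<open>Tensor powers\<close>

text \<open>
  The \<open>l\<close>-fold tensor power of a subspace \<open>A\<close> is realised inside the \<open>l\<close>-linear forms on the dual
  space of \<open>A\<close>: the pure tensor of \<open>v\<^sub>1, \<dots>, v\<^sub>l\<close> is the form
  \<open>(\<phi>\<^sub>1, \<dots>, \<phi>\<^sub>l) \<mapsto> \<phi>\<^sub>1 v\<^sub>1 * \<dots> * \<phi>\<^sub>l v\<^sub>l\<close>. Elements of the dual space are made unique as functions by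
  setting them to 0 outside of \<open>A\<close>. The lemmas \<open>pure_multilinear\<close>, \<open>tensor_universal\<close> and
  \<open>tensor_universal_unique\<close>
  are the universal property, and \<open>tensor_map_pure\<close> characterises the induced maps.
\<close>

definition dual :: "('k::field \<Rightarrow> 'm::ab_group_add \<Rightarrow> 'm) \<Rightarrow> 'm set \<Rightarrow> ('m \<Rightarrow> 'k) set" where
  "dual s A = {\<phi>. linear_on s (*) A \<phi> \<and> (\<forall>v. v \<notin> A \<longrightarrow> \<phi> v = 0)}"

definition pure ::
    "('k::field \<Rightarrow> 'm::ab_group_add \<Rightarrow> 'm) \<Rightarrow> 'm set \<Rightarrow> 'm list \<Rightarrow> (('m \<Rightarrow> 'k) list \<Rightarrow> 'k)" where
  "pure s A vs = (\<lambda>\<phi>s. if length \<phi>s = length vs \<and> set \<phi>s \<subseteq> dual s A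
     then \<Prod>i<length vs. (\<phi>s ! i) (vs ! i) else 0)"

definition tscl :: "'k::field \<Rightarrow> ('i \<Rightarrow> 'k) \<Rightarrow> ('i \<Rightarrow> 'k)" where
  "tscl c f = (\<lambda>i. c * f i)"

definition tensor_space ::
    "('k::field \<Rightarrow> 'm::ab_group_add \<Rightarrow> 'm) \<Rightarrow> nat \<Rightarrow> 'm set \<Rightarrow> (('m \<Rightarrow> 'k) list \<Rightarrow> 'k) set" where
  "tensor_space s l A = module.span tscl {pure s A vs | vs. length vs = l \<and> set vs \<subseteq> A}"

definition tensor_map ::
    "('k::field \<Rightarrow> 'm::ab_group_add \<Rightarrow> 'm) \<Rightarrow> nat \<Rightarrow> 'm set \<Rightarrow> 'm set \<Rightarrow> ('m \<Rightarrow> 'm) \<Rightarrow>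
     (('m \<Rightarrow> 'k) list \<Rightarrow> 'k) \<Rightarrow> (('m \<Rightarrow> 'k) list \<Rightarrow> 'k)" where
  "tensor_map s l A B f T = (\<lambda>\<phi>s. if length \<phi>s = l \<and> set \<phi>s \<subseteq> dual s B
     then T (map (\<lambda>\<phi> v. if v \<in> A then \<phi> (f v) else 0) \<phi>s) else 0)"

definition tensor_power ::
    "('v, 'e) pre_digraph \<Rightarrow> nat \<Rightarrow> ('k::field, 'm::ab_group_add, 'v, 'e) rep \<Rightarrow>
     ('k, ('m \<Rightarrow> 'k) list \<Rightarrow> 'k, 'v, 'e) rep" where
  "tensor_power Q l V = \<lparr> scl = tscl, spc = (\<lambda>x. tensor_space (scl V) l (spc V x)),
     map_at = (\<lambda>a. tensor_map (scl V) l (spc V (tail Q a)) (spc V (head Q a)) (map_at V a)) \<rparr>"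

definition multilinear_on ::
    "('k \<Rightarrow> 'm \<Rightarrow> 'm) \<Rightarrow> ('k \<Rightarrow> 'n \<Rightarrow> 'n) \<Rightarrow> nat \<Rightarrow> 'm set \<Rightarrow> ('m::ab_group_add list \<Rightarrow> 'n::ab_group_add) \<Rightarrow> bool" where
  "multilinear_on s t l A g \<longleftrightarrow>
     (\<forall>vs i. length vs = l \<and> set vs \<subseteq> A \<and> i < l \<longrightarrow> linear_on s t A (\<lambda>v. g (vs[i := v])))"

lemma vector_space_tscl: "vector_space (tscl :: 'k::field \<Rightarrow> ('i \<Rightarrow> 'k) \<Rightarrow> ('i \<Rightarrow> 'k))"
  by unfold_locales (auto simp: tscl_def fun_eq_iff algebra_simps)

lemma tensor_map_pure:
  assumes f: "linear_on s s A f" "f ` A \<subseteq> B" and A: "module s" "module.subspace s A"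
    and vs: "length vs = l" "set vs \<subseteq> A"
  shows "tensor_map s l A B f (pure s A vs) = pure s B (map f vs)"
proof -
  interpret module s by (rule A(1))
  have d: "(\<lambda>v. if v \<in> A then \<phi> (f v) else 0) \<in> dual s A" if "\<phi> \<in> dual s B" for \<phi>
    using that f subspace_add[OF A(2)] subspace_scale[OF A(2)]
    by (auto simp: dual_def linear_on_def image_subset_iff)
  have "set (map (\<lambda>\<phi> v. if v \<in> A then \<phi> (f v) else 0) \<phi>s) \<subseteq> dual s A" if "set \<phi>s \<subseteq> dual s B" for \<phi>s
    using d that by auto
  moreover have "vs ! i \<in> A" if "i < l" for i using vs that nth_mem by blast
  ultimately show ?thesis
    using vs by (auto simp: tensor_map_def pure_def fun_eq_iff intro!: prod.cong)
qed

lemma tensor_map_linear: "linear_on tscl tscl X (tensor_map s l A B f)"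
  by (auto simp: linear_on_def tensor_map_def tscl_def fun_eq_iff)

lemma pure_multilinear:
  fixes s :: "'k::field \<Rightarrow> 'm::ab_group_add \<Rightarrow> 'm"
  assumes "module s" "module.subspace s A"
  shows "multilinear_on s tscl l A (pure s A)"
  unfolding multilinear_on_def
proof (intro allI impI)
  fix vs :: "'m list" and i assume h: "length vs = l \<and> set vs \<subseteq> A \<and> i < l"
  have e: "(\<Prod>j<l. (\<phi>s ! j) (vs[i := v] ! j)) = (\<phi>s ! i) v * (\<Prod>j\<in>{..<l}-{i}. (\<phi>s ! j) (vs ! j))" for \<phi>s v
    using h by (subst prod.remove[of _ i]) (auto intro!: prod.cong)
  have d: "\<phi>s ! i \<in> dual s A" if "length \<phi>s = l" "set \<phi>s \<subseteq> dual s A" for \<phi>s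
    using that h by (metis nth_mem subsetD)
  show "linear_on s tscl A (\<lambda>v. pure s A (vs[i := v]))"
    using h d by (auto simp: linear_on_def pure_def tscl_def fun_eq_iff e dual_def algebra_simps)
qed

lemma multilinear_expand:
  fixes t :: "'k::field \<Rightarrow> 'n::ab_group_add \<Rightarrow> 'n" and s :: "'k \<Rightarrow> 'm::ab_group_add \<Rightarrow> 'm"
  assumes s: "vector_space s" and t: "vector_space t"
    and B: "\<not> module.dependent s B" "finite B" "module.span s B = A"
    and g: "multilinear_on s t l A g"
    and "length pre + length vs = l" "set pre \<subseteq> A" "set vs \<subseteq> A"
  shows "g (pre @ vs) = (\<Sum>bs | length bs = length vs \<and> set bs \<subseteq> B.
     t (\<Prod>i<length vs. module.representation s B (vs ! i) (bs ! i)) (g (pre @ bs)))"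
  using assms(7-)
proof (induction vs arbitrary: pre)
  case Nil
  interpret t: vector_space t by (rule t)
  have "{bs::'m list. length bs = length ([]::'m list) \<and> set bs \<subseteq> B} = {[]}" by auto
  then show ?case by simp
next
  case (Cons v vs)
  interpret s: vector_space s by (rule s)
  interpret t: vector_space t by (rule t)
  let ?r = "s.representation B"
  let ?n = "length vs"
  let ?L = "\<lambda>n. {bs. length bs = n \<and> set bs \<subseteq> B}"
  have BA: "B \<subseteq> A" using B(3) s.span_superset by blast
  have sA: "s.subspace A" using B(3) s.subspace_span by blast
  have v: "v \<in> A" and vs: "set vs \<subseteq> A" using Cons.prems by auto
  have lin: "linear_on s t A (\<lambda>w. g (pre @ w # vs))"
  proof -
    have "linear_on s t A (\<lambda>w. g ((pre @ v # vs)[length pre := w]))"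
      using g[unfolded multilinear_on_def, rule_format, of "pre @ v # vs" "length pre"] Cons.prems
      by simp
    then show ?thesis by simp
  qed
  have z: "g (pre @ 0 # vs) = 0"
  proof -
    have "g (pre @ s 0 v # vs) = t 0 (g (pre @ v # vs))"
      using lin v unfolding linear_on_def by blast
    then show ?thesis by simp
  qed
  have E: "g (pre @ (\<Sum>b\<in>C. s (?r v b) b) # vs) = (\<Sum>b\<in>C. t (?r v b) (g (pre @ b # vs)))"
    if "finite C" "C \<subseteq> B" for C
    using that
  proof (induction C rule: finite_induct)
    case empty
    then show ?case by (simp add: z)
  next
    case (insert b C)
    have m: "s (?r v b) b \<in> A" "b \<in> A" using insert.prems BA sA s.subspace_scale by blast+
    have m': "(\<Sum>b\<in>C. s (?r v b) b) \<in> A"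
      using insert.prems BA sA by (intro s.subspace_sum) (auto intro: s.subspace_scale)
    show ?case using lin m m' insert unfolding linear_on_def by simp
  qed
  have "(\<Sum>b\<in>B. s (?r v b) b) = v"
    using s.sum_representation_eq[OF B(1) _ B(2) subset_refl, of v] v B(3) by simp
  then have "g (pre @ v # vs) = (\<Sum>b\<in>B. t (?r v b) (g (pre @ b # vs)))"
    using E[OF B(2) subset_refl] by simp
  also have "\<dots> = (\<Sum>b\<in>B. t (?r v b) (\<Sum>bs\<in>?L ?n.
      t (\<Prod>i<?n. ?r (vs ! i) (bs ! i)) (g (pre @ b # bs))))"
  proof (intro sum.cong refl)
    fix b assume "b \<in> B"
    then have "b \<in> A" using BA by blast
    then show "t (?r v b) (g (pre @ b # vs)) = t (?r v b) (\<Sum>bs\<in>?L ?n.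
      t (\<Prod>i<?n. ?r (vs ! i) (bs ! i)) (g (pre @ b # bs)))"
      using Cons.IH[of "pre @ [b]"] Cons.prems by simp
  qed
  also have "\<dots> = (\<Sum>b\<in>B. \<Sum>bs\<in>?L ?n.
      t (?r v b * (\<Prod>i<?n. ?r (vs ! i) (bs ! i))) (g (pre @ b # bs)))"
    by (simp add: t.scale_sum_right)
  also have "\<dots> = (\<Sum>(b, bs)\<in>B \<times> ?L ?n.
      t (?r v b * (\<Prod>i<?n. ?r (vs ! i) (bs ! i))) (g (pre @ b # bs)))"
    by (simp add: sum.cartesian_product)
  also have "\<dots> = (\<Sum>bs\<in>?L (Suc ?n). t (\<Prod>i<Suc ?n. ?r ((v # vs) ! i) (bs ! i)) (g (pre @ bs)))"
    by (rule sum.reindex_bij_witness[where i = "\<lambda>bs. (hd bs, tl bs)" and j = "\<lambda>(b, bs). b # bs"])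
      (auto simp: length_Suc_conv prod.lessThan_Suc_shift simp del: prod.lessThan_Suc)
  finally show ?case by simp
qed

lemma tensor_universal:
  fixes t :: "'k::field \<Rightarrow> 'n::ab_group_add \<Rightarrow> 'n" and s :: "'k \<Rightarrow> 'm::ab_group_add \<Rightarrow> 'm"
  assumes s: "vector_space s" and t: "vector_space t"
    and A: "finite C" "module.span s C = A"
    and g: "multilinear_on s t l A g"
  shows "\<exists>h. linear_on tscl t (tensor_space s l A) h \<and>
      (\<forall>vs. length vs = l \<and> set vs \<subseteq> A \<longrightarrow> h (pure s A vs) = g vs)"
proof -
  interpret s: vector_space s by (rule s)
  interpret t: vector_space t by (rule t)
  obtain B where B: "B \<subseteq> C" "\<not> s.dependent B" "C \<subseteq> s.span B"
    using s.maximal_independent_subset by blast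
  have spB: "s.span B = A"
    using B A(2) by (metis s.span_mono s.span_span subset_antisym)
  have fB: "finite B" using B(1) A(1) finite_subset by blast
  define \<beta> where "\<beta> b v = (if v \<in> A then s.representation B v b else 0)" for b v
  have \<beta>: "\<beta> b \<in> dual s A" for b
    unfolding dual_def linear_on_def \<beta>_def
    using s.representation_add[OF B(2)] s.representation_scale[OF B(2)] spB
    by (auto simp: s.span_add s.span_scale)
  let ?L = "{bs. length bs = l \<and> set bs \<subseteq> B}"
  define h where "h T = (\<Sum>bs\<in>?L. t (T (map \<beta> bs)) (g bs))" for T
  have "linear_on tscl t X h" for X
    by (auto simp: linear_on_def h_def tscl_def t.scale_left_distrib sum.distrib t.scale_sum_right)
  moreover have "h (pure s A vs) = g vs" if vs: "length vs = l" "set vs \<subseteq> A" for vs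
  proof -
    have "set (map \<beta> bs) \<subseteq> dual s A" for bs using \<beta> by auto
    moreover have "vs ! i \<in> A" if "i < l" for i using that vs nth_mem by blast
    ultimately show ?thesis
      using multilinear_expand[OF s t B(2) fB spB g, of "[]" vs] vs
      by (simp add: h_def pure_def \<beta>_def)
  qed
  ultimately show ?thesis by blast
qed

lemma tensor_universal_unique:
  fixes t :: "'k::field \<Rightarrow> 'n::ab_group_add \<Rightarrow> 'n" and s :: "'k \<Rightarrow> 'm::ab_group_add \<Rightarrow> 'm"
  assumes t: "vector_space t"
    and h: "linear_on tscl t (tensor_space s l A) h"
      "\<And>vs. length vs = l \<Longrightarrow> set vs \<subseteq> A \<Longrightarrow> h (pure s A vs) = g vs"
    and h': "linear_on tscl t (tensor_space s l A) h'"
      "\<And>vs. length vs = l \<Longrightarrow> set vs \<subseteq> A \<Longrightarrow> h' (pure s A vs) = g vs"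
    and T: "T \<in> tensor_space s l A"
  shows "h T = h' T"
proof -
  interpret t: vector_space t by (rule t)
  interpret ts: vector_space "tscl :: 'k \<Rightarrow> (('m \<Rightarrow> 'k) list \<Rightarrow> 'k) \<Rightarrow> _" by (rule vector_space_tscl)
  let ?G = "{pure s A vs | vs. length vs = l \<and> set vs \<subseteq> A}"
  have "T \<in> ts.span ?G \<and> h T = h' T"
    if "T \<in> ts.span ?G" for T
    using that
  proof (induction rule: ts.span_induct_alt)
    case base
    have 0: "(0 :: ('m \<Rightarrow> 'k) list \<Rightarrow> 'k) \<in> tensor_space s l A"
      unfolding tensor_space_def by (rule ts.span_zero)
    have "h (tscl 0 0) = t 0 (h 0)" "h' (tscl 0 0) = t 0 (h' 0)"
      using h(1) h'(1) 0 unfolding linear_on_def by blast+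
    then have "h 0 = h' 0" by simp
    then show ?case by (rule conjI[OF ts.span_zero])
  next
    case (step c x y)
    have x: "x \<in> ts.span ?G" using step(1) by (rule ts.span_base)
    note m = x ts.span_scale[OF x, of c] step(2)[THEN conjunct1]
    obtain vs where vs: "x = pure s A vs" "length vs = l" "set vs \<subseteq> A" using step(1) by blast
    then have hx: "h x = h' x" using h(2) h'(2) by simp
    have add: "k (tscl c x + y) = t c (k x) + k y"
      if "linear_on tscl t (tensor_space s l A) k" for k
    proof -
      have "k (tscl c x + y) = k (tscl c x) + k y" "k (tscl c x) = t c (k x)"
        using that m unfolding linear_on_def tensor_space_def by blast+
      then show ?thesis by (rule trans[OF _ arg_cong[where f = "\<lambda>z. z + k y"]])
    qed
    have "h (tscl c x + y) = h' (tscl c x + y)"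
      unfolding add[OF h(1)] add[OF h'(1)] hx step(2)[THEN conjunct2] by (rule refl)
    then show ?case by (rule conjI[OF ts.span_add[OF m(2,3)]])
  qed
  then show ?thesis using T unfolding tensor_space_def by blast
qed


section \<open>The lattices\<close>

definition order_ideals :: "'a::order set \<Rightarrow> 'a set set" where
  "order_ideals A = {I. I \<subseteq> A \<and> (\<forall>S\<in>I. \<forall>T\<in>A. T \<le> S \<longrightarrow> T \<in> I)}"

definition max_elems :: "'a::order set \<Rightarrow> 'a set" where
  "max_elems I = {S \<in> I. \<not> (\<exists>T\<in>I. S < T)}"

text \<open>
  An element of the lattice at \<open>x\<close> is a family of ideals indexed by the arrows into \<open>x\<close>, where the
  ideal at \<open>a\<close> lives in the lattice at \<open>tail a\<close>. It is coded hereditarily by a family of finite sets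
  over the whole arrow type, empty at all other indices. For a rooted tree all these lattices are
  finite, so that every ideal is a finite set.
\<close>

datatype 'e lat = Fam "'e \<Rightarrow> 'e lat fset"

primrec ideal_at :: "'e lat \<Rightarrow> 'e \<Rightarrow> 'e lat set" where
  "ideal_at (Fam F) a = fset (F a)"

lemma lat_eqI: "(\<And>a. ideal_at M a = ideal_at N a) \<Longrightarrow> M = N"
  by (cases M; cases N) (auto simp: fun_eq_iff fset_inject)

instantiation lat :: (type) order
begin

definition less_eq_lat :: "'a lat \<Rightarrow> 'a lat \<Rightarrow> bool" where
  "M \<le> N \<longleftrightarrow> (\<forall>a. ideal_at M a \<subseteq> ideal_at N a)"

definition less_lat :: "'a lat \<Rightarrow> 'a lat \<Rightarrow> bool" where
  "M < N \<longleftrightarrow> M \<le> N \<and> \<not> N \<le> (M::'a lat)"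

instance
  by standard (auto simp: less_eq_lat_def less_lat_def intro!: lat_eqI)

end

definition lat_below :: "('e lat \<times> 'e lat) set" where
  "lat_below = {(T, M). \<exists>a. \<exists>S\<in>ideal_at M a. T \<le> S}"

lemma wf_lat_below: "wf lat_below"
proof -
  have "\<forall>T. T \<le> M \<longrightarrow> T \<in> Wellfounded.acc lat_below" for M :: "'a lat"
  proof (induction M)
    case (Fam F)
    show ?case
    proof (intro allI impI)
      fix T assume T: "T \<le> Fam F"
      show "T \<in> Wellfounded.acc lat_below"
      proof (rule accI)
        fix T' assume "(T', T) \<in> lat_below"
        then obtain a S where "S \<in> ideal_at T a" "T' \<le> S" by (auto simp: lat_below_def)
        moreover from this T have "S \<in> fset (F a)" by (auto simp: less_eq_lat_def)
        ultimately show "T' \<in> Wellfounded.acc lat_below" using Fam by blast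
      qed
    qed
  qed
  then show ?thesis by (metis acc_wfI order_refl)
qed

text \<open>
  Recursion on the element rather than on the quiver, which needs no assumption on the quiver;
  the recursion \<open>L\<^sub>x = \<Prod>\<^sub>a J(L\<^sub>t\<^sub>a)\<close> over the arrows \<open>a\<close> into \<open>x\<close> is \<open>lattice_rec\<close>. The lattice at \<open>x\<close>
  only involves vertices with a path to \<open>x\<close>, so passing to that subquiver changes nothing.
\<close>

function in_lattice :: "('v, 'e) pre_digraph \<Rightarrow> 'v \<Rightarrow> 'e lat \<Rightarrow> bool" where
  "in_lattice Q x M \<longleftrightarrow> (\<forall>a. \<forall>S\<in>ideal_at M a. a \<in> in_arcs Q x \<and> in_lattice Q (tail Q a) S \<and>
     (\<forall>T. T \<le> S \<longrightarrow> in_lattice Q (tail Q a) T \<longrightarrow> T \<in> ideal_at M a))"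
  by pat_completeness auto
termination
  by (relation "inv_image lat_below (\<lambda>(Q, x, M). M)") (auto intro!: wf_lat_below,
      auto simp: lat_below_def)

declare in_lattice.simps [simp del]

definition lattice :: "('v, 'e) pre_digraph \<Rightarrow> 'v \<Rightarrow> 'e lat set" where
  "lattice Q x = {M. in_lattice Q x M}"

lemma lattice_rec:
  "lattice Q x = {M. (\<forall>a\<in>in_arcs Q x. ideal_at M a \<in> order_ideals (lattice Q (tail Q a))) \<and>
     (\<forall>a. a \<notin> in_arcs Q x \<longrightarrow> ideal_at M a = {})}"
proof (intro set_eqI)
  fix M
  have "in_lattice Q x M \<longleftrightarrow> (\<forall>a. if a \<in> in_arcs Q x
    then ideal_at M a \<in> order_ideals (lattice Q (tail Q a)) else ideal_at M a = {})"
    unfolding in_lattice.simps[of Q x M] lattice_def order_ideals_def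
    by (intro arg_cong[where f = All] ext) auto
  then show "M \<in> lattice Q x \<longleftrightarrow> M \<in>
    {M. (\<forall>a\<in>in_arcs Q x. ideal_at M a \<in> order_ideals (lattice Q (tail Q a))) \<and>
      (\<forall>a. a \<notin> in_arcs Q x \<longrightarrow> ideal_at M a = {})}"
    by (auto simp: lattice_def split: if_splits)
qed


section \<open>Reduced quivers and rank functors\<close>

text \<open>
  A vertex of the reduced quiver is coded by the list of pairs (arrow, maximal element) that are
  chosen on the way from the new root \<open>[]\<close> up to that vertex; every other vertex \<open>p\<close> is the tail of
  exactly one arrow, which is also called \<open>p\<close> and points to \<open>butlast p\<close>.
\<close>

fun red_path :: "'e lat \<Rightarrow> ('e \<times> 'e lat) list \<Rightarrow> bool" where
  "red_path M [] \<longleftrightarrow> True"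
| "red_path M ((a, S) # p) \<longleftrightarrow> S \<in> max_elems (ideal_at M a) \<and> red_path S p"

definition red_quiver :: "'e lat \<Rightarrow> (('e \<times> 'e lat) list, ('e \<times> 'e lat) list) pre_digraph" where
  "red_quiver M = \<lparr> verts = {p. red_path M p}, arcs = {p. red_path M p \<and> p \<noteq> []},
     tail = id, head = butlast \<rparr>"

definition red_vert :: "('v, 'e) pre_digraph \<Rightarrow> 'v \<Rightarrow> ('e \<times> 'e lat) list \<Rightarrow> 'v" where
  "red_vert Q x p = (if p = [] then x else tail Q (fst (last p)))"

definition red_arc :: "('e \<times> 'e lat) list \<Rightarrow> 'e" where
  "red_arc p = fst (last p)"

lemma red_quiver_rec:
  fixes M :: "'e lat"
  defines "R \<equiv> {(a, S). S \<in> max_elems (ideal_at M a)}"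
  shows "verts (red_quiver M) = insert [] (\<Union>(a, S)\<in>R. (#) (a, S) ` verts (red_quiver S))"
    and "arcs (red_quiver M) = (\<Union>(a, S)\<in>R. insert [(a, S)] ((#) (a, S) ` arcs (red_quiver S)))"
    and "tail (red_quiver M) [(a, S)] = [(a, S)]" "head (red_quiver M) [(a, S)] = []"
    and "red_vert Q x ((a, S) # p) = red_vert Q (tail Q a) p"
    and "red_arc [(a, S)] = a" "p \<noteq> [] \<Longrightarrow> red_arc ((a, S) # p) = red_arc p"
proof -
  have *: "red_path M p \<longleftrightarrow> p = [] \<or> (\<exists>a S q. p = (a, S) # q \<and> (a, S) \<in> R \<and> red_path S q)" for p
    by (cases "(M, p)" rule: red_path.cases) (auto simp: R_def)
  have "p \<in> verts (red_quiver M) \<longleftrightarrow>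
      p \<in> insert [] (\<Union>(a, S)\<in>R. (#) (a, S) ` verts (red_quiver S))" for p
    unfolding red_quiver_def using *[of p] by (cases p) (auto simp: image_iff)
  then show "verts (red_quiver M) = insert [] (\<Union>(a, S)\<in>R. (#) (a, S) ` verts (red_quiver S))"
    by blast
  have "p \<in> arcs (red_quiver M) \<longleftrightarrow>
      p \<in> (\<Union>(a, S)\<in>R. insert [(a, S)] ((#) (a, S) ` arcs (red_quiver S)))" for p
    unfolding red_quiver_def using *[of p] by (cases p) (auto simp: image_iff)
  then show "arcs (red_quiver M) = (\<Union>(a, S)\<in>R. insert [(a, S)] ((#) (a, S) ` arcs (red_quiver S)))"
    by blast
qed (auto simp: red_quiver_def red_vert_def red_arc_def)

definition reduced_rep :: "('v, 'e) pre_digraph \<Rightarrow> 'v \<Rightarrow> 'e lat \<Rightarrow>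
    ('k::field, ('e \<times> 'e lat) list \<Rightarrow> 'k, 'v, 'e) rep" where
  "reduced_rep Q x M = pushforward (red_quiver M) (red_vert Q x) red_arc unit_rep"

definition surj_subrep ::
    "('v, 'e) pre_digraph \<Rightarrow> ('k::field, 'm::ab_group_add, 'v, 'e) rep \<Rightarrow> ('v \<Rightarrow> 'm set) \<Rightarrow> bool" where
  "surj_subrep Q V U \<longleftrightarrow> subrep Q V U \<and> (\<forall>a\<in>arcs Q. map_at V a ` U (tail Q a) = U (head Q a))"

definition max_surj_subrep ::
    "('v, 'e) pre_digraph \<Rightarrow> ('k::field, 'm::ab_group_add, 'v, 'e) rep \<Rightarrow> ('v \<Rightarrow> 'm set) \<Rightarrow> bool" where
  "max_surj_subrep Q V E \<longleftrightarrow> surj_subrep Q V E \<and>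
     (\<forall>F. surj_subrep Q V F \<and> (\<forall>x\<in>verts Q. E x \<subseteq> F x) \<longrightarrow> (\<forall>x\<in>verts Q. F x = E x))"

text \<open>The value \<open>{0}\<close> off the vertices only serves to make the family unique.\<close>

definition surj_part ::
    "('v, 'e) pre_digraph \<Rightarrow> ('k::field, 'm::ab_group_add, 'v, 'e) rep \<Rightarrow> ('v \<Rightarrow> 'm set)" where
  "surj_part Q V = (THE E. max_surj_subrep Q V E \<and> (\<forall>x. x \<notin> verts Q \<longrightarrow> E x = {0}))"

lemma image_span:
  assumes "module s" and f: "linear_on s s A f" and A: "module.subspace s A" and S: "S \<subseteq> A"
  shows "f ` module.span s S = module.span s (f ` S)"
proof -
  interpret module s by (rule assms(1))
  have spA: "span S \<subseteq> A" using A S span_minimal by blast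
  have f0: "f 0 = 0"
  proof -
    have "f (s 0 0) = s 0 (f 0)" using f subspace_0[OF A] unfolding linear_on_def by blast
    then show ?thesis by simp
  qed
  have add: "f (u + v) = f u + f v" if "u \<in> span S" "v \<in> span S" for u v
    using f that spA unfolding linear_on_def by blast
  have sc: "f (s c u) = s c (f u)" if "u \<in> span S" for c u
    using f that spA unfolding linear_on_def by blast
  have "subspace (f ` span S)"
  proof (rule subspaceI)
    show "0 \<in> f ` span S" using f0 span_zero by (metis imageI)
    show "x + y \<in> f ` span S" if "x \<in> f ` span S" "y \<in> f ` span S" for x y
      using that add span_add by (auto simp: image_iff) metis
    show "s c x \<in> f ` span S" if "x \<in> f ` span S" for c x
      using that sc span_scale by (auto simp: image_iff) metis
  qed
  then have "span (f ` S) \<subseteq> f ` span S"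
    using span_superset by (intro span_minimal) auto
  moreover have "f x \<in> span (f ` S)" if "x \<in> span S" for x
  proof -
    have "x \<in> span S \<and> f x \<in> span (f ` S)"
      using that
    proof (induction rule: span_induct_alt)
      case base
      then show ?case by (simp add: f0 span_zero)
    next
      case (step c x y)
      then show ?case using add sc
        by (simp add: span_base span_scale span_add)
    qed
    then show ?thesis ..
  qed
  ultimately show ?thesis by blast
qed

lemma surj_part_ex1:
  assumes "wf_digraph Q" and V: "is_rep Q V"
  shows "\<exists>!E. max_surj_subrep Q V E \<and> (\<forall>x. x \<notin> verts Q \<longrightarrow> E x = {0})"
proof -
  interpret wf_digraph Q by (rule assms(1))
  interpret vector_space "scl V" using V by (simp add: is_rep_def)
  define E where
    "E x = (if x \<in> verts Q then span (\<Union>{F x | F. surj_subrep Q V F}) else {0})" for x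
  have sp: "subspace (spc V x)" if "x \<in> verts Q" for x
    using V that unfolding is_rep_def by (metis subspace_span)
  have sub: "\<Union>{F x | F. surj_subrep Q V F} \<subseteq> spc V x" if "x \<in> verts Q" for x
    using that by (auto simp: surj_subrep_def subrep_def)
  have ge: "F x \<subseteq> E x" if "surj_subrep Q V F" "x \<in> verts Q" for F x
    using that span_superset[of "\<Union>{F x | F. surj_subrep Q V F}"] by (auto simp: E_def)
  have im: "map_at V a ` E (tail Q a) = E (head Q a)" if a: "a \<in> arcs Q" for a
  proof -
    have "map_at V a ` \<Union>{F (tail Q a) | F. surj_subrep Q V F} = \<Union>{F (head Q a) | F. surj_subrep Q V F}"
      (is "?l = ?r")
    proof -
      have F: "map_at V a ` F (tail Q a) = F (head Q a)" if "surj_subrep Q V F" for F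
        using that a by (simp add: surj_subrep_def)
      have "?l = (\<Union>F\<in>Collect (surj_subrep Q V). map_at V a ` F (tail Q a))"
        by (simp only: setcompr_eq_image image_UN)
      also have "\<dots> = (\<Union>F\<in>Collect (surj_subrep Q V). F (head Q a))"
        using F by (intro SUP_cong) auto
      finally show ?thesis by (simp only: setcompr_eq_image)
    qed
    moreover have "linear_on (scl V) (scl V) (spc V (tail Q a)) (map_at V a)"
      using V a by (simp add: is_rep_def)
    ultimately show ?thesis
      using a image_span[OF module_axioms _ sp sub, of "tail Q a" "map_at V a"] by (simp add: E_def)
  qed
  have "subspace (E x) \<and> E x \<subseteq> spc V x" if "x \<in> verts Q" for x
    using that span_minimal[OF sub sp] by (simp add: E_def)
  with im have "subrep Q V E" by (simp add: subrep_def)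
  with im have E: "surj_subrep Q V E" by (simp add: surj_subrep_def)
  show ?thesis
  proof (rule ex1I[of _ E])
    show "max_surj_subrep Q V E \<and> (\<forall>x. x \<notin> verts Q \<longrightarrow> E x = {0})"
      unfolding max_surj_subrep_def using E ge by (auto simp: E_def)
  next
    fix M assume M: "max_surj_subrep Q V M \<and> (\<forall>x. x \<notin> verts Q \<longrightarrow> M x = {0})"
    then have "\<forall>x\<in>verts Q. M x \<subseteq> E x" using ge by (auto simp: max_surj_subrep_def)
    then have "\<forall>x\<in>verts Q. E x = M x" using M E unfolding max_surj_subrep_def by blast
    then show "M = E" using M by (auto simp: fun_eq_iff E_def)
  qed
qed

definition global_rank ::
    "('v, 'e) pre_digraph \<Rightarrow> 'v \<Rightarrow> ('k::field, 'm::ab_group_add, 'v, 'e) rep \<Rightarrow> 'm set" where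
  "global_rank Q \<sigma> V = surj_part Q V \<sigma>"

definition rank ::
    "('v, 'e) pre_digraph \<Rightarrow> 'v \<Rightarrow> 'e lat \<Rightarrow> ('k::field, 'm::ab_group_add, 'v, 'e) rep \<Rightarrow> 'm set" where
  "rank Q x M V = global_rank (red_quiver M) [] (pullback (red_vert Q x) red_arc V)"

text \<open>The relation written \<open>U \<simeq> \<Omega>\<^sub>N \<otimes> Z\<close>, for \<open>U\<close> inside \<open>X\<close> and a subspace \<open>Z\<close> of \<open>X\<close> at the root.\<close>

definition iso_reduced_tensor ::
    "('v, 'e) pre_digraph \<Rightarrow> 'v \<Rightarrow> ('k::field, 'm::ab_group_add, 'v, 'e) rep \<Rightarrow> ('v \<Rightarrow> 'm set) \<Rightarrow>
     'e lat \<Rightarrow> 'm set \<Rightarrow> bool" where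
  "iso_reduced_tensor Q \<sigma> X U N Z \<longleftrightarrow>
     rep_iso Q (restr X U) (copies (vector_space.dim (scl X) Z) (reduced_rep Q \<sigma> N)) \<and> U \<sigma> = Z"

end

theory Submission
  imports Defs
begin

text \<open>
  The proof constructs two families of linear maps, indexed by the vertices \<open>p\<close> of the reduced
  quiver of \<open>N\<close>, that realise a sum of copies of the reduced representation inside \<open>V\<^sup>\<otimes>\<^sup>l\<close> and split
  it off. Let \<open>S\<^sub>p\<close> be the lattice element at which the path \<open>p\<close> ends, \<open>R\<close> the rank of \<open>V\<close> at \<open>N\<close>, and
  \<open>Z\<close> that of \<open>V\<^sup>\<otimes>\<^sup>l\<close>, which is the \<open>l\<close>-th tensor power of \<open>R\<close> (\<open>rank_tensor_power\<close>).

  \<^emph>\<open>Sections.\<close> A vector lies in the rank at \<open>N\<close> iff it has compatible preimages along all arrows of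
  the reduced quiver (\<open>rank_eq_liftings\<close>). Hence there are linear maps \<open>s\<^sub>p\<close> from \<open>Z\<close> to the space below
  \<open>p\<close>, with values in the rank at \<open>S\<^sub>p\<close>, that are compatible with the arrows and start with the
  inclusion of \<open>Z\<close> (\<open>exists_sections\<close>). They assemble to a morphism from \<open>\<Omega>\<^sub>N \<otimes> Z\<close> to \<open>V\<^sup>\<otimes>\<^sup>l\<close>.

  \<^emph>\<open>Projections.\<close> In the opposite direction one needs maps \<open>\<pi>\<^sub>p\<close> into \<open>Z\<close> such that, for an arrow \<open>a\<close>
  into the vertex below \<open>p\<close>, the composite of \<open>\<pi>\<^sub>p\<close> with \<open>a\<close> is the sum of the \<open>\<pi>\<^sub>q\<close> over the
  predecessors \<open>q\<close> of \<open>p\<close> along \<open>a\<close>. They are required to vanish on the rank at each \<open>T\<close> not below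
  \<open>S\<^sub>p\<close>. This is where tensor powers enter. By maximality of \<open>N\<close> and because ranks turn joins
  into intersections, \<open>R\<close> meets the rank at every \<open>T\<close> not below \<open>N\<close> in 0, so that there is a projector
  onto \<open>R\<close> that kills this one rank. In general no projector kills all of them, but a product
  of projectors, with many factors for each \<open>T\<close>, does (\<open>exists_initial_list\<close>). Composing such a product
  with an arrow \<open>a\<close> yields a product in which many factors kill the rank at \<open>T\<close>, for each \<open>T\<close> outside of
  the ideal \<open>I\<close> of \<open>S\<^sub>p\<close> at \<open>a\<close>. It remains to write it as a sum, over the maximal elements \<open>S\<close> of
  \<open>I\<close>, of products in which many factors kill the rank at \<open>T\<close>, for each \<open>T\<close> not below \<open>S\<close>
  (\<open>tensor_op_split_ideal\<close>). If \<open>S\<close> is maximal in \<open>I\<close> and \<open>T\<close> is not below \<open>S\<close>, then the join of \<open>S\<close> and \<open>T\<close> is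
  outside of \<open>I\<close>, so many factors vanish on the intersection of the ranks at \<open>S\<close> and \<open>T\<close>. Each is a sum
  of a map that vanishes on the first and one that vanishes on the second. After expanding the
  product, every summand either has many factors killing the rank at \<open>T\<close> for all such \<open>T\<close>, as wanted
  for \<open>S\<close>, or has many factors killing the rank at \<open>S\<close>, and then \<open>I\<close> can be replaced by \<open>I - {S}\<close>.

  \<^emph>\<open>Splitting.\<close> The matrix of the \<open>\<pi>\<^sub>p s\<^sub>q\<close>, for paths \<open>p\<close> and \<open>q\<close> over the same vertex, need not be the
  identity, but it is unitriangular for a lexicographic order of the paths (\<open>proj_section\<close>).
  Therefore the sum of the images of the \<open>s\<^sub>p\<close> is direct, it is complementary to the common kernel of
  the \<open>\<pi>\<^sub>p\<close> (\<open>direct_sum\<close>), and both are subrepresentations. The rank of any complement is contained in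
  its intersection with \<open>Z\<close> at the root, hence 0.
\<close>

section \<open>Linear algebra\<close>

lemma linear_on_add: "linear_on s t A f \<Longrightarrow> u \<in> A \<Longrightarrow> v \<in> A \<Longrightarrow> f (u + v) = f u + f v"
  and linear_on_scale: "linear_on s t A f \<Longrightarrow> u \<in> A \<Longrightarrow> f (s c u) = t c (f u)"
  and linear_on_subset: "linear_on s t A f \<Longrightarrow> B \<subseteq> A \<Longrightarrow> linear_on s t B f"
  unfolding linear_on_def by blast+

lemma linear_on_compose:
  "linear_on s t A f \<Longrightarrow> linear_on t r B g \<Longrightarrow> f ` A \<subseteq> B \<Longrightarrow> linear_on s r A (\<lambda>v. g (f v))"
  by (auto simp: linear_on_def image_subset_iff)

lemma linear_on_zero:
  assumes "linear_on s t A f" "module s" "module t" "module.subspace s A"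
  shows "f 0 = 0"
proof -
  interpret s: module s by fact
  interpret t: module t by fact
  have "f (s 0 0) = t 0 (f 0)" using assms s.subspace_0 by (intro linear_on_scale)
  then show ?thesis by simp
qed

lemma linear_on_sum:
  assumes "linear_on s t A f" "module s" "module t" "module.subspace s A" "\<And>i. i \<in> I \<Longrightarrow> g i \<in> A"
  shows "f (\<Sum>i\<in>I. g i) = (\<Sum>i\<in>I. f (g i))"
proof -
  interpret s: module s by fact
  show ?thesis using assms(5)
  proof (induction I rule: infinite_finite_induct)
    case (insert i I)
    then have "f (g i + (\<Sum>i\<in>I. g i)) = f (g i) + f (\<Sum>i\<in>I. g i)"
      by (intro linear_on_add[OF assms(1)] s.subspace_sum[OF assms(4)]) auto
    then show ?case using insert by simp
  qed (simp_all add: linear_on_zero[OF assms(1-4)])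
qed

lemma linear_on_diff:
  assumes "linear_on s t A f" "module s" "module t" "module.subspace s A" "u \<in> A" "v \<in> A"
  shows "f (u - v) = f u - f v"
proof -
  interpret s: module s by fact
  have "f (u - v + v) = f (u - v) + f v"
    using assms s.subspace_diff by (intro linear_on_add)
  then show ?thesis by (simp add: algebra_simps)
qed

lemma subspace_linear_image:
  assumes "linear_on s t A f" "module s" "module t" "module.subspace s A"
  shows "module.subspace t (f ` A)"
proof -
  interpret s: module s by fact
  interpret t: module t by fact
  show ?thesis
  proof (rule t.subspaceI)
    show "0 \<in> f ` A" by (intro image_eqI[of _ f 0] linear_on_zero[OF assms, symmetric] s.subspace_0[OF assms(4)])
    show "x + y \<in> f ` A" if xy: "x \<in> f ` A" "y \<in> f ` A" for x y
    proof -
      obtain u v where "u \<in> A" "v \<in> A" "x = f u" "y = f v" using xy by blast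
      then have "x + y = f (u + v)" "u + v \<in> A"
        using s.subspace_add[OF assms(4)] linear_on_add[OF assms(1)] by auto
      then show ?thesis by (rule image_eqI)
    qed
    show "t c x \<in> f ` A" if x: "x \<in> f ` A" for c x
    proof -
      obtain u where "u \<in> A" "x = f u" using x by blast
      then have "t c x = f (s c u)" "s c u \<in> A"
        using s.subspace_scale[OF assms(4)] linear_on_scale[OF assms(1)] by auto
      then show ?thesis by (rule image_eqI)
    qed
  qed
qed

lemma linear_on_linear: "Vector_Spaces.linear s t f \<Longrightarrow> linear_on s t A f"
  unfolding linear_on_def Vector_Spaces.linear_iff by blast

text \<open>
  Extend a basis of \<open>A\<close> by elements of \<open>B\<close> to a basis of \<open>A + B\<close> and send the new basis elements
  to 0: what is subtracted from an element of \<open>B\<close> then lies in \<open>B\<close> again.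
\<close>

lemma exists_projector:
  assumes "vector_space s" and A: "module.subspace s A" and B: "module.subspace s B"
  obtains e where "linear_on s s UNIV e" "\<And>v. e v \<in> A" "\<And>v. v \<in> A \<Longrightarrow> e v = v"
    "\<And>v. v \<in> B \<Longrightarrow> e v \<in> A \<inter> B"
proof -
  interpret vector_space s by fact
  interpret vector_space_pair s s by unfold_locales
  obtain CA where CA: "CA \<subseteq> A" "independent CA" "A \<subseteq> span CA"
    by (rule basis_exists[of A])
  obtain D where D: "CA \<subseteq> D" "D \<subseteq> CA \<union> B" "independent D" "CA \<union> B \<subseteq> span D"
    by (rule maximal_independent_subset_extend[OF Un_upper1 CA(2), of B])
  obtain e where e: "Vector_Spaces.linear s s e" "\<And>x. x \<in> D \<Longrightarrow> e x = (if x \<in> CA then x else 0)"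
      "range e = span ((\<lambda>x. if x \<in> CA then x else 0) ` D)"
    using linear_independent_extend_subspace[OF D(3), of "\<lambda>x. if x \<in> CA then x else 0"] by blast
  interpret e: Vector_Spaces.linear s s e by (rule e(1))
  have eA: "e v \<in> A" for v
  proof -
    have "(\<lambda>x. if x \<in> CA then x else 0) ` D \<subseteq> A" using CA subspace_0[OF A] by auto
    then have "range e \<subseteq> A" unfolding e(3) using A span_minimal by blast
    then show ?thesis by blast
  qed
  have eid: "e v = v" if "v \<in> A" for v
  proof -
    have "v \<in> span CA" using that CA by blast
    then show ?thesis
    proof (induction rule: span_induct_alt)
      case base then show ?case by simp
    next
      case (step c x y) then show ?case using D e(2)[of x] by (auto simp: e.add e.scale)
    qed
  qed
  have eB: "v - e v \<in> B" if "v \<in> span D" for v using that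
  proof (induction rule: span_induct_alt)
    case base then show ?case by (simp add: subspace_0[OF B])
  next
    case (step c x y)
    have "x - e x \<in> B" using step(1) D e(2)[of x] subspace_0[OF B] by auto
    then have "s c (x - e x) + (y - e y) \<in> B"
      using step(2) subspace_add[OF B] subspace_scale[OF B] by blast
    then show ?case by (simp add: e.add e.scale algebra_simps)
  qed
  show ?thesis
  proof (rule that[of e])
    show "linear_on s s UNIV e" using e(1) by (rule linear_on_linear)
    show "e v \<in> A \<inter> B" if "v \<in> B" for v
    proof -
      have "v - (v - e v) \<in> B" using that eB D subspace_diff[OF B] by blast
      then show ?thesis using eA by simp
    qed
  qed (auto intro: eA eid)
qed

text \<open>Project to \<open>B\<close> first, which makes the map linear on the whole ambient space.\<close>

lemma exists_section:
  assumes "vector_space s" and f: "linear_on s s A f" and B: "module.subspace s B" "B \<subseteq> A"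
  obtains g where "linear_on s s UNIV g" "\<And>v. g v \<in> B" "\<And>v. v \<in> f ` B \<Longrightarrow> f (g v) = v"
proof -
  interpret vector_space s by fact
  interpret vector_space_pair s s by unfold_locales
  obtain e where e: "linear_on s s UNIV e" "\<And>v. e v \<in> B" "\<And>v. v \<in> B \<Longrightarrow> e v = v"
      "\<And>v. v \<in> B \<Longrightarrow> e v \<in> B \<inter> B"
    by (rule exists_projector[OF assms(1) B(1) B(1)], rule that)
  have "linear_on s s UNIV (\<lambda>v. f (e v))"
    by (rule linear_on_compose[OF e(1) f]) (use e(2) B(2) in blast)
  then have lin: "Vector_Spaces.linear s s (\<lambda>v. f (e v))"
    unfolding Vector_Spaces.linear_iff linear_on_def using vector_space_axioms by blast
  obtain g where g: "range g \<subseteq> B" "Vector_Spaces.linear s s g" "\<And>v. v \<in> (\<lambda>v. f (e v)) ` B \<Longrightarrow> f (e (g v)) = v"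
    using linear_exists_right_inverse_on[OF lin B(1)] by blast
  show ?thesis
  proof (rule that[of g])
    show "f (g v) = v" if "v \<in> f ` B" for v
    proof -
      have "v \<in> (\<lambda>v. f (e v)) ` B" using that e by auto
      then have "f (e (g v)) = v" by (rule g(3))
      moreover have "g v \<in> B" using g(1) by blast
      ultimately show ?thesis using e(3)[of "g v"] by simp
    qed
    show "linear_on s s UNIV g" using g(2) by (rule linear_on_linear)
  qed (use g(1) in auto)
qed

lemma finite_basis_of_subspace:
  assumes "vector_space s" "finite S" "A \<subseteq> module.span s S" "module.subspace s A"
  obtains B where "finite B" "\<not> module.dependent s B" "module.span s B = A" "card B = vector_space.dim s A"
proof -
  interpret vector_space s by fact
  obtain B where "B \<subseteq> A" "independent B" "A \<subseteq> span B" "card B = dim A"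
    by (rule basis_exists[of A])
  moreover have "finite B"
    using independent_span_bound assms(2,3) calculation by blast
  ultimately show ?thesis using that span_minimal[of B A] assms(4) by blast
qed

section \<open>Rooted trees\<close>

text \<open>
  A directed cycle, and likewise a pair of distinct directed walks with the same ends, would give a
  cycle of the underlying graph. So the arrows of a rooted tree are well-founded and every vertex
  but the root is the tail of exactly one arrow.
\<close>

lemma double_simps:
  "tail (double Q) (a, False) = tail Q a" "head (double Q) (a, False) = head Q a"
  "tail (double Q) (a, True) = head Q a" "head (double Q) (a, True) = tail Q a"
  "verts (double Q) = verts Q" "arcs (double Q) = arcs Q \<times> UNIV"
  by (simp_all add: double_def)

lemma wf_digraph_double: "wf_digraph Q \<Longrightarrow> wf_digraph (double Q)"
  by (auto simp: wf_digraph_def double_def)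

lemma cas_double_forward:
  "pre_digraph.cas Q x p y \<Longrightarrow> pre_digraph.cas (double Q) x (map (\<lambda>a. (a, False)) p) y"
  by (induction p arbitrary: x) (auto simp: pre_digraph.cas.simps double_simps)

lemma awalk_double_forward:
  "pre_digraph.awalk Q x p y \<Longrightarrow> pre_digraph.awalk (double Q) x (map (\<lambda>a. (a, False)) p) y"
  using cas_double_forward[of Q x p y] by (auto simp: pre_digraph.awalk_def double_simps)

lemma cas_append:
  "pre_digraph.cas Q x (p @ q) z \<longleftrightarrow> (\<exists>y. pre_digraph.cas Q x p y \<and> pre_digraph.cas Q y q z)"
  by (induction p arbitrary: x) (auto simp: pre_digraph.cas.simps)

lemma cas_double_backward:
  "pre_digraph.cas Q x p y \<Longrightarrow> pre_digraph.cas (double Q) y (rev (map (\<lambda>a. (a, True)) p)) x"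
  by (induction p arbitrary: x)
    (auto simp: pre_digraph.cas.simps cas_append double_simps)

context
  fixes Q :: "('v, 'e) pre_digraph" and \<sigma>
  assumes tree: "rooted_tree Q \<sigma>"
begin

interpretation fin_digraph Q using tree by (simp add: rooted_tree_def)
interpretation D: wf_digraph "double Q" using wf_digraph_double wf_digraph .

lemma no_double_cycle: "D.cycle p \<Longrightarrow> \<not> distinct (map fst p)"
  using tree by (auto simp: rooted_tree_def underlying_tree_def)

lemma tree_no_closed_walk: "\<not> closed_w p"
proof
  assume "closed_w p"
  then obtain q u where q: "awalk u q u" "distinct (tl (awalk_verts u q))" "q \<noteq> []" "distinct q"
    using closed_w_imp_cycle unfolding cycle_conv by blast
  let ?q = "map (\<lambda>a. (a, False)) q"
  have w: "D.awalk u ?q u" by (rule awalk_double_forward[OF q(1)])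
  have "awalk_verts u q = D.awalk_verts u ?q"
    by (simp add: awalk_verts_conv D.awalk_verts_conv comp_def double_simps last_map)
  then have "D.cycle ?q" using w q by (auto simp: D.cycle_def)
  then show False using no_double_cycle[of ?q] q by (simp add: comp_def)
qed

lemma tree_walk_distinct: "awalk x p y \<Longrightarrow> distinct (awalk_verts x p)"
  using awalk_not_distinct_decomp tree_no_closed_walk by (metis closed_w_def)

text \<open>
  In a counterexample of minimal total length the two walks can only meet at their ends, as
  cutting both at a common vertex or arrow would give a smaller counterexample. Running
  through one and back through the other is then a cycle of the underlying graph.
\<close>

lemma tree_walk_unique: "awalk x p y \<Longrightarrow> awalk x q y \<Longrightarrow> p = q"
proof (induction "length p + length q" arbitrary: x p q y rule: less_induct)
  case less
  show ?case
  proof (rule ccontr)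
    assume ne: "p \<noteq> q"
    have n: "p \<noteq> []" "q \<noteq> []"
      using ne less.prems tree_no_closed_walk[of p] tree_no_closed_walk[of q]
      by (auto simp: awalk_Nil_iff closed_w_def)
    have cut: False if "p = p1 @ p2" "q = q1 @ q2" "awalk x p1 w" "awalk x q1 w"
      "p1 \<noteq> []" "q2 \<noteq> []" for p1 p2 q1 q2 w
    proof -
      have "awlast x p1 = w" "awlast x q1 = w" using that by auto
      then have "awalk w p2 y" "awalk w q2 y" using that less.prems by auto
      then have "p1 = q1" "p2 = q2"
        using that less.hyps[of p1 q1 x w] less.hyps[of p2 q2 w y] by auto
      then show False using ne that by simp
    qed
    have disj: "set (map (head Q) p) \<inter> set (map (tail Q) q) = {}"
    proof (rule ccontr)
      assume "\<not> ?thesis"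
      then obtain a b where ab: "a \<in> set p" "b \<in> set q" "head Q a = tail Q b" by auto
      obtain p1 p2 q1 q2 where s: "p = p1 @ a # p2" "q = q1 @ b # q2"
        using ab by (meson split_list)
      have "awalk x (p1 @ [a]) (head Q a)"
        using less.prems(1) unfolding s by (auto simp: awalk_Cons_iff awalk_Nil_iff)
      moreover have "awalk x q1 (tail Q b)"
        using less.prems(2) unfolding s by (auto simp: awalk_Cons_iff)
      ultimately show False using cut[of "p1 @ [a]" p2 q1 "b # q2" "head Q a"] s ab by simp
    qed
    have arcs_disj: "set p \<inter> set q = {}"
    proof (rule ccontr)
      assume "\<not> ?thesis"
      then obtain a where ab: "a \<in> set p" "a \<in> set q" by auto
      obtain p1 p2 q1 q2 where s: "p = p1 @ a # p2" "q = q1 @ a # q2"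
        using ab by (meson split_list)
      have w: "awalk x p1 (tail Q a)" "awalk x q1 (tail Q a)"
         "awalk (head Q a) p2 y" "awalk (head Q a) q2 y"
        using less.prems unfolding s by (auto simp: awalk_Cons_iff)
      have "p1 = q1" "p2 = q2"
        using w s less.hyps[of p1 q1 x "tail Q a"] less.hyps[of p2 q2 "head Q a" y] by auto
      then show False using ne s by simp
    qed
    let ?c = "map (\<lambda>a. (a, False)) p @ rev (map (\<lambda>a. (a, True)) q)"
    have cas: "D.cas x ?c x"
      using less.prems awalk_double_forward[of Q x p y] cas_double_backward[of Q x q y]
      by (auto simp: cas_append D.awalk_def)
    moreover have "set ?c \<subseteq> arcs (double Q)" "x \<in> verts (double Q)"
      using less.prems by (auto simp: double_simps)
    ultimately have "D.awalk x ?c x" by (simp add: D.awalk_def)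
    moreover have "distinct (tl (D.awalk_verts x ?c))"
    proof -
      have "tl (D.awalk_verts x ?c) = map (head Q) p @ rev (map (tail Q) q)"
        using D.awalk_verts_conv'[OF cas] n by (simp add: comp_def rev_map double_simps)
      moreover have "distinct (map (head Q) p)"
        using tree_walk_distinct[OF less.prems(1)] awalk_verts_conv'[of x p y] less.prems(1) n
        by (auto simp: awalk_def)
      moreover have "distinct (map (tail Q) q)"
        using tree_walk_distinct[OF less.prems(2)] n by (simp add: awalk_verts_conv)
      ultimately show ?thesis using disj by auto
    qed
    ultimately have "D.cycle ?c" using n by (auto simp: D.cycle_def)
    moreover have "distinct (map fst ?c)"
      using arcs_disj distinct_verts_imp_distinct tree_walk_distinct less.prems
      by (auto simp: comp_def rev_map[symmetric])
    ultimately show False using no_double_cycle by blast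
  qed
qed

lemma tree_arcs_wf: "wf {(tail Q a, head Q a) | a. a \<in> arcs Q}" (is "wf ?r")
proof (rule finite_acyclic_wf)
  show "finite ?r" by (simp add: setcompr_eq_image)
  have "\<exists>p. awalk x p y \<and> p \<noteq> []" if "(x, y) \<in> ?r\<^sup>+" for x y
    using that
  proof (induction rule: trancl_induct)
    case (base y)
    then show ?case using arc_implies_awalk by blast
  next
    case (step y z)
    then show ?case using arc_implies_awalk awalk_appendI by blast
  qed
  then show "acyclic ?r" using tree_no_closed_walk by (auto simp: acyclic_def closed_w_def)
qed

lemma tree_walk_to_root: "x \<in> verts Q \<Longrightarrow> \<exists>p. awalk x p \<sigma>"
proof -
  have "wf ({(tail Q a, head Q a) | a. a \<in> arcs Q}\<inverse>)" (is "wf (?r\<inverse>)")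
  proof (rule finite_acyclic_wf_converse)
    show "finite ?r" by (simp add: setcompr_eq_image)
    show "acyclic ?r" using tree_arcs_wf by (rule wf_acyclic)
  qed
  then show "x \<in> verts Q \<Longrightarrow> \<exists>p. awalk x p \<sigma>"
  proof (induction x rule: wf_induct_rule)
    case (less x)
    show ?case
    proof (cases "x = \<sigma>")
      case True
      then show ?thesis using less.prems awalk_Nil_iff by blast
    next
      case False
      then obtain a where a: "a \<in> arcs Q" "tail Q a = x"
        using tree less.prems by (auto simp: rooted_tree_def out_arcs_def)
      then obtain p where "awalk (head Q a) p \<sigma>" using less.IH[of "head Q a"] by auto
      then have "awalk x (a # p) \<sigma>" using a by (auto simp: awalk_Cons_iff)
      then show ?thesis by blast
    qed
  qed
qed

lemma tree_root: "\<sigma> \<in> verts Q" "a \<in> arcs Q \<Longrightarrow> tail Q a \<noteq> \<sigma>"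
  using tree by (auto simp: rooted_tree_def out_arcs_def)

lemma tree_tail_inj:
  assumes "a \<in> arcs Q" "b \<in> arcs Q" "tail Q a = tail Q b"
  shows "a = b"
proof -
  obtain p q where "awalk (head Q a) p \<sigma>" "awalk (head Q b) q \<sigma>"
    using tree_walk_to_root assms by (meson head_in_verts)
  then have "awalk (tail Q a) (a # p) \<sigma>" "awalk (tail Q a) (b # q) \<sigma>"
    using assms by (auto simp: awalk_Cons_iff)
  then have "a # p = b # q" by (rule tree_walk_unique)
  then show ?thesis by simp
qed

end

section \<open>Paths in reduced quivers\<close>

text \<open>
  The part of the reduced quiver of \<open>M\<close> above the path \<open>p\<close> is the reduced quiver of this element.
\<close>

definition last_lat :: "'e lat \<Rightarrow> ('e \<times> 'e lat) list \<Rightarrow> 'e lat" where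
  "last_lat M p = (if p = [] then M else snd (last p))"

lemma last_lat_simps [simp]:
  "last_lat M [] = M" "last_lat M (p @ [(a, S)]) = S" "last_lat M ((a, S) # p) = last_lat S p"
  by (auto simp: last_lat_def)

lemma red_vert_simps [simp]:
  "red_vert Q x [] = x" "red_vert Q x (p @ [(a, S)]) = tail Q a"
  "red_vert Q x ((a, S) # p) = red_vert Q (tail Q a) p"
  by (auto simp: red_vert_def)

lemma red_path_snoc [simp]:
  "red_path M (p @ [(a, S)]) \<longleftrightarrow> red_path M p \<and> S \<in> max_elems (ideal_at (last_lat M p) a)"
  by (induction M p rule: red_path.induct) auto

lemma finite_ideal_at [simp]: "finite (ideal_at M a)"
  by (cases M) simp

lemma max_elems_subset: "max_elems I \<subseteq> I"
  by (auto simp: max_elems_def)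

lemma max_elemsD: "S \<in> max_elems I \<Longrightarrow> S \<in> I"
  by (simp add: max_elems_def)

lemma finite_max_elems [simp]: "finite (max_elems (ideal_at M a))"
  by (rule finite_subset[OF max_elems_subset finite_ideal_at])

lemma below_max_elem:
  assumes "finite I" "S \<in> I"
  shows "\<exists>T\<in>max_elems I. S \<le> T"
proof -
  obtain m where "m \<in> I" "S \<le> m" "\<forall>b\<in>I. m \<le> b \<longrightarrow> m = b"
    using finite_has_maximal2[OF assms] by blast
  then have "m \<in> max_elems I" unfolding max_elems_def by (auto simp: less_le)
  with \<open>S \<le> m\<close> show ?thesis by blast
qed

lemma max_elems_le_eq: "S \<in> max_elems I \<Longrightarrow> T \<in> max_elems I \<Longrightarrow> S \<le> T \<Longrightarrow> S = T"
  by (auto simp: max_elems_def order_le_less)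

text \<open>
  Reduced quivers and ranks are recursive in the elements of the ideals of \<open>M\<close>.
\<close>

lemma lat_induct [case_names ideal]:
  assumes "\<And>M. (\<And>a S. S \<in> ideal_at M a \<Longrightarrow> P S) \<Longrightarrow> P M"
  shows "P M"
proof (induction M)
  case (Fam F)
  then show ?case by (intro assms[of "Fam F"]) auto
qed

lemma lattice_ideal:
  assumes "M \<in> lattice Q x" "S \<in> ideal_at M a"
  shows "a \<in> arcs Q" "head Q a = x" "S \<in> lattice Q (tail Q a)"
    "T \<in> lattice Q (tail Q a) \<Longrightarrow> T \<le> S \<Longrightarrow> T \<in> ideal_at M a"
proof -
  have *: "a \<in> in_arcs Q x \<and> in_lattice Q (tail Q a) S \<and>
     (\<forall>T. T \<le> S \<longrightarrow> in_lattice Q (tail Q a) T \<longrightarrow> T \<in> ideal_at M a)"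
    using assms in_lattice.simps[of Q x M] unfolding lattice_def by blast
  then show "a \<in> arcs Q" "head Q a = x" "S \<in> lattice Q (tail Q a)"
    by (auto simp: lattice_def)
  show "T \<in> lattice Q (tail Q a) \<Longrightarrow> T \<le> S \<Longrightarrow> T \<in> ideal_at M a"
    using * by (auto simp: lattice_def)
qed

lemma latticeI:
  assumes "\<And>a S. S \<in> ideal_at M a \<Longrightarrow> a \<in> arcs Q \<and> head Q a = x \<and> S \<in> lattice Q (tail Q a)"
    and "\<And>a S T. S \<in> ideal_at M a \<Longrightarrow> T \<in> lattice Q (tail Q a) \<Longrightarrow> T \<le> S \<Longrightarrow> T \<in> ideal_at M a"
  shows "M \<in> lattice Q x"
  using assms unfolding lattice_def in_lattice.simps[of Q x M] mem_Collect_eq in_arcs_def by blast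

lemma red_path_lattice:
  assumes "M \<in> lattice Q x" "red_path M p"
  shows "last_lat M p \<in> lattice Q (red_vert Q x p)"
  using assms(2)
proof (induction p rule: rev_induct)
  case (snoc b p)
  then show ?case
    using lattice_ideal(3) max_elems_subset by (cases b) fastforce
qed (simp add: assms(1))

lemma red_path_arc:
  assumes "M \<in> lattice Q x" "red_path M (p @ [(a, S)])"
  shows "a \<in> arcs Q" "head Q a = red_vert Q x p"
  using lattice_ideal(1,2)[OF red_path_lattice[OF assms(1)], of p S a] assms(2) max_elems_subset
  by auto

lemma red_path_verts:
  assumes "wf_digraph Q" "x \<in> verts Q" "M \<in> lattice Q x" "red_path M p"
  shows "red_vert Q x p \<in> verts Q"
proof (cases p rule: rev_cases)
  case (snoc q b)
  then show ?thesis using red_path_arc(1)[OF assms(3), of q] assms wf_digraph.tail_in_verts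
    by (cases b) fastforce
qed (simp add: assms)

lemma finite_red_paths:
  assumes "finite (arcs Q)" "M \<in> lattice Q x"
  shows "finite {p. red_path M p}"
  using assms(2)
proof (induction M arbitrary: x rule: lat_induct)
  case (ideal M)
  have "{p. red_path M p} \<subseteq> insert [] (\<Union>a\<in>arcs Q. \<Union>S\<in>max_elems (ideal_at M a). (#) (a, S) ` {p. red_path S p})"
  proof
    fix p assume p: "p \<in> {p. red_path M p}"
    show "p \<in> insert [] (\<Union>a\<in>arcs Q. \<Union>S\<in>max_elems (ideal_at M a). (#) (a, S) ` {p. red_path S p})"
    proof (cases p)
      case (Cons b q)
      then obtain a S where b: "p = (a, S) # q" by (cases b) auto
      then have S: "S \<in> max_elems (ideal_at M a)" "red_path S q" using p by auto
      then have "a \<in> arcs Q" using lattice_ideal(1)[OF ideal.prems] max_elems_subset by blast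
      then show ?thesis using S b by blast
    qed simp
  qed
  moreover have "finite {p. red_path S p}" if "S \<in> max_elems (ideal_at M a)" for a S
  proof -
    have S: "S \<in> ideal_at M a" using that max_elems_subset[of "ideal_at M a"] by blast
    show ?thesis by (rule ideal.IH[OF S lattice_ideal(3)[OF ideal.prems S]])
  qed
  ultimately show ?case using assms(1) by (elim finite_subset) auto
qed

lemma red_quiver_simps [simp]:
  "verts (red_quiver M) = {p. red_path M p}" "arcs (red_quiver M) = {p. red_path M p \<and> p \<noteq> []}"
  "tail (red_quiver M) = id" "head (red_quiver M) = butlast"
  by (simp_all add: red_quiver_def)

lemma wf_red_quiver: "wf_digraph (red_quiver M)"
proof -
  have "red_path M (butlast p)" if "red_path M p" for p
    using that by (cases p rule: rev_cases) auto
  then show ?thesis by (auto simp: wf_digraph_def)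
qed

section \<open>Ranks as sets of liftable vectors\<close>

lemma is_rep_simps:
  assumes "is_rep Q V"
  shows "vector_space (scl V)" "module (scl V)" "x \<in> verts Q \<Longrightarrow> module.subspace (scl V) (spc V x)"
    "a \<in> arcs Q \<Longrightarrow> linear_on (scl V) (scl V) (spc V (tail Q a)) (map_at V a)"
    "a \<in> arcs Q \<Longrightarrow> v \<in> spc V (tail Q a) \<Longrightarrow> map_at V a v \<in> spc V (head Q a)"
proof -
  show vs: "vector_space (scl V)" using assms by (simp add: is_rep_def)
  then interpret vector_space "scl V" .
  show "module (scl V)" by (rule module_axioms)
  show "subspace (spc V x)" if "x \<in> verts Q"
    using assms that subspace_span unfolding is_rep_def by metis
  show "linear_on (scl V) (scl V) (spc V (tail Q a)) (map_at V a)" if "a \<in> arcs Q"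
    using assms that by (simp add: is_rep_def)
  show "map_at V a v \<in> spc V (head Q a)" if "a \<in> arcs Q" "v \<in> spc V (tail Q a)"
    using assms that unfolding is_rep_def by blast
qed

text \<open>
  A maximal element among the subrepresentations with surjective arrows is the greatest one because
  these subrepresentations are closed under sums.
\<close>

lemma surj_part_greatest:
  assumes "wf_digraph Q" "is_rep Q V"
  shows "surj_subrep Q V (surj_part Q V)"
    and "surj_subrep Q V F \<Longrightarrow> x \<in> verts Q \<Longrightarrow> F x \<subseteq> surj_part Q V x"
proof -
  let ?E = "surj_part Q V"
  interpret wf_digraph Q by fact
  interpret vector_space "scl V" using assms by (simp add: is_rep_def)
  have E: "max_surj_subrep Q V ?E"
    using theI'[OF surj_part_ex1[OF assms]] unfolding surj_part_def by blast
  then show sE: "surj_subrep Q V ?E" by (simp add: max_surj_subrep_def)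
  assume F: "surj_subrep Q V F" and x: "x \<in> verts Q"
  let ?G = "\<lambda>x. {u + v | u v. u \<in> ?E x \<and> v \<in> F x}"
  have sub: "subspace (?E y)" "subspace (F y)" "?E y \<subseteq> spc V y" "F y \<subseteq> spc V y" if "y \<in> verts Q" for y
    using sE F that by (auto simp: surj_subrep_def subrep_def)
  have "surj_subrep Q V ?G"
    unfolding surj_subrep_def subrep_def
  proof (intro conjI ballI)
    fix y assume y: "y \<in> verts Q"
    show "subspace (?G y)" using sub[OF y] by (intro subspace_sums)
    show "?G y \<subseteq> spc V y"
      using sub[OF y] subspace_add[OF is_rep_simps(3)[OF assms(2) y]] by blast
  next
    fix a assume a: "a \<in> arcs Q"
    then have t: "tail Q a \<in> verts Q" by simp
    have im: "map_at V a ` ?E (tail Q a) = ?E (head Q a)" "map_at V a ` F (tail Q a) = F (head Q a)"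
      using sE F a by (auto simp: surj_subrep_def)
    have ad: "map_at V a (u + v) = map_at V a u + map_at V a v"
      if "u \<in> ?E (tail Q a)" "v \<in> F (tail Q a)" for u v
      using is_rep_simps(4)[OF assms(2) a] that sub[OF t] unfolding linear_on_def by blast
    show "map_at V a ` ?G (tail Q a) = ?G (head Q a)"
    proof
      show "map_at V a ` ?G (tail Q a) \<subseteq> ?G (head Q a)"
      proof
        fix w assume "w \<in> map_at V a ` ?G (tail Q a)"
        then obtain u v where uv: "u \<in> ?E (tail Q a)" "v \<in> F (tail Q a)" "w = map_at V a (u + v)"
          by blast
        then have "w = map_at V a u + map_at V a v" using ad by simp
        then show "w \<in> ?G (head Q a)" using uv im by blast
      qed
      show "?G (head Q a) \<subseteq> map_at V a ` ?G (tail Q a)"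
      proof
        fix w assume "w \<in> ?G (head Q a)"
        then obtain u v where uv: "u \<in> ?E (tail Q a)" "v \<in> F (tail Q a)" "w = map_at V a u + map_at V a v"
          unfolding im[symmetric] by blast
        then have "w = map_at V a (u + v)" using ad by simp
        then show "w \<in> map_at V a ` ?G (tail Q a)" using uv by blast
      qed
    qed
    then show "map_at V a ` ?G (tail Q a) \<subseteq> ?G (head Q a)" by simp
  qed
  moreover have "\<forall>y\<in>verts Q. ?E y \<subseteq> ?G y"
  proof (intro ballI subsetI)
    fix y u assume "y \<in> verts Q" "u \<in> ?E y"
    then have "u = u + 0" "0 \<in> F y" using sub(2) subspace_0 by auto
    then show "u \<in> ?G y" using \<open>u \<in> ?E y\<close> by blast
  qed
  ultimately have "?G x = ?E x" using E x unfolding max_surj_subrep_def by blast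
  moreover have "F x \<subseteq> ?G x"
  proof
    fix v assume "v \<in> F x"
    moreover have "v = 0 + v" "0 \<in> ?E x" using sub(1)[OF x] subspace_0 by auto
    ultimately show "v \<in> ?G x" by blast
  qed
  ultimately show "F x \<subseteq> ?E x" by simp
qed

text \<open>
  A vector in the root space of a tree representation lies in the largest subrepresentation with
  surjective arrows iff it can be lifted along all arrows. This description of the rank carries no
  subspaces along, which makes its recursion over the reduced quiver easy.
\<close>

definition lifting :: "('v, 'e) pre_digraph \<Rightarrow> 'v \<Rightarrow> 'e lat \<Rightarrow> ('k, 'm, 'v, 'e) rep \<Rightarrow>
    (('e \<times> 'e lat) list \<Rightarrow> 'm) \<Rightarrow> bool" where
  "lifting Q x M V u \<longleftrightarrow> (\<forall>p. red_path M p \<longrightarrow> u p \<in> spc V (red_vert Q x p)) \<and>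
     (\<forall>p a S. red_path M (p @ [(a, S)]) \<longrightarrow> map_at V a (u (p @ [(a, S)])) = u p)"

lemma is_rep_pullback:
  assumes "wf_digraph Q" "is_rep Q V" "x \<in> verts Q" "M \<in> lattice Q x"
  shows "is_rep (red_quiver M) (pullback (red_vert Q x) red_arc V)"
  unfolding is_rep_def
proof (intro conjI ballI)
  let ?P = "pullback (red_vert Q x) red_arc V"
  show "vector_space (scl ?P)"
    using is_rep_simps(1)[OF assms(2)] by (simp add: pullback_def)
next
  let ?P = "pullback (red_vert Q x) red_arc V"
  fix p assume "p \<in> verts (red_quiver M)"
  then have "red_vert Q x p \<in> verts Q" using red_path_verts assms by simp
  then show "\<exists>B. finite B \<and> module.span (scl ?P) B =
      spc ?P p"
    using assms(2) by (simp add: is_rep_def pullback_def)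
next
  let ?P = "pullback (red_vert Q x) red_arc V"
  fix p assume p: "p \<in> arcs (red_quiver M)"
  then obtain q a S where q: "p = q @ [(a, S)]" by (cases p rule: rev_cases) auto
  have a: "a \<in> arcs Q" "head Q a = red_vert Q x q" using red_path_arc[OF assms(4)] p q by auto
  show "linear_on (scl ?P) (scl ?P)
      (spc ?P (tail (red_quiver M) p)) (map_at ?P p)"
    using is_rep_simps(4)[OF assms(2) a(1)] q by (simp add: pullback_def red_arc_def)
  show "map_at ?P p ` spc ?P (tail (red_quiver M) p)
      \<subseteq> spc ?P (head (red_quiver M) p)"
    using is_rep_simps(5)[OF assms(2) a(1)] q a(2) by (auto simp: pullback_def red_arc_def)
qed

lemma rank_eq_liftings:
  assumes "wf_digraph Q" "is_rep Q V" "x \<in> verts Q" "M \<in> lattice Q x"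
  shows "v \<in> rank Q x M V \<longleftrightarrow> (\<exists>u. lifting Q x M V u \<and> u [] = v)"
proof
  let ?R = "red_quiver M" and ?V = "pullback (red_vert Q x) red_arc V"
  let ?E = "surj_part ?R ?V"
  note greatest = surj_part_greatest[OF wf_red_quiver is_rep_pullback[OF assms]]
  have E: "?E p \<subseteq> spc V (red_vert Q x p)" if "red_path M p" for p
    using greatest(1) that by (auto simp: surj_subrep_def subrep_def pullback_def)
  have surj: "map_at V a ` ?E (p @ [(a, S)]) = ?E p" if "red_path M (p @ [(a, S)])" for p a S
  proof -
    have "p @ [(a, S)] \<in> arcs ?R" using that by simp
    then have "map_at ?V (p @ [(a, S)]) ` ?E (tail ?R (p @ [(a, S)])) = ?E (head ?R (p @ [(a, S)]))"
      using greatest(1) unfolding surj_subrep_def by blast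
    then show ?thesis by (simp add: pullback_def red_arc_def)
  qed
  {
    assume "v \<in> rank Q x M V"
    then have v: "v \<in> ?E []" by (simp add: rank_def global_rank_def)
    \<comment> \<open>Choose preimages inside the largest subrepresentation with surjective arrows, from the root to
      the leaves; the list is reversed because paths grow at their end.\<close>
    define u where "u p = rec_list v (\<lambda>b q w. SOME w'. w' \<in> ?E (rev (b # q)) \<and> map_at V (fst b) w' = w) (rev p)" for p
    have u0: "u [] = v" by (simp add: u_def)
    have us: "u (p @ [b]) = (SOME w'. w' \<in> ?E (p @ [b]) \<and> map_at V (fst b) w' = u p)" for p b
      by (simp add: u_def)
    have step: "u (p @ [(a, S)]) \<in> ?E (p @ [(a, S)]) \<and> map_at V a (u (p @ [(a, S)])) = u p"
      if "red_path M (p @ [(a, S)])" "u p \<in> ?E p" for p a S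
    proof -
      have "\<exists>w'. w' \<in> ?E (p @ [(a, S)]) \<and> map_at V a w' = u p"
        using that(2) surj[OF that(1)] by (metis imageE)
      then show ?thesis unfolding us fst_conv by (rule someI_ex)
    qed
    have uE: "u p \<in> ?E p" if "red_path M p" for p
      using that
    proof (induction p rule: rev_induct)
      case (snoc b p)
      then show ?case using step[of p "fst b" "snd b"] by (cases b) simp
    qed (simp add: u0 v)
    have "lifting Q x M V u"
      unfolding lifting_def
    proof (intro conjI allI impI)
      show "u p \<in> spc V (red_vert Q x p)" if "red_path M p" for p
        using uE[OF that] E[OF that] by blast
      show "map_at V a (u (p @ [(a, S)])) = u p" if "red_path M (p @ [(a, S)])" for p a S
        using step[OF that uE[of p]] that by simp
    qed
    then show "\<exists>u. lifting Q x M V u \<and> u [] = v" using u0 by blast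
  next
    assume "\<exists>u. lifting Q x M V u \<and> u [] = v"
    then obtain u where u: "lifting Q x M V u" "u [] = v" by blast
    interpret vector_space "scl V" using assms(2) by (simp add: is_rep_def)
    have us: "u p \<in> spc V (red_vert Q x p)" if "red_path M p" for p
      using u that by (simp add: lifting_def)
    have sub: "subspace (spc V (red_vert Q x p))" if "red_path M p" for p
      using is_rep_simps(3)[OF assms(2)] red_path_verts[OF assms(1,3,4) that] .
    have im: "map_at V (red_arc p) ` span {u p} = span {u (butlast p)}" if "red_path M p" "p \<noteq> []" for p
    proof -
      obtain q a S where q: "p = q @ [(a, S)]" using \<open>p \<noteq> []\<close> by (cases p rule: rev_cases) auto
      have a: "a \<in> arcs Q" using red_path_arc[OF assms(4)] that q by auto
      have "map_at V a ` span {u p} = span (map_at V a ` {u p})"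
        using image_span[OF module_axioms is_rep_simps(4)[OF assms(2) a]] sub[OF that(1)] us[OF that(1)]
        by (simp add: q)
      moreover have "map_at V a (u p) = u q" using u that q by (simp add: lifting_def)
      ultimately show ?thesis using q by (simp add: red_arc_def)
    qed
    \<comment> \<open>Conversely, the spans of the lifts form a subrepresentation with surjective arrows.\<close>
    have "surj_subrep ?R ?V (\<lambda>p. span {u p})"
      unfolding surj_subrep_def subrep_def using im us sub
      by (auto simp: pullback_def span_minimal subspace_span)
    from greatest(2)[OF this, of "[]"] have "span {u []} \<subseteq> ?E []" by simp
    then show "v \<in> rank Q x M V" using u(2) span_base[of v "{v}"]
      by (auto simp: rank_def global_rank_def)
  }
qed

text \<open>
  A lifting over the reduced quiver of \<open>M\<close> consists of a lifting over the reduced quiver of \<open>S\<close> for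
  each arrow \<open>a\<close> and maximal element \<open>S\<close> of the ideal at \<open>a\<close>, each of which starts over a preimage of
  the given vector.
\<close>

lemma rank_rec_max:
  assumes Q: "wf_digraph Q" "is_rep Q V" "x \<in> verts Q" "M \<in> lattice Q x"
  shows "rank Q x M V = {v \<in> spc V x. \<forall>a. \<forall>S\<in>max_elems (ideal_at M a). v \<in> map_at V a ` rank Q (tail Q a) S V}"
proof (intro set_eqI iffI CollectI conjI allI ballI)
  have sub: "tail Q a \<in> verts Q" "S \<in> lattice Q (tail Q a)" if "S \<in> max_elems (ideal_at M a)" for a S
    using that lattice_ideal(1,3)[OF Q(4), of S a] max_elems_subset[of "ideal_at M a"]
      wf_digraph.tail_in_verts[OF Q(1), of a] by auto
  note iff = rank_eq_liftings[OF Q(1,2)]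
  {
    fix v assume "v \<in> rank Q x M V"
    then obtain u where u: "lifting Q x M V u" "u [] = v" unfolding iff[OF Q(3,4)] by blast
    have "red_path M []" by simp
    then show "v \<in> spc V x" using u unfolding lifting_def by (metis red_vert_simps(1))
    fix a S assume S: "S \<in> max_elems (ideal_at M a)"
    have "lifting Q (tail Q a) S V (\<lambda>p. u ((a, S) # p))"
      unfolding lifting_def
    proof (intro conjI allI impI)
      fix p assume "red_path S p"
      then have "red_path M ((a, S) # p)" using S by simp
      then show "u ((a, S) # p) \<in> spc V (red_vert Q (tail Q a) p)"
        using u(1) unfolding lifting_def by (metis red_vert_simps(3))
    next
      fix p b T assume "red_path S (p @ [(b, T)])"
      then have "red_path M (((a, S) # p) @ [(b, T)])" using S by simp
      then have "map_at V b (u (((a, S) # p) @ [(b, T)])) = u ((a, S) # p)"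
        using u(1) unfolding lifting_def by blast
      then show "map_at V b (u ((a, S) # p @ [(b, T)])) = u ((a, S) # p)" by simp
    qed
    then have "u [(a, S)] \<in> rank Q (tail Q a) S V" unfolding iff[OF sub[OF S]] by blast
    moreover have "red_path M ([] @ [(a, S)])" using S by simp
    then have "map_at V a (u [(a, S)]) = v" using u unfolding lifting_def by fastforce
    ultimately show "v \<in> map_at V a ` rank Q (tail Q a) S V" by blast
  next
    fix v assume v: "v \<in> {v \<in> spc V x. \<forall>a. \<forall>S\<in>max_elems (ideal_at M a). v \<in> map_at V a ` rank Q (tail Q a) S V}"
    have "\<exists>u. lifting Q (tail Q a) S V u \<and> map_at V a (u []) = v" if S: "S \<in> max_elems (ideal_at M a)" for a S
    proof -
      obtain w where w: "w \<in> rank Q (tail Q a) S V" "v = map_at V a w" using v S by blast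
      obtain u where "lifting Q (tail Q a) S V u" "u [] = w"
        using w(1) unfolding iff[OF sub[OF S]] by blast
      then show ?thesis using w(2) by auto
    qed
    then have "\<forall>a S. \<exists>u. S \<in> max_elems (ideal_at M a) \<longrightarrow> lifting Q (tail Q a) S V u \<and> map_at V a (u []) = v"
      by blast
    then obtain w where w: "\<And>a S. S \<in> max_elems (ideal_at M a) \<Longrightarrow>
        lifting Q (tail Q a) S V (w a S) \<and> map_at V a (w a S []) = v"
      unfolding choice_iff by blast
    define u where "u p = (case p of [] \<Rightarrow> v | b # q \<Rightarrow> w (fst b) (snd b) q)" for p
    have "lifting Q x M V u"
      unfolding lifting_def
    proof (intro conjI allI impI)
      fix p assume p: "red_path M p"
      show "u p \<in> spc V (red_vert Q x p)"
      proof (cases p)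
        case Nil
        then show ?thesis using v by (simp add: u_def)
      next
        case (Cons b q)
        obtain a S where b: "b = (a, S)" by (cases b)
        have "S \<in> max_elems (ideal_at M a)" "red_path S q" using p b Cons by auto
        then show ?thesis using w(1)[of S a] Cons b by (auto simp: u_def lifting_def)
      qed
    next
      fix p a S assume p: "red_path M (p @ [(a, S)])"
      show "map_at V a (u (p @ [(a, S)])) = u p"
      proof (cases p)
        case Nil
        then show ?thesis using p w(1)[of S a] by (simp add: u_def)
      next
        case (Cons b q)
        obtain b' T where b: "b = (b', T)" by (cases b)
        have "T \<in> max_elems (ideal_at M b')" "red_path T (q @ [(a, S)])" using p b Cons by auto
        then show ?thesis using w(1)[of T b'] Cons b by (auto simp: u_def lifting_def simp del: red_path_snoc)
      qed
    qed
    moreover have "u [] = v" by (simp add: u_def)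
    ultimately show "v \<in> rank Q x M V" unfolding iff[OF Q(3,4)] by blast
  }
qed

section \<open>Operations on the lattices\<close>

lemma finite_lattice:
  assumes "wf {(tail Q a, head Q a) | a. a \<in> arcs Q}" "finite (arcs Q)"
  shows "finite (lattice Q x)"
  using assms(1)
proof (induction x rule: wf_induct_rule)
  case (less x)
  let ?T = "\<Union>a\<in>in_arcs Q x. lattice Q (tail Q a)"
  have fin: "finite (in_arcs Q x)" using assms(2) by (simp add: in_arcs_def)
  have "finite (lattice Q (tail Q a))" if "a \<in> in_arcs Q x" for a
    using that by (intro less) auto
  then have "finite ?T" using fin by blast
  then have "finite {f. \<forall>a. (a \<in> in_arcs Q x \<longrightarrow> f a \<in> Pow ?T) \<and> (a \<notin> in_arcs Q x \<longrightarrow> f a = {})}"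
    using fin by (intro finite_set_of_finite_funs) auto
  moreover have "ideal_at ` lattice Q x \<subseteq>
      {f. \<forall>a. (a \<in> in_arcs Q x \<longrightarrow> f a \<in> Pow ?T) \<and> (a \<notin> in_arcs Q x \<longrightarrow> f a = {})}"
  proof (intro image_subsetI CollectI allI conjI impI)
    fix M a assume M: "M \<in> lattice Q x"
    show "ideal_at M a \<in> Pow ?T" if "a \<in> in_arcs Q x"
      using that lattice_ideal(3)[OF M] by blast
    show "ideal_at M a = {}" if "a \<notin> in_arcs Q x"
      using that lattice_ideal(1,2)[OF M] by (auto simp: in_arcs_def)
  qed
  ultimately have "finite (ideal_at ` lattice Q x)" by (rule finite_subset[rotated])
  moreover have "inj_on ideal_at (lattice Q x)"
    by (intro inj_onI lat_eqI) simp
  ultimately show ?case by (rule finite_imageD)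
qed

text \<open>
  For \<open>T\<close> in the lattice at the tail of \<open>a\<close>, the least element at the head whose ideal at \<open>a\<close> contains
  \<open>T\<close> is \<open>arc_lat Q a T\<close>. Its rank is the image under \<open>a\<close> of the rank at \<open>T\<close> (\<open>rank_arc\<close>), which makes
  it possible to move vanishing conditions along \<open>a\<close>.
\<close>

definition bot_lat :: "'e lat" where "bot_lat = Fam (\<lambda>_. {||})"

definition join_lat :: "'e lat \<Rightarrow> 'e lat \<Rightarrow> 'e lat" where
  "join_lat M N = Fam (\<lambda>a. Abs_fset (ideal_at M a \<union> ideal_at N a))"

definition arc_lat :: "('v, 'e) pre_digraph \<Rightarrow> 'e \<Rightarrow> 'e lat \<Rightarrow> 'e lat" where
  "arc_lat Q a T = Fam (\<lambda>b. Abs_fset (if b = a then {U \<in> lattice Q (tail Q a). U \<le> T} else {}))"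

lemma ideal_at_bot [simp]: "ideal_at bot_lat a = {}"
  and ideal_at_join [simp]: "ideal_at (join_lat M N) a = ideal_at M a \<union> ideal_at N a"
  and ideal_at_arc: "finite (lattice Q (tail Q a)) \<Longrightarrow>
    ideal_at (arc_lat Q a T) b = (if b = a then {U \<in> lattice Q (tail Q a). U \<le> T} else {})"
  by (simp_all add: bot_lat_def join_lat_def arc_lat_def Abs_fset_inverse)

lemma bot_lat_in_lattice: "bot_lat \<in> lattice Q x"
  by (rule latticeI) auto

lemma join_lat_in_lattice:
  assumes "M \<in> lattice Q x" "N \<in> lattice Q x"
  shows "join_lat M N \<in> lattice Q x"
proof (rule latticeI)
  fix a S assume "S \<in> ideal_at (join_lat M N) a"
  then consider "S \<in> ideal_at M a" | "S \<in> ideal_at N a" by auto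
  then show "a \<in> arcs Q \<and> head Q a = x \<and> S \<in> lattice Q (tail Q a)"
    using lattice_ideal(1-3)[OF assms(1)] lattice_ideal(1-3)[OF assms(2)] by cases blast+
  show "T \<in> ideal_at (join_lat M N) a"
    if S: "S \<in> ideal_at (join_lat M N) a" and T: "T \<in> lattice Q (tail Q a)" "T \<le> S" for T
  proof -
    consider "S \<in> ideal_at M a" | "S \<in> ideal_at N a" using S by auto
    then show ?thesis
      using lattice_ideal(4)[OF assms(1) _ T] lattice_ideal(4)[OF assms(2) _ T] by cases simp_all
  qed
qed

lemma le_join_lat: "M \<le> join_lat M N" "N \<le> join_lat M N"
  by (auto simp: less_eq_lat_def)

lemma arc_lat_in_lattice:
  assumes "finite (lattice Q (tail Q a))" "a \<in> arcs Q"
  shows "arc_lat Q a T \<in> lattice Q (head Q a)"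
proof (rule latticeI)
  note arc = ideal_at_arc[OF assms(1)]
  fix b S assume S: "S \<in> ideal_at (arc_lat Q a T) b"
  then show "b \<in> arcs Q \<and> head Q b = head Q a \<and> S \<in> lattice Q (tail Q b)"
    unfolding arc using assms(2) by (simp split: if_splits)
  show "U \<in> ideal_at (arc_lat Q a T) b" if "U \<in> lattice Q (tail Q b)" "U \<le> S" for U
    using S that unfolding arc by (auto split: if_splits)
qed

lemma arc_lat_le_iff:
  assumes "finite (lattice Q (tail Q a))" "T \<in> lattice Q (tail Q a)" "S \<in> lattice Q x"
  shows "arc_lat Q a T \<le> S \<longleftrightarrow> T \<in> ideal_at S a"
  using assms lattice_ideal(4)[OF assms(3)] by (auto simp: less_eq_lat_def ideal_at_arc)

section \<open>Ranks and the lattice operations\<close>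

context
  fixes Q :: "('v, 'e) pre_digraph" and V :: "('k::field, 'm::ab_group_add, 'v, 'e) rep"
  assumes Q: "wf_digraph Q" and V: "is_rep Q V"
begin

interpretation wf_digraph Q by (rule Q)
interpretation vector_space "scl V" using V by (simp add: is_rep_def)

lemma rank_subset:
  assumes "x \<in> verts Q" "M \<in> lattice Q x"
  shows "rank Q x M V \<subseteq> spc V x"
  using rank_rec_max[OF Q V assms] by blast

lemma lattice_ideal_tail: "M \<in> lattice Q x \<Longrightarrow> S \<in> ideal_at M a \<Longrightarrow> tail Q a \<in> verts Q"
  by (rule tail_in_verts[OF lattice_ideal(1)])

lemma rank_subspace:
  assumes "x \<in> verts Q" "M \<in> lattice Q x"
  shows "subspace (rank Q x M V)"
  using assms
proof (induction M arbitrary: x rule: lat_induct)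
  case (ideal M)
  note iff = rank_rec_max[OF Q V ideal.prems]
  have im: "subspace (map_at V a ` rank Q (tail Q a) S V)" if S: "S \<in> max_elems (ideal_at M a)" for a S
  proof -
    have S': "S \<in> ideal_at M a" using S by (rule max_elemsD)
    note l = lattice_ideal[OF ideal.prems(2) S'] and t = lattice_ideal_tail[OF ideal.prems(2) S']
    have "linear_on (scl V) (scl V) (rank Q (tail Q a) S V) (map_at V a)"
      by (rule linear_on_subset[OF is_rep_simps(4)[OF V l(1)] rank_subset[OF t l(3)]])
    then show ?thesis
      using ideal.IH[OF S' t l(3)] module_axioms by (intro subspace_linear_image)
  qed
  have "rank Q x M V = \<Inter>(insert (spc V x) {map_at V a ` rank Q (tail Q a) S V | a S. S \<in> max_elems (ideal_at M a)})"
    unfolding iff by blast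
  moreover have "subspace (spc V x)" by (rule is_rep_simps(3)[OF V ideal.prems(1)])
  ultimately show ?case using im
    by (simp only:) (rule subspace_Inter, blast)
qed

text \<open>
  Each maximal element of an ideal of \<open>M\<close> lies below a maximal element of the corresponding ideal of
  \<open>M'\<close>.
\<close>

lemma rank_antimono:
  assumes "x \<in> verts Q" "M \<in> lattice Q x" "M' \<in> lattice Q x" "M \<le> M'"
  shows "rank Q x M' V \<subseteq> rank Q x M V"
  using assms
proof (induction M arbitrary: x M' rule: lat_induct)
  case (ideal M)
  show ?case
  proof
    fix v assume v: "v \<in> rank Q x M' V"
    have "v \<in> map_at V a ` rank Q (tail Q a) S V" if "S \<in> max_elems (ideal_at M a)" for a S
    proof -
      have S: "S \<in> ideal_at M a" using that by (rule max_elemsD)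
      have SM: "S \<in> ideal_at M' a" using S ideal.prems(4) by (auto simp: less_eq_lat_def)
      obtain S' where S': "S' \<in> max_elems (ideal_at M' a)" "S \<le> S'"
        using below_max_elem[OF finite_ideal_at SM] by blast
      have S'': "S' \<in> ideal_at M' a" using S'(1) by (rule max_elemsD)
      have "rank Q (tail Q a) S' V \<subseteq> rank Q (tail Q a) S V"
        using ideal.IH[OF S lattice_ideal_tail[OF ideal.prems(2) S]]
          lattice_ideal(3)[OF ideal.prems(2) S] lattice_ideal(3)[OF ideal.prems(3) S''] S'(2) .
      moreover have "v \<in> map_at V a ` rank Q (tail Q a) S' V"
        using v S'(1) unfolding rank_rec_max[OF Q V ideal.prems(1,3)] by blast
      ultimately show ?thesis by blast
    qed
    moreover have "v \<in> spc V x" using v rank_subset[OF ideal.prems(1,3)] by blast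
    ultimately show "v \<in> rank Q x M V" unfolding rank_rec_max[OF Q V ideal.prems(1,2)] by blast
  qed
qed

text \<open>
  By monotonicity the maximal elements may be replaced by all elements of the ideals. In this form
  the recursion shows at once how ranks depend on the lattice operations.
\<close>

lemma rank_rec:
  assumes "x \<in> verts Q" "M \<in> lattice Q x"
  shows "rank Q x M V = {v \<in> spc V x. \<forall>a. \<forall>S\<in>ideal_at M a. v \<in> map_at V a ` rank Q (tail Q a) S V}"
    (is "_ = ?r")
proof
  show "?r \<subseteq> rank Q x M V" unfolding rank_rec_max[OF Q V assms] by (auto dest: max_elemsD)
  show "rank Q x M V \<subseteq> ?r"
  proof (intro subsetI CollectI conjI allI ballI)
    fix v assume v: "v \<in> rank Q x M V"
    then show "v \<in> spc V x" using rank_subset[OF assms] by blast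
    fix a S assume S: "S \<in> ideal_at M a"
    obtain T where T: "T \<in> max_elems (ideal_at M a)" "S \<le> T"
      using below_max_elem[OF finite_ideal_at S] by blast
    have T': "T \<in> ideal_at M a" using T(1) by (rule max_elemsD)
    have "rank Q (tail Q a) T V \<subseteq> rank Q (tail Q a) S V"
      using rank_antimono[OF lattice_ideal_tail[OF assms(2) S]
        lattice_ideal(3)[OF assms(2) S] lattice_ideal(3)[OF assms(2) T'] T(2)] .
    then show "v \<in> map_at V a ` rank Q (tail Q a) S V"
      using v T(1) unfolding rank_rec_max[OF Q V assms] by blast
  qed
qed

lemma rank_bot: "x \<in> verts Q \<Longrightarrow> rank Q x bot_lat V = spc V x"
  using rank_rec[OF _ bot_lat_in_lattice, of x] by simp

lemma rank_join:
  assumes "x \<in> verts Q" "M \<in> lattice Q x" "N \<in> lattice Q x"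
  shows "rank Q x (join_lat M N) V = rank Q x M V \<inter> rank Q x N V"
  unfolding rank_rec[OF assms(1,2)] rank_rec[OF assms(1,3)]
    rank_rec[OF assms(1) join_lat_in_lattice[OF assms(2,3)]] ideal_at_join by blast

lemma rank_arc:
  assumes "a \<in> arcs Q" "T \<in> lattice Q (tail Q a)" "finite (lattice Q (tail Q a))"
  shows "rank Q (head Q a) (arc_lat Q a T) V = map_at V a ` rank Q (tail Q a) T V"
proof -
  have h: "head Q a \<in> verts Q" "tail Q a \<in> verts Q" using assms by auto
  have sub: "map_at V a ` rank Q (tail Q a) T V \<subseteq> map_at V a ` rank Q (tail Q a) S V"
    if "S \<in> lattice Q (tail Q a)" "S \<le> T" for S
    using rank_antimono[OF h(2) that(1) assms(2) that(2)] by blast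
  have "map_at V a ` rank Q (tail Q a) T V \<subseteq> spc V (head Q a)"
    using rank_subset[OF h(2) assms(2)] is_rep_simps(5)[OF V assms(1)] by blast
  then have ge: "v \<in> spc V (head Q a) \<and> (\<forall>b. \<forall>S\<in>ideal_at (arc_lat Q a T) b. v \<in> map_at V b ` rank Q (tail Q b) S V)"
    if "v \<in> map_at V a ` rank Q (tail Q a) T V" for v
    unfolding ideal_at_arc[OF assms(3)] using that sub by (simp split: if_splits) blast
  have "T \<in> ideal_at (arc_lat Q a T) a" unfolding ideal_at_arc[OF assms(3)] using assms(2) by simp
  then show ?thesis
    unfolding rank_rec[OF h(1) arc_lat_in_lattice[OF assms(3,1)]] using ge by blast
qed

end

lemma is_rep_restr:
  assumes "is_rep Q X" "subrep Q X W" "wf_digraph Q"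
  shows "is_rep Q (restr X W)"
proof -
  have s: "scl (restr X W) = scl X" "spc (restr X W) = W" "map_at (restr X W) = map_at X"
    by (simp_all add: restr_def)
  show ?thesis
    unfolding is_rep_def s
  proof (intro conjI ballI)
    show "vector_space (scl X)" by (rule is_rep_simps(1)[OF assms(1)])
  next
    fix x assume x: "x \<in> verts Q"
    obtain B0 where B0: "finite B0" "module.span (scl X) B0 = spc X x"
      using assms(1) x unfolding is_rep_def by blast
    have W: "module.subspace (scl X) (W x)" "W x \<subseteq> module.span (scl X) B0"
      using assms(2) x B0(2) unfolding subrep_def by auto
    show "\<exists>B. finite B \<and> module.span (scl X) B = W x"
      by (rule finite_basis_of_subspace[OF is_rep_simps(1)[OF assms(1)] B0(1) W(2,1)]) blast
  next
    fix a assume a: "a \<in> arcs Q"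
    then show "map_at X a ` W (tail Q a) \<subseteq> W (head Q a)" using assms(2) by (simp add: subrep_def)
    have "W (tail Q a) \<subseteq> spc X (tail Q a)"
      using assms(2) wf_digraph.tail_in_verts[OF assms(3) a] by (simp add: subrep_def)
    then show "linear_on (scl X) (scl X) (W (tail Q a)) (map_at X a)"
      by (rule linear_on_subset[OF is_rep_simps(4)[OF assms(1) a]])
  qed
qed

lemma rank_restr:
  assumes Q: "wf_digraph Q" and X: "is_rep Q X" "subrep Q X W" and x: "x \<in> verts Q" "M \<in> lattice Q x"
  shows "rank Q x M (restr X W) \<subseteq> rank Q x M X \<inter> W x"
proof
  fix v assume v: "v \<in> rank Q x M (restr X W)"
  note R = is_rep_restr[OF X Q]
  have "W y \<subseteq> spc X y" if "y \<in> verts Q" for y using X(2) that by (simp add: subrep_def)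
  then have W: "W (red_vert Q x p) \<subseteq> spc X (red_vert Q x p)" if "red_path M p" for p
    using red_path_verts[OF Q x that] by blast
  obtain u where u: "lifting Q x M (restr X W) u" "u [] = v"
    using v unfolding rank_eq_liftings[OF Q R x] by blast
  have "lifting Q x M X u"
    using u(1) W unfolding lifting_def restr_def by (simp add: subset_iff)
  then have "v \<in> rank Q x M X" unfolding rank_eq_liftings[OF Q X(1) x] using u(2) by blast
  moreover have "v \<in> W x" using rank_subset[OF Q R x] v by (auto simp: restr_def)
  ultimately show "v \<in> rank Q x M X \<inter> W x" by blast
qed

section \<open>Tensor powers of subspaces and products of linear maps\<close>

text \<open>
  \<open>tensor_sub s l A B\<close> is the tensor power of a subspace \<open>B\<close> of \<open>A\<close>, inside the forms on the dual of \<open>A\<close>.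
  \<open>tensor_maps s A C [f\<^sub>1, \<dots>, f\<^sub>l]\<close> is \<open>f\<^sub>1 \<otimes> \<dots> \<otimes> f\<^sub>l\<close> for maps from \<open>A\<close> to \<open>C\<close>, encoded like the
  induced map of a single map in \<^const>\<open>tensor_map\<close>.
\<close>

definition tensor_sub ::
    "('k::field \<Rightarrow> 'm::ab_group_add \<Rightarrow> 'm) \<Rightarrow> nat \<Rightarrow> 'm set \<Rightarrow> 'm set \<Rightarrow> (('m \<Rightarrow> 'k) list \<Rightarrow> 'k) set" where
  "tensor_sub s l A B = module.span tscl {pure s A vs | vs. length vs = l \<and> set vs \<subseteq> B}"

definition tensor_maps ::
    "('k::field \<Rightarrow> 'm::ab_group_add \<Rightarrow> 'm) \<Rightarrow> 'm set \<Rightarrow> 'm set \<Rightarrow> ('m \<Rightarrow> 'm) list \<Rightarrow>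
     (('m \<Rightarrow> 'k) list \<Rightarrow> 'k) \<Rightarrow> (('m \<Rightarrow> 'k) list \<Rightarrow> 'k)" where
  "tensor_maps s A C fs T = (\<lambda>\<phi>s. if length \<phi>s = length fs \<and> set \<phi>s \<subseteq> dual s C
     then T (map2 (\<lambda>\<phi> f v. if v \<in> A then \<phi> (f v) else 0) \<phi>s fs) else 0)"

lemma module_tscl: "module (tscl :: 'k::field \<Rightarrow> ('i \<Rightarrow> 'k) \<Rightarrow> ('i \<Rightarrow> 'k))"
proof -
  interpret vector_space "tscl :: 'k \<Rightarrow> ('i \<Rightarrow> 'k) \<Rightarrow> ('i \<Rightarrow> 'k)" by (rule vector_space_tscl)
  show ?thesis by (rule module_axioms)
qed

lemma tensor_space_eq_sub: "tensor_space s l A = tensor_sub s l A A"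
  by (simp add: tensor_space_def tensor_sub_def)

lemma subspace_tensor_sub: "module.subspace tscl (tensor_sub s l A B)"
  unfolding tensor_sub_def by (rule module.subspace_span[OF module_tscl])

lemma tensor_sub_mono: "B \<subseteq> C \<Longrightarrow> tensor_sub s l A B \<subseteq> tensor_sub s l A C"
  unfolding tensor_sub_def by (rule module.span_mono[OF module_tscl]) blast

lemma pure_in_tensor_sub: "length vs = l \<Longrightarrow> set vs \<subseteq> B \<Longrightarrow> pure s A vs \<in> tensor_sub s l A B"
  unfolding tensor_sub_def by (rule module.span_base[OF module_tscl]) blast

lemma tensor_maps_linear: "linear_on tscl tscl X (tensor_maps s A C fs)"
  by (auto simp: linear_on_def tensor_maps_def tscl_def fun_eq_iff)

lemma tensor_sub_induct [consumes 1, case_names zero step]: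
  assumes "T \<in> tensor_sub s l A B" "P 0"
    "\<And>c vs T. length vs = l \<Longrightarrow> set vs \<subseteq> B \<Longrightarrow> T \<in> tensor_sub s l A B \<Longrightarrow> P T \<Longrightarrow> P (tscl c (pure s A vs) + T)"
  shows "P T"
proof -
  have "T \<in> tensor_sub s l A B \<and> P T"
    using assms(1)[unfolded tensor_sub_def]
  proof (induction rule: module.span_induct_alt[OF module_tscl, consumes 1])
    case 1
    then show ?case unfolding tensor_sub_def using assms(2) module.span_zero[OF module_tscl] by blast
  next
    case (2 c x y)
    obtain vs where vs: "x = pure s A vs" "length vs = l" "set vs \<subseteq> B" using 2(1) by blast
    have "tscl c x + y \<in> tensor_sub s l A B"
      unfolding vs(1)
      by (intro module.subspace_add[OF module_tscl subspace_tensor_sub]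
          module.subspace_scale[OF module_tscl subspace_tensor_sub] pure_in_tensor_sub vs(2,3) conjunct1[OF 2(2)])
    moreover have "P (tscl c x + y)" unfolding vs(1) using assms(3)[OF vs(2,3)] 2(2) by blast
    ultimately show ?case by blast
  qed
  then show ?thesis ..
qed

lemma linear_eq_on_tensor_sub:
  assumes "linear_on tscl t UNIV f" "linear_on tscl t UNIV g" "module t"
    and "\<And>vs. length vs = l \<Longrightarrow> set vs \<subseteq> B \<Longrightarrow> f (pure s A vs) = g (pure s A vs)"
    and "T \<in> tensor_sub s l A B"
  shows "f T = g T"
  using assms(5)
proof (induction rule: tensor_sub_induct)
  case zero
  then show ?case
    using linear_on_zero[OF assms(1) module_tscl assms(3)] linear_on_zero[OF assms(2) module_tscl assms(3)]
      module.subspace_UNIV[OF module_tscl] by metis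
next
  case (step c vs T)
  then show ?case
    unfolding linear_on_add[OF assms(1) UNIV_I UNIV_I] linear_on_add[OF assms(2) UNIV_I UNIV_I]
      linear_on_scale[OF assms(1) UNIV_I] linear_on_scale[OF assms(2) UNIV_I] by (simp add: assms(4))
qed

lemma linear_image_tensor_sub:
  assumes "linear_on tscl tscl UNIV f" "module.subspace tscl Y"
    and "\<And>vs. length vs = l \<Longrightarrow> set vs \<subseteq> B \<Longrightarrow> f (pure s A vs) \<in> Y"
    and "T \<in> tensor_sub s l A B"
  shows "f T \<in> Y"
  using assms(4)
proof (induction rule: tensor_sub_induct)
  case zero
  then show ?case
    using linear_on_zero[OF assms(1) module_tscl module_tscl] module.subspace_UNIV[OF module_tscl]
      module.subspace_0[OF module_tscl assms(2)] by metis
next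
  case (step c vs T)
  then show ?case
    unfolding linear_on_add[OF assms(1) UNIV_I UNIV_I] linear_on_scale[OF assms(1) UNIV_I]
    by (intro module.subspace_add[OF module_tscl assms(2)] module.subspace_scale[OF module_tscl assms(2)] assms(3))
qed

context
  fixes s :: "'k::field \<Rightarrow> 'm::ab_group_add \<Rightarrow> 'm"
  assumes s: "vector_space s"
begin

interpretation vector_space s by (rule s)

lemma dual_compose:
  assumes "\<phi> \<in> dual s C" "linear_on s s A f" "f ` A \<subseteq> C" "subspace A"
  shows "(\<lambda>v. if v \<in> A then \<phi> (f v) else 0) \<in> dual s A"
  using assms(1-3) subspace_add[OF assms(4)] subspace_scale[OF assms(4)]
  by (auto simp: dual_def linear_on_def image_subset_iff)

lemma map2_dual_compose:
  assumes "set \<phi>s \<subseteq> dual s C" "\<And>f. f \<in> set fs \<Longrightarrow> linear_on s s A f \<and> f ` A \<subseteq> C" "subspace A"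
  shows "set (map2 (\<lambda>\<phi> f v. if v \<in> A then \<phi> (f v) else 0) \<phi>s fs) \<subseteq> dual s A"
proof
  fix \<psi> assume "\<psi> \<in> set (map2 (\<lambda>\<phi> f v. if v \<in> A then \<phi> (f v) else 0) \<phi>s fs)"
  then obtain \<phi> f where f: "(\<phi>, f) \<in> set (zip \<phi>s fs)" "\<psi> = (\<lambda>v. if v \<in> A then \<phi> (f v) else 0)"
    by auto
  then have "\<phi> \<in> dual s C" "f \<in> set fs"
    using assms(1) by (auto dest: set_zip_leftD set_zip_rightD)
  then show "\<psi> \<in> dual s A" using dual_compose[OF _ _ _ assms(3)] assms(2) f(2) by blast
qed

lemma map2_apply_subset:
  assumes "\<And>f. f \<in> set fs \<Longrightarrow> f ` A \<subseteq> R" "set vs \<subseteq> A"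
  shows "set (map2 (\<lambda>f v. f v) fs vs) \<subseteq> R"
proof
  fix w assume "w \<in> set (map2 (\<lambda>f v. f v) fs vs)"
  then obtain f v where fv: "(f, v) \<in> set (zip fs vs)" "w = f v" by auto
  then have "f \<in> set fs" "v \<in> A" using assms(2) by (auto dest: set_zip_leftD set_zip_rightD)
  then show "w \<in> R" using assms(1)[of f] fv(2) by blast
qed

lemma tensor_maps_pure:
  assumes "length fs = length vs" "set vs \<subseteq> A" "subspace A"
    and "\<And>f. f \<in> set fs \<Longrightarrow> linear_on s s A f \<and> f ` A \<subseteq> C"
  shows "tensor_maps s A C fs (pure s A vs) = pure s C (map2 (\<lambda>f v. f v) fs vs)"
proof
  fix \<phi>s
  show "tensor_maps s A C fs (pure s A vs) \<phi>s = pure s C (map2 (\<lambda>f v. f v) fs vs) \<phi>s"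
  proof (cases "length \<phi>s = length fs \<and> set \<phi>s \<subseteq> dual s C")
    case True
    let ?\<psi>s = "map2 (\<lambda>\<phi> f v. if v \<in> A then \<phi> (f v) else 0) \<phi>s fs"
    have "set ?\<psi>s \<subseteq> dual s A"
      by (rule map2_dual_compose[OF conjunct2[OF True] assms(4)]) (use assms in auto)
    moreover have "vs ! i \<in> A" if "i < length vs" for i using that assms(2) by auto
    ultimately show ?thesis
      using True assms(1) by (auto simp: tensor_maps_def pure_def intro!: prod.cong)
  next
    case False
    then show ?thesis using assms(1) by (auto simp: tensor_maps_def pure_def)
  qed
qed

lemma tensor_map_eq_maps: "tensor_map s l A B f = tensor_maps s A B (replicate l f)"
proof (intro ext)
  fix T :: "('m \<Rightarrow> 'k) list \<Rightarrow> 'k" and \<phi>s :: "('m \<Rightarrow> 'k) list"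
  have "map2 (\<lambda>\<phi> f v. if v \<in> A then \<phi> (f v) else 0) \<phi>s (replicate l f) =
      map (\<lambda>\<phi> v. if v \<in> A then \<phi> (f v) else 0) \<phi>s" if "length \<phi>s = l"
    using that by (intro nth_equalityI) auto
  then show "tensor_map s l A B f T \<phi>s = tensor_maps s A B (replicate l f) T \<phi>s"
    by (simp add: tensor_map_def tensor_maps_def)
qed

lemma tensor_map_image:
  assumes "linear_on s s A f" "f ` A \<subseteq> C" "subspace A" "B \<subseteq> A"
  shows "tensor_map s l A C f ` tensor_sub s l A B = tensor_sub s l C (f ` B)"
proof -
  let ?P = "\<lambda>A B. {pure s A vs | vs. length vs = l \<and> set vs \<subseteq> B}"
  have p: "tensor_map s l A C f (pure s A vs) = pure s C (map f vs)"
    if "length vs = l" "set vs \<subseteq> B" for vs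
    using that assms module_axioms by (intro tensor_map_pure) auto
  have "tensor_map s l A C f ` ?P A B = ?P C (f ` B)"
  proof
    show "tensor_map s l A C f ` ?P A B \<subseteq> ?P C (f ` B)"
    proof
      fix T assume "T \<in> tensor_map s l A C f ` ?P A B"
      then obtain vs where "length vs = l" "set vs \<subseteq> B" "T = tensor_map s l A C f (pure s A vs)" by blast
      then show "T \<in> ?P C (f ` B)" using p by (intro CollectI exI[of _ "map f vs"]) auto
    qed
    show "?P C (f ` B) \<subseteq> tensor_map s l A C f ` ?P A B"
    proof
      fix T assume "T \<in> ?P C (f ` B)"
      then obtain ws where ws: "length ws = l" "set ws \<subseteq> f ` B" "T = pure s C ws" by blast
      then have "ws \<in> lists (f ` B)" by auto
      then obtain vs where vs: "ws = map f vs" "vs \<in> lists B" unfolding lists_image by blast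
      have l: "length vs = l" "set vs \<subseteq> B" using vs ws(1) by auto
      then have "T = tensor_map s l A C f (pure s A vs)" using p[OF l] ws(3) vs(1) by simp
      then show "T \<in> tensor_map s l A C f ` ?P A B" using l by blast
    qed
  qed
  then show ?thesis
    unfolding tensor_sub_def
    using image_span[OF module_tscl tensor_map_linear module.subspace_UNIV[OF module_tscl] subset_UNIV, of s l A C f "?P A B"]
    by simp
qed

lemma tensor_maps_tensor_map:
  assumes "length fs = l" "\<And>f. f \<in> set fs \<Longrightarrow> linear_on s s A f \<and> f ` A \<subseteq> C" "subspace A"
    and "g ` A' \<subseteq> A"
  shows "tensor_maps s A C fs (tensor_map s l A' A g T) = tensor_maps s A' C (map (\<lambda>f v. f (g v)) fs) T"
proof
  fix \<phi>s
  show "tensor_maps s A C fs (tensor_map s l A' A g T) \<phi>s = tensor_maps s A' C (map (\<lambda>f v. f (g v)) fs) T \<phi>s"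
  proof (cases "length \<phi>s = length fs \<and> set \<phi>s \<subseteq> dual s C")
    case True
    let ?\<psi>s = "map2 (\<lambda>\<phi> f v. if v \<in> A then \<phi> (f v) else 0) \<phi>s fs"
    have "set ?\<psi>s \<subseteq> dual s A"
      by (rule map2_dual_compose[OF conjunct2[OF True] assms(2)]) (use assms in auto)
    moreover have "map (\<lambda>\<phi> v. if v \<in> A' then \<phi> (g v) else 0) ?\<psi>s =
        map2 (\<lambda>\<phi> f v. if v \<in> A' then \<phi> (f v) else 0) \<phi>s (map (\<lambda>f v. f (g v)) fs)"
      using True assms(4) by (intro nth_equalityI) (auto simp: fun_eq_iff)
    ultimately show ?thesis using True assms(1) by (simp add: tensor_maps_def tensor_map_def)
  next
    case False
    then show ?thesis by (auto simp: tensor_maps_def)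
  qed
qed

lemma tensor_maps_add:
  assumes "length fs = l" "\<And>f. f \<in> set fs \<Longrightarrow> linear_on s s A f \<and> f ` A \<subseteq> C" "subspace A" "subspace C"
    and j: "j < l" and g: "linear_on s s A g" "g ` A \<subseteq> C" and h: "linear_on s s A h" "h ` A \<subseteq> C"
    and eq: "\<And>v. v \<in> A \<Longrightarrow> (fs ! j) v = g v + h v"
    and T: "T \<in> tensor_space s l A"
  shows "tensor_maps s A C fs T = tensor_maps s A C (fs[j := g]) T + tensor_maps s A C (fs[j := h]) T"
proof -
  let ?M = "\<lambda>fs. tensor_maps s A C fs"
  have upd: "linear_on s s A f \<and> f ` A \<subseteq> C" if "f \<in> set (fs[j := k])" "k = g \<or> k = h" for f k
  proof -
    have "f = k \<or> f \<in> set fs" using that(1) set_update_subset_insert[of fs j k] by blast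
    then show ?thesis using that(2) assms(2) g h by blast
  qed
  have lin: "linear_on tscl tscl UNIV (\<lambda>T. ?M (fs[j := g]) T + ?M (fs[j := h]) T)"
    by (auto simp: linear_on_def tensor_maps_def tscl_def fun_eq_iff algebra_simps)
  show ?thesis
  proof (rule linear_eq_on_tensor_sub[OF tensor_maps_linear lin module_tscl _ T[unfolded tensor_space_eq_sub]])
    fix vs assume vs: "length vs = l" "set vs \<subseteq> A"
    let ?ws = "map2 (\<lambda>f v. f v) fs vs"
    have ws: "length ?ws = l" "set ?ws \<subseteq> C"
      using vs assms(1) map2_apply_subset[of fs A C vs] assms(2) by simp_all
    have vj: "vs ! j \<in> A" using vs j by auto
    have p: "?M (fs[j := k]) (pure s A vs) = pure s C (?ws[j := k (vs ! j)])" if "k = g \<or> k = h" for k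
    proof -
      have "map2 (\<lambda>f v. f v) (fs[j := k]) vs = ?ws[j := k (vs ! j)]"
        using vs assms(1) j by (intro nth_equalityI) (auto simp: nth_list_update)
      then show ?thesis using tensor_maps_pure[OF _ vs(2) assms(3), of "fs[j := k]" C] upd[OF _ that] vs assms(1)
        by simp
    qed
    have "?ws[j := g (vs ! j) + h (vs ! j)] = ?ws"
      using eq[OF vj] vs(1) assms(1) j by (intro nth_equalityI) (auto simp: nth_list_update)
    then have "?M fs (pure s A vs) = pure s C (?ws[j := g (vs ! j) + h (vs ! j)])"
      using tensor_maps_pure[OF _ vs(2) assms(3), of fs C] assms(1,2) vs by simp
    also have "\<dots> = pure s C (?ws[j := g (vs ! j)]) + pure s C (?ws[j := h (vs ! j)])"
    proof -
      have "linear_on s tscl C (\<lambda>v. pure s C (?ws[j := v]))"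
        using pure_multilinear[OF module_axioms assms(4), of l] ws j unfolding multilinear_on_def by blast
      moreover have "g (vs ! j) \<in> C" "h (vs ! j) \<in> C" using g h vj by auto
      ultimately show ?thesis by (rule linear_on_add)
    qed
    finally show "?M fs (pure s A vs) = ?M (fs[j := g]) (pure s A vs) + ?M (fs[j := h]) (pure s A vs)"
      by (simp add: p)
  qed
qed

lemma tensor_maps_kill:
  assumes "length fs = l" "\<And>f. f \<in> set fs \<Longrightarrow> linear_on s s A f \<and> f ` A \<subseteq> C" "subspace A" "B \<subseteq> A"
    and j: "j < l" "\<And>v. v \<in> B \<Longrightarrow> (fs ! j) v = 0"
    and T: "T \<in> tensor_sub s l A B"
  shows "tensor_maps s A C fs T = 0"
proof (rule linear_eq_on_tensor_sub[OF tensor_maps_linear _ module_tscl _ T, where g = "\<lambda>_. 0"])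
  show "linear_on tscl tscl UNIV (\<lambda>_. 0 :: ('m \<Rightarrow> 'k) list \<Rightarrow> 'k)"
    by (auto simp: linear_on_def tscl_def fun_eq_iff)
  fix vs assume vs: "length vs = l" "set vs \<subseteq> B"
  let ?ws = "map2 (\<lambda>f v. f v) fs vs"
  have "vs ! j \<in> B" using vs j(1) nth_mem by blast
  then have j0: "?ws ! j = 0" "length ?ws = l" using vs j assms(1) by auto
  have "pure s C ?ws = 0"
  proof
    fix \<phi>s
    have "(\<Prod>i<l. (\<phi>s ! i) (?ws ! i)) = 0" if "length \<phi>s = l" "set \<phi>s \<subseteq> dual s C"
    proof -
      have "\<phi>s ! j \<in> dual s C" using that j by auto
      then have "(\<phi>s ! j) 0 = 0"
        by (cases "0 \<in> C") (auto simp: dual_def linear_on_def dest!: spec[of _ 0] bspec[of _ _ 0])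
      then show ?thesis using j(1) j0(1) by (intro prod_zero bexI[of _ j]) auto
    qed
    then show "pure s C ?ws \<phi>s = 0 \<phi>s" using j0 by (simp add: pure_def)
  qed
  then show "tensor_maps s A C fs (pure s A vs) = 0"
    using tensor_maps_pure[of fs vs A C] assms vs by simp
qed

lemma tensor_maps_range:
  assumes "length fs = l" "\<And>f. f \<in> set fs \<Longrightarrow> linear_on s s A f \<and> f ` A \<subseteq> R" "subspace A" "R \<subseteq> C"
    and T: "T \<in> tensor_space s l A"
  shows "tensor_maps s A C fs T \<in> tensor_sub s l C R"
proof (rule linear_image_tensor_sub[OF tensor_maps_linear subspace_tensor_sub _ T[unfolded tensor_space_eq_sub]])
  fix vs assume vs: "length vs = l" "set vs \<subseteq> A"
  let ?ws = "map2 (\<lambda>f v. f v) fs vs"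
  have "set ?ws \<subseteq> R" using map2_apply_subset[of fs A R vs] assms(2) vs(2) by blast
  moreover have "tensor_maps s A C fs (pure s A vs) = pure s C ?ws"
    using assms vs by (intro tensor_maps_pure) auto
  moreover have "length ?ws = l" using vs assms(1) by simp
  ultimately show "tensor_maps s A C fs (pure s A vs) \<in> tensor_sub s l C R"
    by (simp only: pure_in_tensor_sub)
qed

lemma tensor_maps_id:
  assumes "length fs = l" "\<And>f. f \<in> set fs \<Longrightarrow> linear_on s s A f \<and> f ` A \<subseteq> A" "subspace A" "R \<subseteq> A"
    and id: "\<And>f v. f \<in> set fs \<Longrightarrow> v \<in> R \<Longrightarrow> f v = v"
    and T: "T \<in> tensor_sub s l A R"
  shows "tensor_maps s A A fs T = T"
proof (rule linear_eq_on_tensor_sub[OF tensor_maps_linear _ module_tscl _ T, where g = "\<lambda>T. T"])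
  show "linear_on tscl tscl UNIV (\<lambda>T :: ('m \<Rightarrow> 'k) list \<Rightarrow> 'k. T)" by (simp add: linear_on_def)
  fix vs assume vs: "length vs = l" "set vs \<subseteq> R"
  have "map2 (\<lambda>f v. f v) fs vs = vs"
  proof (rule nth_equalityI)
    fix i assume "i < length (map2 (\<lambda>f v. f v) fs vs)"
    then have "i < l" using vs assms(1) by simp
    then have "fs ! i \<in> set fs" "vs ! i \<in> R"
      using vs assms(1) nth_mem[of i fs] nth_mem[of i vs] by auto
    then show "map2 (\<lambda>f v. f v) fs vs ! i = vs ! i" using id \<open>i < l\<close> vs assms(1) by simp
  qed (use vs assms(1) in simp)
  then show "tensor_maps s A A fs (pure s A vs) = pure s A vs"
    using tensor_maps_pure[of fs vs A A] assms vs by auto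
qed

text \<open>
  A projector \<open>e\<close> onto \<open>B\<close> that maps \<open>C\<close> into \<open>B \<inter> C\<close> fixes the tensors over \<open>B\<close> and sends those over
  \<open>C\<close> to tensors over \<open>B \<inter> C\<close>.
\<close>

lemma tensor_sub_Int:
  assumes "subspace A" "subspace B" "subspace C" "B \<subseteq> A" "C \<subseteq> A"
  shows "tensor_sub s l A (B \<inter> C) = tensor_sub s l A B \<inter> tensor_sub s l A C"
proof
  show "tensor_sub s l A (B \<inter> C) \<subseteq> tensor_sub s l A B \<inter> tensor_sub s l A C"
    by (simp add: tensor_sub_mono)
  obtain e where e: "linear_on s s UNIV e" "\<And>v. e v \<in> B" "\<And>v. v \<in> B \<Longrightarrow> e v = v"
    "\<And>v. v \<in> C \<Longrightarrow> e v \<in> B \<inter> C"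
    by (rule exists_projector[OF s assms(2,3)], rule that)
  have lin: "linear_on s s A e" using linear_on_subset[OF e(1)] by simp
  show "tensor_sub s l A B \<inter> tensor_sub s l A C \<subseteq> tensor_sub s l A (B \<inter> C)"
  proof
    fix T assume T: "T \<in> tensor_sub s l A B \<inter> tensor_sub s l A C"
    have eA: "e ` A \<subseteq> A" using e(2) assms(4) by blast
    have "tensor_map s l A A e T = T"
      unfolding tensor_map_eq_maps
      by (rule tensor_maps_id[where R = B]) (use lin eA e(3) assms T in auto)
    moreover have "tensor_map s l A A e T \<in> tensor_sub s l A (e ` C)"
      using T tensor_map_image[OF lin eA assms(1,5)] by blast
    moreover have "tensor_sub s l A (e ` C) \<subseteq> tensor_sub s l A (B \<inter> C)"
      by (rule tensor_sub_mono) (use e(4) in blast)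
    ultimately show "T \<in> tensor_sub s l A (B \<inter> C)" by auto
  qed
qed

lemma tensor_sub_Inter:
  assumes "finite \<B>" "subspace A" "\<And>B. B \<in> \<B> \<Longrightarrow> subspace B \<and> B \<subseteq> A"
  shows "tensor_sub s l A (A \<inter> \<Inter>\<B>) = tensor_space s l A \<inter> (\<Inter>B\<in>\<B>. tensor_sub s l A B)"
  using assms(1,3)
proof (induction \<B> rule: finite_induct)
  case empty
  then show ?case by (simp add: tensor_space_eq_sub)
next
  case (insert B \<B>)
  have "subspace (A \<inter> \<Inter>\<B>)"
    using insert.prems assms(2) by (intro subspace_inter subspace_Inter) auto
  then have "tensor_sub s l A (B \<inter> (A \<inter> \<Inter>\<B>)) = tensor_sub s l A B \<inter> tensor_sub s l A (A \<inter> \<Inter>\<B>)"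
    using insert.prems assms(2) by (intro tensor_sub_Int) auto
  moreover have "A \<inter> \<Inter>(insert B \<B>) = B \<inter> (A \<inter> \<Inter>\<B>)" by auto
  ultimately show ?case using insert by auto
qed

lemma tensor_space_finite:
  assumes "finite B0" "span B0 = A"
  shows "\<exists>C. finite C \<and> module.span tscl C = tensor_space s l A"
proof -
  have sA: "subspace A" using assms(2) subspace_span by blast
  obtain B where B: "finite B" "independent B" "span B = A" "card B = dim A"
    by (rule finite_basis_of_subspace[OF s assms(1) _ sA]) (use assms(2) in simp)+
  let ?C = "pure s A ` {bs. length bs = l \<and> set bs \<subseteq> B}"
  have fin: "finite {bs. length bs = l \<and> set bs \<subseteq> B}"
    using finite_lists_length_eq[OF B(1), of l] by (simp add: conj_commute)
  have BA: "B \<subseteq> A" using B(3) span_superset by blast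
  have "pure s A vs \<in> module.span tscl ?C" if "length vs = l" "set vs \<subseteq> A" for vs
  proof -
    have "pure s A ([] @ vs) = (\<Sum>bs | length bs = length vs \<and> set bs \<subseteq> B.
        tscl (\<Prod>i<length vs. representation B (vs ! i) (bs ! i)) (pure s A ([] @ bs)))"
      by (rule multilinear_expand[OF s vector_space_tscl B(2,1,3) pure_multilinear[OF module_axioms sA, of l]])
        (use that in auto)
    also have "\<dots> \<in> module.span tscl ?C"
      using that by (intro module.span_sum[OF module_tscl] module.span_scale[OF module_tscl]
          module.span_base[OF module_tscl]) auto
    finally show ?thesis by simp
  qed
  then have "tensor_space s l A \<subseteq> module.span tscl ?C"
    unfolding tensor_space_def
    by (intro module.span_minimal[OF module_tscl] module.subspace_span[OF module_tscl]) auto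
  moreover have "module.span tscl ?C \<subseteq> tensor_space s l A"
    unfolding tensor_space_def by (rule module.span_mono[OF module_tscl]) (use BA in auto)
  ultimately show ?thesis using fin by (intro exI[of _ ?C]) auto
qed

end

section \<open>Splitting products of linear maps\<close>

inductive_set sums_of :: "'a::comm_monoid_add set \<Rightarrow> 'a set" for X where
  zero: "0 \<in> sums_of X"
| add: "x \<in> X \<Longrightarrow> y \<in> sums_of X \<Longrightarrow> x + y \<in> sums_of X"

lemma sums_of_base: "x \<in> X \<Longrightarrow> x \<in> sums_of X"
  using sums_of.add[OF _ sums_of.zero] by fastforce

lemma sums_of_add: "x \<in> sums_of X \<Longrightarrow> y \<in> sums_of X \<Longrightarrow> x + y \<in> sums_of X"
  by (induction rule: sums_of.induct) (auto simp: add.assoc intro: sums_of.intros)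

lemma sums_of_trans: "x \<in> sums_of X \<Longrightarrow> X \<subseteq> sums_of Y \<Longrightarrow> x \<in> sums_of Y"
  by (induction rule: sums_of.induct) (auto intro: sums_of_add sums_of.zero)

lemma sums_of_mono: "X \<subseteq> Y \<Longrightarrow> sums_of X \<subseteq> sums_of Y"
  using sums_of_trans sums_of_base by blast

text \<open>Group the summands by a chosen index of a set that contains them.\<close>

lemma sums_of_UN:
  assumes "x \<in> sums_of (\<Union>i\<in>I. X i)" "finite I"
  obtains g where "\<And>i. i \<in> I \<Longrightarrow> g i \<in> sums_of (X i)" "x = sum g I"
proof -
  have "\<exists>g. (\<forall>i\<in>I. g i \<in> sums_of (X i)) \<and> x = sum g I"
    using assms(1)
  proof (induction rule: sums_of.induct)
    case zero
    then show ?case by (intro exI[of _ "\<lambda>_. 0"]) (auto intro: sums_of.zero)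
  next
    case (add x y)
    then obtain g j where g: "\<forall>i\<in>I. g i \<in> sums_of (X i)" "y = sum g I" and j: "j \<in> I" "x \<in> X j"
      by blast
    have "(\<Sum>i\<in>I. if i = j then x + g i else g i) = x + sum g I"
      unfolding sum.remove[OF assms(2) j(1)] by (simp add: add.assoc)
    moreover have "\<forall>i\<in>I. (if i = j then x + g i else g i) \<in> sums_of (X i)"
      using g j by (auto intro: sums_of.intros)
    ultimately show ?case using g by (intro exI[of _ "\<lambda>i. if i = j then x + g i else g i"]) simp
  qed
  then show ?thesis using that by blast
qed

text \<open>
  Cutting the product off outside of the tensor space makes identities that hold on that space
  identities of functions, so that a product of maps can be rewritten as a sum of others.
\<close>

definition tensor_op ::
    "('k::field \<Rightarrow> 'm::ab_group_add \<Rightarrow> 'm) \<Rightarrow> nat \<Rightarrow> 'm set \<Rightarrow> 'm set \<Rightarrow> ('m \<Rightarrow> 'm) list \<Rightarrow>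
     (('m \<Rightarrow> 'k) list \<Rightarrow> 'k) \<Rightarrow> (('m \<Rightarrow> 'k) list \<Rightarrow> 'k)" where
  "tensor_op s l A C fs = (\<lambda>T. if T \<in> tensor_space s l A then tensor_maps s A C fs T else 0)"

definition map_lists :: "('k::field \<Rightarrow> 'm::ab_group_add \<Rightarrow> 'm) \<Rightarrow> nat \<Rightarrow> 'm set \<Rightarrow> 'm set \<Rightarrow> ('m \<Rightarrow> 'm) list set" where
  "map_lists s l A R = {fs. length fs = l \<and> (\<forall>f\<in>set fs. linear_on s s A f \<and> f ` A \<subseteq> R)}"

definition kill_count :: "('m \<Rightarrow> 'm::zero) list \<Rightarrow> 'm set \<Rightarrow> nat" where
  "kill_count fs B = card {j. j < length fs \<and> (\<forall>v\<in>B. (fs ! j) v = 0)}"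

context
  fixes s :: "'k::field \<Rightarrow> 'm::ab_group_add \<Rightarrow> 'm" and A R C :: "'m set"
  assumes s: "vector_space s" and A: "module.subspace s A" and R: "module.subspace s R"
    and C: "module.subspace s C" and RC: "R \<subseteq> C"
begin

interpretation vector_space s by (rule s)

abbreviation product :: "nat \<Rightarrow> ('m \<Rightarrow> 'm) list \<Rightarrow> (('m \<Rightarrow> 'k) list \<Rightarrow> 'k) \<Rightarrow> ('m \<Rightarrow> 'k) list \<Rightarrow> 'k" where
  "product l \<equiv> tensor_op s l A C"

abbreviation factors :: "nat \<Rightarrow> ('m \<Rightarrow> 'm) list set" where
  "factors l \<equiv> map_lists s l A R"

lemma map_lists_update:
  "fs \<in> factors l \<Longrightarrow> linear_on s s A g \<Longrightarrow> g ` A \<subseteq> R \<Longrightarrow> fs[j := g] \<in> factors l"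
proof -
  assume fs: "fs \<in> factors l" and g: "linear_on s s A g" "g ` A \<subseteq> R"
  have "linear_on s s A f \<and> f ` A \<subseteq> R" if "f \<in> set (fs[j := g])" for f
  proof -
    have "f = g \<or> f \<in> set fs" using that set_update_subset_insert[of fs j g] by blast
    then show ?thesis using fs g unfolding map_lists_def by blast
  qed
  then show ?thesis using fs unfolding map_lists_def by simp
qed

text \<open>
  With a projector \<open>e\<close> onto \<open>B1\<close> that maps \<open>B2\<close> into \<open>B1 \<inter> B2\<close>, the factor \<open>f\<close> is the sum of
  \<open>f - f \<circ> e\<close>, which vanishes on \<open>B1\<close>, and \<open>f \<circ> e\<close>, which vanishes on \<open>B2\<close>.
\<close>

lemma tensor_op_split:
  assumes fs: "fs \<in> factors l" and j: "j < l"
    and B: "subspace B1" "subspace B2" "B1 \<subseteq> A" "B2 \<subseteq> A"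
    and kill: "\<And>v. v \<in> B1 \<inter> B2 \<Longrightarrow> (fs ! j) v = 0"
  obtains g h where "fs[j := g] \<in> factors l" "fs[j := h] \<in> factors l"
    "product l fs = product l (fs[j := g]) + product l (fs[j := h])"
    "\<And>v. v \<in> B1 \<Longrightarrow> g v = 0" "\<And>v. v \<in> B2 \<Longrightarrow> h v = 0"
proof -
  obtain e where e: "linear_on s s UNIV e" "\<And>v. e v \<in> B1" "\<And>v. v \<in> B1 \<Longrightarrow> e v = v"
    "\<And>v. v \<in> B2 \<Longrightarrow> e v \<in> B1 \<inter> B2"
    by (rule exists_projector[OF s B(1,2)], rule that)
  define f where "f = fs ! j"
  have "f \<in> set fs" using fs j by (auto simp: map_lists_def f_def)
  then have f: "linear_on s s A f" "f ` A \<subseteq> R" using fs by (auto simp: map_lists_def)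
  have eA: "e v \<in> A" for v using e(2) B(3) by blast
  have h: "linear_on s s A (\<lambda>v. f (e v))" "(\<lambda>v. f (e v)) ` A \<subseteq> R"
    using linear_on_compose[OF linear_on_subset[OF e(1) subset_UNIV] f(1)] eA f(2) by auto
  have g: "linear_on s s A (\<lambda>v. f v - f (e v))"
    using f(1) h(1) unfolding linear_on_def by (auto simp: scale_right_diff_distrib)
  have g': "(\<lambda>v. f v - f (e v)) ` A \<subseteq> R"
    using f(2) h(2) subspace_diff[OF R] by (auto simp: image_subset_iff)
  show ?thesis
  proof (rule that)
    show m: "fs[j := \<lambda>v. f v - f (e v)] \<in> factors l" "fs[j := \<lambda>v. f (e v)] \<in> factors l"
      using map_lists_update[OF fs] g g' h by blast+
    have len: "length fs = l" and fsC: "\<And>f. f \<in> set fs \<Longrightarrow> linear_on s s A f \<and> f ` A \<subseteq> C"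
      using fs RC unfolding map_lists_def by blast+
    have "tensor_maps s A C fs T = tensor_maps s A C (fs[j := \<lambda>v. f v - f (e v)]) T +
        tensor_maps s A C (fs[j := \<lambda>v. f (e v)]) T" if "T \<in> tensor_space s l A" for T
      by (rule tensor_maps_add[OF s len fsC A C j g _ h(1) _ _ that])
        (use RC g' h(2) in \<open>auto simp: f_def\<close>)
    then show "product l fs = product l (fs[j := \<lambda>v. f v - f (e v)]) +
        product l (fs[j := \<lambda>v. f (e v)])"
      by (auto simp: tensor_op_def fun_eq_iff)
    show "f v - f (e v) = 0" if "v \<in> B1" for v using e(3)[OF that] by simp
    show "f (e v) = 0" if "v \<in> B2" for v using kill[OF e(4)[OF that]] by (simp add: f_def)
  qed
qed

text \<open>
  Splitting a factor in \<open>J\<close> yields a summand with one more factor that kills \<open>B1\<close> and a summand with one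
  more factor that kills \<open>B2\<close>; what remains to be done is smaller by one in \<open>a\<close> or in \<open>b\<close>, respectively.
\<close>

lemma tensor_op_split_many:
  assumes B: "subspace B1" "subspace B2" "B1 \<subseteq> A" "B2 \<subseteq> A"
    and "finite J" "J \<subseteq> {..<l}" "card J = a + b" "fs \<in> factors l"
    and "\<And>j v. j \<in> J \<Longrightarrow> v \<in> B1 \<inter> B2 \<Longrightarrow> (fs ! j) v = 0"
  shows "product l fs \<in> sums_of (product l ` {fs' \<in> factors l.
    (\<forall>i<l. i \<notin> J \<longrightarrow> fs' ! i = fs ! i) \<and>
    (a \<le> card {j \<in> J. \<forall>v\<in>B1. (fs' ! j) v = 0} \<or> b \<le> card {j \<in> J. \<forall>v\<in>B2. (fs' ! j) v = 0})})"
  using assms(5-)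
proof (induction J arbitrary: a b fs rule: finite_induct)
  case empty
  then show ?case by (intro sums_of_base imageI) auto
next
  case (insert j J)
  show ?case
  proof (cases "a = 0 \<or> b = 0")
    case True
    then show ?thesis using insert.prems by (intro sums_of_base imageI) auto
  next
    case False
    then obtain a' b' where ab: "a = Suc a'" "b = Suc b'" using not0_implies_Suc by blast
    have j: "j < l" using insert.prems(1) by simp
    obtain g h where gh: "fs[j := g] \<in> factors l" "fs[j := h] \<in> factors l"
      "product l fs = product l (fs[j := g]) + product l (fs[j := h])"
      "\<And>v. v \<in> B1 \<Longrightarrow> g v = 0" "\<And>v. v \<in> B2 \<Longrightarrow> h v = 0"
      by (rule tensor_op_split[OF insert.prems(3) j B insert.prems(4)[OF insertI1]], assumption, rule that)
    have len: "length fs = l" using insert.prems(3) by (simp add: map_lists_def)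
    have J: "J \<subseteq> {..<l}" "card J = a' + b" "card J = a + b'"
      using insert.prems(1,2) insert.hyps ab by auto
    have k: "(fs[j := k] ! i) v = 0" if "i \<in> J" "v \<in> B1 \<inter> B2" for k i v
    proof -
      have "i \<noteq> j" using that insert.hyps by blast
      then show ?thesis using insert.prems(4)[of i v] that by simp
    qed
    have card_insert: "card {i \<in> insert j J. P i} = card {i \<in> J. P i} + (if P j then 1 else 0)" for P
    proof -
      have "{i \<in> insert j J. P i} = (if P j then insert j {i \<in> J. P i} else {i \<in> J. P i})" by auto
      then show ?thesis using insert.hyps by simp
    qed
    let ?G = "\<lambda>J a b fs. {fs' \<in> factors l. (\<forall>i<l. i \<notin> J \<longrightarrow> fs' ! i = fs ! i) \<and>
      (a \<le> card {j \<in> J. \<forall>v\<in>B1. (fs' ! j) v = 0} \<or> b \<le> card {j \<in> J. \<forall>v\<in>B2. (fs' ! j) v = 0})}"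
    have sub: "?G J c d (fs[j := k]) \<subseteq> ?G (insert j J) a b fs"
      if "a \<le> c + (if \<forall>v\<in>B1. k v = 0 then 1 else 0)" "b \<le> d + (if \<forall>v\<in>B2. k v = 0 then 1 else 0)" for k c d
    proof
      fix fs' assume fs': "fs' \<in> ?G J c d (fs[j := k])"
      have k: "fs' ! j = k" using fs' j insert.hyps len by auto
      have "c \<le> card {i \<in> J. \<forall>v\<in>B1. (fs' ! i) v = 0} \<or> d \<le> card {i \<in> J. \<forall>v\<in>B2. (fs' ! i) v = 0}"
        using fs' by blast
      then have "a \<le> card {i \<in> insert j J. \<forall>v\<in>B1. (fs' ! i) v = 0} \<or>
          b \<le> card {i \<in> insert j J. \<forall>v\<in>B2. (fs' ! i) v = 0}"
        using that unfolding card_insert k by linarith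
      moreover have "\<forall>i<l. i \<notin> insert j J \<longrightarrow> fs' ! i = fs ! i" using fs' by auto
      ultimately show "fs' \<in> ?G (insert j J) a b fs" using fs' by blast
    qed
    have 1: "product l (fs[j := g]) \<in> sums_of (product l ` ?G (insert j J) a b fs)"
      using insert.IH[OF J(1,2) gh(1) k] sums_of_mono[OF image_mono[OF sub[of a' g b]]] gh(4) ab by auto
    have 2: "product l (fs[j := h]) \<in> sums_of (product l ` ?G (insert j J) a b fs)"
      using insert.IH[OF J(1,3) gh(2) k] sums_of_mono[OF image_mono[OF sub[of a h b']]] gh(5) ab by auto
    show ?thesis unfolding gh(3) using 1 2 by (rule sums_of_add)
  qed
qed

text \<open>
  Only \<open>2 * r\<close> of the factors that kill \<open>B1 \<inter> B2\<close> are split. In each summand \<open>r\<close> of the new factors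
  kill the same one of the two subspaces, and of any \<open>3 * r\<close> old factors at least \<open>r\<close> are untouched.
\<close>

lemma tensor_op_split_count:
  assumes B: "subspace B1" "subspace B2" "B1 \<subseteq> A" "B2 \<subseteq> A"
    and fs: "fs \<in> factors l" and r: "3 * r \<le> kill_count fs (B1 \<inter> B2)"
  shows "product l fs \<in> sums_of (product l ` {fs' \<in> factors l.
    (\<forall>U. 3 * r \<le> kill_count fs U \<longrightarrow> r \<le> kill_count fs' U) \<and>
    (r \<le> kill_count fs' B1 \<or> r \<le> kill_count fs' B2)})"
proof -
  have len: "length fs = l" using fs by (simp add: map_lists_def)
  obtain J where J: "J \<subseteq> {j. j < l \<and> (\<forall>v\<in>B1 \<inter> B2. (fs ! j) v = 0)}" "card J = r + r" "finite J"
    using r obtain_subset_with_card_n[of "r + r" "{j. j < l \<and> (\<forall>v\<in>B1 \<inter> B2. (fs ! j) v = 0)}"]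
    unfolding kill_count_def len by auto
  let ?G = "{fs' \<in> factors l. (\<forall>i<l. i \<notin> J \<longrightarrow> fs' ! i = fs ! i) \<and>
    (r \<le> card {j \<in> J. \<forall>v\<in>B1. (fs' ! j) v = 0} \<or> r \<le> card {j \<in> J. \<forall>v\<in>B2. (fs' ! j) v = 0})}"
  have "product l fs \<in> sums_of (product l ` ?G)"
    using J by (intro tensor_op_split_many[OF B J(3) _ J(2) fs]) auto
  moreover have "?G \<subseteq> {fs' \<in> factors l.
    (\<forall>U. 3 * r \<le> kill_count fs U \<longrightarrow> r \<le> kill_count fs' U) \<and>
    (r \<le> kill_count fs' B1 \<or> r \<le> kill_count fs' B2)}"
  proof
    fix fs' assume fs': "fs' \<in> ?G"
    have len': "length fs' = l" using fs' by (simp add: map_lists_def)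
    have kc: "card {j \<in> J. \<forall>v\<in>B. (fs' ! j) v = 0} \<le> kill_count fs' B" for B
      unfolding kill_count_def len' using J by (intro card_mono) auto
    have "r \<le> kill_count fs' U" if U: "3 * r \<le> kill_count fs U" for U
    proof -
      have "{j. j < l \<and> (\<forall>v\<in>U. (fs ! j) v = 0)} - J \<subseteq> {j. j < l \<and> (\<forall>v\<in>U. (fs' ! j) v = 0)}"
        using fs' by auto
      then have "card ({j. j < l \<and> (\<forall>v\<in>U. (fs ! j) v = 0)} - J) \<le> kill_count fs' U"
        unfolding kill_count_def len' by (intro card_mono) auto
      moreover have "kill_count fs U - card J \<le> card ({j. j < l \<and> (\<forall>v\<in>U. (fs ! j) v = 0)} - J)"
        unfolding kill_count_def len using J(3) by (intro diff_card_le_card_Diff) auto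
      ultimately show ?thesis using U J(2) by simp
    qed
    moreover have "r \<le> kill_count fs' B1 \<or> r \<le> kill_count fs' B2"
      using fs' kc[of B1] kc[of B2] by auto
    ultimately show "fs' \<in> {fs' \<in> factors l.
      (\<forall>U. 3 * r \<le> kill_count fs U \<longrightarrow> r \<le> kill_count fs' U) \<and>
      (r \<le> kill_count fs' B1 \<or> r \<le> kill_count fs' B2)}" using fs' by blast
  qed
  ultimately show ?thesis using sums_of_mono[OF image_mono] by blast
qed

text \<open>
  Treating the elements of \<open>\<T>\<close> one after the other triples the number of required factors each
  time, since each step may spoil factors that were gained before. The number \<open>n\<close> is chosen before the
  tensor exponent \<open>l\<close> because \<open>l\<close> is only fixed at the end, when all these numbers are known.
\<close>

lemma tensor_op_split_family:
  assumes S: "subspace S" "S \<subseteq> A" and "finite \<T>"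
    and "\<And>T. T \<in> \<T> \<Longrightarrow> subspace T \<and> T \<subseteq> A"
  shows "\<exists>n\<ge>r. \<forall>l. \<forall>fs\<in>factors l. (\<forall>T\<in>\<T>. n \<le> kill_count fs (S \<inter> T)) \<longrightarrow>
    product l fs \<in> sums_of (product l ` {fs' \<in> factors l.
      (\<forall>U. n \<le> kill_count fs U \<longrightarrow> r \<le> kill_count fs' U) \<and>
      (r \<le> kill_count fs' S \<or> (\<forall>T\<in>\<T>. r \<le> kill_count fs' T))})"
  using assms(3-)
proof (induction \<T> arbitrary: r rule: finite_induct)
  case empty
  show ?case by (rule exI[of _ r]) (auto intro!: sums_of_base)
next
  case (insert T \<T>)
  let ?G = "\<lambda>\<T> l n r fs. {fs' \<in> factors l.
      (\<forall>U. n \<le> kill_count fs U \<longrightarrow> r \<le> kill_count fs' U) \<and>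
      (r \<le> kill_count fs' S \<or> (\<forall>T\<in>\<T>. r \<le> kill_count fs' T))}"
  obtain n where n: "n \<ge> r" "\<And>l fs. fs \<in> factors l \<Longrightarrow> (\<And>T. T \<in> \<T> \<Longrightarrow> n \<le> kill_count fs (S \<inter> T)) \<Longrightarrow>
      product l fs \<in> sums_of (product l ` ?G \<T> l n r fs)"
    using insert.IH[of r] insert.prems by auto
  have T: "subspace T" "T \<subseteq> A" using insert.prems by auto
  have "product l fs \<in> sums_of (product l ` ?G (insert T \<T>) l (3 * n) r fs)"
    if fs: "fs \<in> factors l" and c: "\<forall>T\<in>insert T \<T>. 3 * n \<le> kill_count fs (S \<inter> T)" for l fs
  proof -
    have "product l fs \<in> sums_of (product l ` {fs' \<in> factors l.
      (\<forall>U. 3 * n \<le> kill_count fs U \<longrightarrow> n \<le> kill_count fs' U) \<and>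
      (n \<le> kill_count fs' S \<or> n \<le> kill_count fs' T)})"
      using c by (intro tensor_op_split_count[OF S(1) T(1) S(2) T(2) fs]) auto
    moreover have "product l fs' \<in> sums_of (product l ` ?G (insert T \<T>) l (3 * n) r fs)"
      if m: "fs' \<in> factors l" and keep: "\<forall>U. 3 * n \<le> kill_count fs U \<longrightarrow> n \<le> kill_count fs' U"
        and alt: "n \<le> kill_count fs' S \<or> n \<le> kill_count fs' T" for fs'
    proof (cases "n \<le> kill_count fs' S")
      case True
      have "fs' \<in> ?G (insert T \<T>) l (3 * n) r fs" using m keep True n(1) by (auto intro: order_trans)
      then show ?thesis by (intro sums_of_base imageI)
    next
      case False
      have "product l fs' \<in> sums_of (product l ` ?G \<T> l n r fs')"
        using c keep by (intro n(2)[OF m]) auto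
      moreover have "?G \<T> l n r fs' \<subseteq> ?G (insert T \<T>) l (3 * n) r fs"
        using keep alt False by auto
      ultimately show ?thesis using sums_of_mono[OF image_mono] by blast
    qed
    ultimately show ?thesis by (elim sums_of_trans) blast
  qed
  then show ?case using n(1) by (intro exI[of _ "3 * n"]) auto
qed

text \<open>
  Induction on the ideal. For a maximal element \<open>S\<close> of \<open>I\<close> the splitting with respect to \<open>S\<close> and all \<open>T\<close>
  not below \<open>S\<close> leaves summands that are as wanted for \<open>S\<close> and others that satisfy the hypothesis for
  \<open>I - {S}\<close>. For the empty ideal a factor kills the whole space, and the product is 0.
\<close>

lemma tensor_op_split_ideal:
  fixes L I :: "'i::order set" and K :: "'i \<Rightarrow> 'm set"
  assumes L: "finite L" and K: "\<And>S. S \<in> L \<Longrightarrow> subspace (K S) \<and> K S \<subseteq> A"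
    and bot: "b \<in> L" "K b = A"
    and join: "\<And>S T. S \<in> L \<Longrightarrow> T \<in> L \<Longrightarrow> \<exists>J\<in>L. S \<le> J \<and> T \<le> J \<and> K J = K S \<inter> K T"
    and I: "I \<subseteq> L" "\<And>S T. S \<in> I \<Longrightarrow> T \<in> L \<Longrightarrow> T \<le> S \<Longrightarrow> T \<in> I"
  shows "\<exists>n. \<forall>l. \<forall>fs\<in>factors l. (\<forall>T\<in>L - I. n \<le> kill_count fs (K T)) \<longrightarrow>
    product l fs \<in> sums_of (product l `
      (\<Union>S\<in>I. {fs' \<in> factors l. \<forall>T\<in>L. \<not> T \<le> S \<longrightarrow> r \<le> kill_count fs' (K T)}))"
proof -
  let ?G = "\<lambda>l I. (\<Union>S\<in>I. {fs' \<in> factors l. \<forall>T\<in>L. \<not> T \<le> S \<longrightarrow> r \<le> kill_count fs' (K T)})"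
  have "finite I" using I(1) L by (rule finite_subset)
  then show ?thesis using I
  proof (induction I rule: finite_psubset_induct)
    case (psubset I)
    show ?case
    proof (cases "I = {}")
      case True
      have "product l fs = 0" if fs: "fs \<in> factors l" "\<forall>T\<in>L - I. 1 \<le> kill_count fs (K T)" for l fs
      proof -
        have len: "length fs = l" using fs by (simp add: map_lists_def)
        have "1 \<le> kill_count fs A" using fs(2) bot True by auto
        then have "{j. j < l \<and> (\<forall>v\<in>A. (fs ! j) v = 0)} \<noteq> {}"
          unfolding kill_count_def len by (metis card.empty not_one_le_zero)
        then obtain j where j: "j < l" "\<And>v. v \<in> A \<Longrightarrow> (fs ! j) v = 0" by blast
        have fsC: "\<And>f. f \<in> set fs \<Longrightarrow> linear_on s s A f \<and> f ` A \<subseteq> C"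
          using fs(1) RC unfolding map_lists_def by blast
        have "tensor_maps s A C fs T = 0" if "T \<in> tensor_space s l A" for T
          by (rule tensor_maps_kill[OF s len fsC A subset_refl j that[unfolded tensor_space_eq_sub]])
        then show ?thesis by (auto simp: tensor_op_def fun_eq_iff)
      qed
      then show ?thesis by (intro exI[of _ 1] allI ballI impI) (simp only: sums_of.zero)
    next
      case False
      obtain S where S: "S \<in> I" "\<And>T. T \<in> I \<Longrightarrow> S \<le> T \<Longrightarrow> S = T"
        using finite_has_maximal[OF psubset.hyps False] by blast
      have SL: "S \<in> L" using S psubset.prems by blast
      have "\<exists>n. \<forall>l. \<forall>fs\<in>factors l. (\<forall>T\<in>L - (I - {S}). n \<le> kill_count fs (K T)) \<longrightarrow>
          product l fs \<in> sums_of (product l ` ?G l (I - {S}))"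
      proof (rule psubset.IH)
        show "I - {S} \<subset> I" using S by blast
        show "I - {S} \<subseteq> L" using psubset.prems by blast
        show "T' \<in> I - {S}" if T: "T \<in> I - {S}" "T' \<in> L" "T' \<le> T" for T T'
          using psubset.prems(2)[of T T'] S(2)[of T] T by blast
      qed
      then obtain n1 where n1: "\<And>l fs. fs \<in> factors l \<Longrightarrow> \<forall>T\<in>L - (I - {S}). n1 \<le> kill_count fs (K T) \<Longrightarrow>
          product l fs \<in> sums_of (product l ` ?G l (I - {S}))" by blast
      define r' where "r' = max r n1"
      let ?T = "K ` {T \<in> L. \<not> T \<le> S}"
      have fin: "finite ?T" and sub: "subspace (K S)" "K S \<subseteq> A"
          "\<And>T. T \<in> ?T \<Longrightarrow> subspace T \<and> T \<subseteq> A"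
        using K SL L by auto
      obtain n where n: "n \<ge> r'" "\<forall>l. \<forall>fs\<in>factors l. (\<forall>T\<in>?T. n \<le> kill_count fs (K S \<inter> T)) \<longrightarrow>
        product l fs \<in> sums_of (product l ` {fs' \<in> factors l.
          (\<forall>U. n \<le> kill_count fs U \<longrightarrow> r' \<le> kill_count fs' U) \<and>
          (r' \<le> kill_count fs' (K S) \<or> (\<forall>T\<in>?T. r' \<le> kill_count fs' T))})"
        by (rule exE[OF tensor_op_split_family[OF sub(1,2) fin, of r']],
            rule sub(3), assumption, elim conjE, rule that)
      have "product l fs \<in> sums_of (product l ` ?G l I)"
        if fs: "fs \<in> factors l" and c: "\<forall>T\<in>L - I. n \<le> kill_count fs (K T)" for l fs
      proof -
        have "n \<le> kill_count fs (K S \<inter> K T)" if T: "T \<in> L" "\<not> T \<le> S" for T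
        proof -
          obtain J where J: "J \<in> L" "S \<le> J" "T \<le> J" "K J = K S \<inter> K T"
            using join[OF SL T(1)] by blast
          then have "J \<notin> I" using S(2)[of J] T by auto
          then have "n \<le> kill_count fs (K J)" using c J(1) by blast
          then show ?thesis by (simp only: J(4))
        qed
        then have "product l fs \<in> sums_of (product l ` {fs' \<in> factors l.
          (\<forall>U. n \<le> kill_count fs U \<longrightarrow> r' \<le> kill_count fs' U) \<and>
          (r' \<le> kill_count fs' (K S) \<or> (\<forall>T\<in>?T. r' \<le> kill_count fs' T))})"
          by (intro n(2)[THEN spec, THEN bspec, THEN mp, OF fs]) auto
        moreover have "product l fs' \<in> sums_of (product l ` ?G l I)"
          if m: "fs' \<in> factors l" and keep: "\<forall>U. n \<le> kill_count fs U \<longrightarrow> r' \<le> kill_count fs' U"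
            and alt: "r' \<le> kill_count fs' (K S) \<or> (\<forall>T\<in>?T. r' \<le> kill_count fs' T)" for fs'
        proof (cases "\<forall>T\<in>?T. r' \<le> kill_count fs' T")
          case True
          then have "fs' \<in> ?G l I" using m S(1) unfolding r'_def by auto
          then show ?thesis by (intro sums_of_base imageI)
        next
          case False
          then have kS: "r' \<le> kill_count fs' (K S)" using alt by blast
          have "n1 \<le> kill_count fs' (K T)" if "T \<in> L - (I - {S})" for T
          proof (cases "T = S")
            case True
            then show ?thesis using kS by (simp add: r'_def)
          next
            case False
            then have "r' \<le> kill_count fs' (K T)" using that c keep by blast
            then show ?thesis by (simp add: r'_def)
          qed
          then have "product l fs' \<in> sums_of (product l ` ?G l (I - {S}))"
            using n1[OF m] by blast
          moreover have "?G l (I - {S}) \<subseteq> ?G l I" by blast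
          ultimately show ?thesis using sums_of_mono[OF image_mono] by blast
        qed
        ultimately show ?thesis by (elim sums_of_trans) blast
      qed
      then show ?thesis by blast
    qed
  qed
qed

end

section \<open>Ranks of tensor powers\<close>

lemma tensor_power_simps [simp]:
  "scl (tensor_power Q l V) = tscl"
  "spc (tensor_power Q l V) x = tensor_space (scl V) l (spc V x)"
  "map_at (tensor_power Q l V) a = tensor_map (scl V) l (spc V (tail Q a)) (spc V (head Q a)) (map_at V a)"
  by (simp_all add: tensor_power_def)

lemma is_rep_image:
  assumes "wf_digraph Q" "is_rep Q V" "a \<in> arcs Q"
  shows "map_at V a ` spc V (tail Q a) \<subseteq> spc V (head Q a)"
  using is_rep_simps(5)[OF assms(2,3)] by blast

lemma is_rep_tensor_power:
  assumes Q: "wf_digraph Q" and V: "is_rep Q V"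
  shows "is_rep Q (tensor_power Q l V)"
  unfolding is_rep_def
proof (intro conjI ballI)
  show "vector_space (scl (tensor_power Q l V))" by (simp add: vector_space_tscl)
next
  fix x assume "x \<in> verts Q"
  then obtain B where "finite B" "module.span (scl V) B = spc V x"
    using V unfolding is_rep_def by blast
  then show "\<exists>B. finite B \<and> module.span (scl (tensor_power Q l V)) B = spc (tensor_power Q l V) x"
    using tensor_space_finite[OF is_rep_simps(1)[OF V]] by simp
next
  fix a assume a: "a \<in> arcs Q"
  have t: "tail Q a \<in> verts Q" using wf_digraph.tail_in_verts[OF Q a] .
  show "linear_on (scl (tensor_power Q l V)) (scl (tensor_power Q l V))
      (spc (tensor_power Q l V) (tail Q a)) (map_at (tensor_power Q l V) a)"
    by (simp add: tensor_map_linear)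
  show "map_at (tensor_power Q l V) a ` spc (tensor_power Q l V) (tail Q a)
      \<subseteq> spc (tensor_power Q l V) (head Q a)"
    using tensor_map_image[OF is_rep_simps(1)[OF V] is_rep_simps(4)[OF V a] is_rep_image[OF Q V a]
        is_rep_simps(3)[OF V t] subset_refl, of l]
      tensor_sub_mono[OF is_rep_image[OF Q V a], of "scl V" l "spc V (head Q a)"]
    by (simp add: tensor_space_eq_sub)
qed

text \<open>
  Tensor powers commute with images and, by \<open>tensor_sub_Inter\<close>, with finite intersections; ranks are
  built from these.
\<close>

lemma rank_tensor_power:
  assumes Q: "wf_digraph Q" "finite (arcs Q)" and V: "is_rep Q V" and "x \<in> verts Q" "M \<in> lattice Q x"
  shows "rank Q x M (tensor_power Q l V) = tensor_sub (scl V) l (spc V x) (rank Q x M V)"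
  using assms(4,5)
proof (induction M arbitrary: x rule: lat_induct)
  case (ideal M)
  let ?X = "tensor_power Q l V"
  let ?B = "\<lambda>a S. map_at V a ` rank Q (tail Q a) S V"
  let ?\<B> = "(\<lambda>(a, S). ?B a S) ` (SIGMA a:arcs Q. ideal_at M a)"
  note X = is_rep_tensor_power[OF Q(1) V, of l] and x = ideal.prems
  have arc: "a \<in> arcs Q" "head Q a = x" "tail Q a \<in> verts Q" "S \<in> lattice Q (tail Q a)"
    if "S \<in> ideal_at M a" for a S
    using lattice_ideal(1-3)[OF x(2) that] wf_digraph.tail_in_verts[OF Q(1)] by auto
  have sub: "module.subspace (scl V) (?B a S) \<and> ?B a S \<subseteq> spc V x"
    and im: "map_at ?X a ` rank Q (tail Q a) S ?X = tensor_sub (scl V) l (spc V x) (?B a S)"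
    if S: "S \<in> ideal_at M a" for a S
  proof -
    note a = arc[OF S]
    have le: "rank Q (tail Q a) S V \<subseteq> spc V (tail Q a)" by (rule rank_subset[OF Q(1) V a(3,4)])
    have lin: "linear_on (scl V) (scl V) (spc V (tail Q a)) (map_at V a)" by (rule is_rep_simps(4)[OF V a(1)])
    show "module.subspace (scl V) (?B a S) \<and> ?B a S \<subseteq> spc V x"
      using subspace_linear_image[OF linear_on_subset[OF lin le] is_rep_simps(2,2)[OF V] rank_subspace[OF Q(1) V a(3,4)]]
        is_rep_image[OF Q(1) V a(1)] le a(2) by blast
    show "map_at ?X a ` rank Q (tail Q a) S ?X = tensor_sub (scl V) l (spc V x) (?B a S)"
      unfolding ideal.IH[OF S a(3,4)] tensor_power_simps
      using tensor_map_image[OF is_rep_simps(1)[OF V] lin is_rep_image[OF Q(1) V a(1)]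
          is_rep_simps(3)[OF V a(3)] le, of l] by (simp add: a(2))
  qed
  have "rank Q x M ?X = tensor_space (scl V) l (spc V x) \<inter> (\<Inter>B\<in>?\<B>. tensor_sub (scl V) l (spc V x) B)"
    unfolding rank_rec[OF Q(1) X x] using im arc(1) by auto
  also have "\<dots> = tensor_sub (scl V) l (spc V x) (spc V x \<inter> \<Inter>?\<B>)"
    by (rule tensor_sub_Inter[symmetric, OF is_rep_simps(1)[OF V] _ is_rep_simps(3)[OF V x(1)]])
      (use Q(2) sub in auto)
  also have "spc V x \<inter> \<Inter>?\<B> = rank Q x M V"
    unfolding rank_rec[OF Q(1) V x] using arc(1) by auto
  finally show ?case .
qed

section \<open>Families of projections\<close>

text \<open>
  The operators from which the projection at a path over \<open>y\<close> that ends at \<open>S\<close> is built: in each product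
  at least \<open>r\<close> factors kill the rank at \<open>T\<close>, for every \<open>T\<close> not below \<open>S\<close>. For the final projections \<open>r = 1\<close>
  suffices; larger values are needed to descend to further arrows.
\<close>

definition good_lists where
  "good_lists Q V l R y r S = {fs \<in> map_lists (scl V) l (spc V y) R.
     \<forall>T\<in>lattice Q y. \<not> T \<le> S \<longrightarrow> r \<le> kill_count fs (rank Q y T V)}"

definition good_ops where
  "good_ops Q V l R C y r S = sums_of (tensor_op (scl V) l (spc V y) C ` good_lists Q V l R y r S)"

lemma good_ops_mono:
  assumes "r' \<le> r" "S \<le> S'"
  shows "good_ops Q V l R C y r S \<subseteq> good_ops Q V l R C y r' S'"
proof -
  have "good_lists Q V l R y r S \<subseteq> good_lists Q V l R y r' S'"
  proof
    fix fs assume fs: "fs \<in> good_lists Q V l R y r S"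
    have "r' \<le> kill_count fs (rank Q y T V)" if T: "T \<in> lattice Q y" "\<not> T \<le> S'" for T
    proof -
      have "\<not> T \<le> S" using T(2) assms(2) by (meson order_trans)
      then have "r \<le> kill_count fs (rank Q y T V)" using fs T(1) unfolding good_lists_def by blast
      then show ?thesis using assms(1) by simp
    qed
    then show "fs \<in> good_lists Q V l R y r' S'" using fs unfolding good_lists_def by blast
  qed
  then show ?thesis unfolding good_ops_def by (intro sums_of_mono image_mono)
qed

lemma good_ops_properties:
  assumes Q: "wf_digraph Q" "is_rep Q V" "y \<in> verts Q" and RC: "R \<subseteq> C"
    and F: "F \<in> good_ops Q V l R C y 1 S"
  shows "linear_on tscl tscl (tensor_space (scl V) l (spc V y)) F"
    and "t \<in> tensor_space (scl V) l (spc V y) \<Longrightarrow> F t \<in> tensor_sub (scl V) l C R"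
    and "T \<in> lattice Q y \<Longrightarrow> \<not> T \<le> S \<Longrightarrow> t \<in> tensor_sub (scl V) l (spc V y) (rank Q y T V) \<Longrightarrow> F t = 0"
proof -
  note V = is_rep_simps(1,3)[OF Q(2)] and sub = rank_subset[OF Q]
  let ?A = "spc V y"
  let ?X = "tensor_space (scl V) l ?A"
  have sX: "module.subspace tscl ?X" unfolding tensor_space_eq_sub by (rule subspace_tensor_sub)
  have "linear_on tscl tscl ?X F \<and> (\<forall>t\<in>?X. F t \<in> tensor_sub (scl V) l C R) \<and>
    (\<forall>T\<in>lattice Q y. \<not> T \<le> S \<longrightarrow> (\<forall>t\<in>tensor_sub (scl V) l ?A (rank Q y T V). F t = 0))"
    using F unfolding good_ops_def
  proof (induction rule: sums_of.induct)
    case zero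
    show ?case using module.subspace_0[OF module_tscl subspace_tensor_sub[of "scl V" l C R]]
      by (auto simp: linear_on_def tscl_def fun_eq_iff zero_fun_def)
  next
    case (add x F)
    obtain fs where fs: "fs \<in> good_lists Q V l R y 1 S" "x = tensor_op (scl V) l ?A C fs"
      using add.hyps(1) by blast
    have len: "length fs = l" and R: "\<And>f. f \<in> set fs \<Longrightarrow> linear_on (scl V) (scl V) ?A f \<and> f ` ?A \<subseteq> R"
      and kc: "\<And>T. T \<in> lattice Q y \<Longrightarrow> \<not> T \<le> S \<Longrightarrow> 1 \<le> kill_count fs (rank Q y T V)"
      using fs(1) unfolding good_lists_def map_lists_def by blast+
    have C: "\<And>f. f \<in> set fs \<Longrightarrow> linear_on (scl V) (scl V) ?A f \<and> f ` ?A \<subseteq> C" using R RC by blast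
    have x: "x t = tensor_maps (scl V) ?A C fs t" if "t \<in> ?X" for t using that fs(2) by (simp add: tensor_op_def)
    have lin: "linear_on tscl tscl ?X x"
    proof -
      have "u + v \<in> ?X" "tscl c u \<in> ?X" if "u \<in> ?X" "v \<in> ?X" for u v c
        using module.subspace_add[OF module_tscl sX that] module.subspace_scale[OF module_tscl sX that(1)] .
      then show ?thesis using tensor_maps_linear[of ?X "scl V" ?A C fs] x unfolding linear_on_def by simp
    qed
    have ran: "x t \<in> tensor_sub (scl V) l C R" if t: "t \<in> ?X" for t
      unfolding x[OF t] by (rule tensor_maps_range[OF V(1) len R V(2)[OF Q(3)] RC t])
    have kill: "x t = 0" if T: "T \<in> lattice Q y" "\<not> T \<le> S" and t: "t \<in> tensor_sub (scl V) l ?A (rank Q y T V)" for T t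
    proof -
      have "{j. j < length fs \<and> (\<forall>v\<in>rank Q y T V. (fs ! j) v = 0)} \<noteq> {}"
        using kc[OF T] unfolding kill_count_def by (metis card.empty not_one_le_zero)
      then obtain j where j: "j < l" "\<And>v. v \<in> rank Q y T V \<Longrightarrow> (fs ! j) v = 0" using len by blast
      have "t \<in> ?X" using tensor_sub_mono[OF sub[OF T(1)]] t unfolding tensor_space_eq_sub by blast
      then show ?thesis
        unfolding x[OF \<open>t \<in> ?X\<close>] by (intro tensor_maps_kill[OF V(1) len C V(2)[OF Q(3)] sub[OF T(1)] j t])
    qed
    have "linear_on tscl tscl ?X (x + F)"
      using lin add.IH unfolding linear_on_def by (auto simp: tscl_def fun_eq_iff algebra_simps)
    moreover have "(x + F) t \<in> tensor_sub (scl V) l C R" if t: "t \<in> ?X" for t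
    proof -
      have "F t \<in> tensor_sub (scl V) l C R" using add.IH t by blast
      then have "x t + F t \<in> tensor_sub (scl V) l C R"
        by (rule module.subspace_add[OF module_tscl subspace_tensor_sub ran[OF t]])
      then show ?thesis by simp
    qed
    moreover have "(x + F) t = 0" if "T \<in> lattice Q y" "\<not> T \<le> S" "t \<in> tensor_sub (scl V) l ?A (rank Q y T V)" for T t
    proof -
      have "F t = 0" using add.IH that by blast
      then show ?thesis using kill[OF that] by (simp only: plus_fun_apply add_0_left)
    qed
    ultimately show ?case by blast
  qed
  then show "linear_on tscl tscl ?X F" "t \<in> ?X \<Longrightarrow> F t \<in> tensor_sub (scl V) l C R"
    "T \<in> lattice Q y \<Longrightarrow> \<not> T \<le> S \<Longrightarrow> t \<in> tensor_sub (scl V) l ?A (rank Q y T V) \<Longrightarrow> F t = 0"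
    by blast+
qed

text \<open>
  The second condition says that the \<open>\<pi> p\<close> form a morphism into the sum of copies of the reduced
  representation.
\<close>

definition projection_family where
  "projection_family Q V R C l z S \<pi> \<longleftrightarrow>
    (\<forall>p. red_path S p \<longrightarrow> \<pi> p \<in> good_ops Q V l R C (red_vert Q z p) 1 (last_lat S p)) \<and>
    (\<forall>p a T. red_path S p \<longrightarrow> a \<in> in_arcs Q (red_vert Q z p) \<longrightarrow> T \<in> tensor_space (scl V) l (spc V (tail Q a)) \<longrightarrow>
      \<pi> p (map_at (tensor_power Q l V) a T) = (\<Sum>S'\<in>max_elems (ideal_at (last_lat S p) a). \<pi> (p @ [(a, S')]) T))"

context
  fixes Q :: "('v, 'e) pre_digraph" and V :: "('k::field, 'm::ab_group_add, 'v, 'e) rep"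
    and R C :: "'m set"
  assumes Q: "wf_digraph Q" "finite (arcs Q)" "\<And>x. finite (lattice Q x)" and V: "is_rep Q V"
    and R: "module.subspace (scl V) R" and C: "module.subspace (scl V) C" and RC: "R \<subseteq> C"
begin

interpretation wf_digraph Q by (rule Q(1))

lemma tensor_op_arc:
  assumes a: "a \<in> arcs Q" and fs: "fs \<in> map_lists (scl V) l (spc V (head Q a)) R"
  defines "gs \<equiv> map (\<lambda>f v. f (map_at V a v)) fs"
  shows "gs \<in> map_lists (scl V) l (spc V (tail Q a)) R"
    and "T \<in> tensor_space (scl V) l (spc V (tail Q a)) \<Longrightarrow>
      tensor_op (scl V) l (spc V (head Q a)) C fs (map_at (tensor_power Q l V) a T) =
      tensor_op (scl V) l (spc V (tail Q a)) C gs T"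
    and "kill_count fs (map_at V a ` U) \<le> kill_count gs U"
proof -
  have lin: "linear_on (scl V) (scl V) (spc V (tail Q a)) (map_at V a)"
    and im: "map_at V a ` spc V (tail Q a) \<subseteq> spc V (head Q a)"
    using is_rep_simps(4)[OF V a] is_rep_image[OF Q(1) V a] by blast+
  have len: "length fs = l" and fs': "\<And>f. f \<in> set fs \<Longrightarrow> linear_on (scl V) (scl V) (spc V (head Q a)) f \<and> f ` spc V (head Q a) \<subseteq> R"
    using fs unfolding map_lists_def by blast+
  have "linear_on (scl V) (scl V) (spc V (tail Q a)) g \<and> g ` spc V (tail Q a) \<subseteq> R" if "g \<in> set gs" for g
  proof -
    obtain f where f: "f \<in> set fs" "g = (\<lambda>v. f (map_at V a v))" using \<open>g \<in> set gs\<close> by (auto simp: gs_def)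
    show ?thesis
      unfolding f(2) using linear_on_compose[OF lin conjunct1[OF fs'[OF f(1)]] im] fs'[OF f(1)] im by blast
  qed
  then show "gs \<in> map_lists (scl V) l (spc V (tail Q a)) R"
    using len by (simp add: map_lists_def gs_def)
  have hsub: "module.subspace (scl V) (spc V (head Q a))" by (rule is_rep_simps(3)[OF V head_in_verts[OF a]])
  show "tensor_op (scl V) l (spc V (head Q a)) C fs (map_at (tensor_power Q l V) a T) =
      tensor_op (scl V) l (spc V (tail Q a)) C gs T" if T: "T \<in> tensor_space (scl V) l (spc V (tail Q a))"
  proof -
    have "map_at (tensor_power Q l V) a T \<in> tensor_space (scl V) l (spc V (head Q a))"
      using is_rep_simps(5)[OF is_rep_tensor_power[OF Q(1) V, of l] a] T by simp
    moreover have fsC: "\<And>f. f \<in> set fs \<Longrightarrow> linear_on (scl V) (scl V) (spc V (head Q a)) f \<and> f ` spc V (head Q a) \<subseteq> C"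
      using fs' RC by blast
    have "tensor_maps (scl V) (spc V (head Q a)) C fs (map_at (tensor_power Q l V) a T) =
        tensor_maps (scl V) (spc V (tail Q a)) C gs T"
      unfolding gs_def tensor_power_simps
      by (rule tensor_maps_tensor_map[OF is_rep_simps(1)[OF V] len fsC hsub im])
    ultimately show ?thesis using T by (simp add: tensor_op_def)
  qed
  show "kill_count fs (map_at V a ` U) \<le> kill_count gs U"
    unfolding kill_count_def gs_def by (intro card_mono) auto
qed

text \<open>
  The factors that kill the image of the rank at \<open>T\<close> before the composition with \<open>a\<close> kill the rank at
  \<open>T\<close> afterwards, and this image is the rank at \<open>arc_lat Q a T\<close>, which is not below \<open>S\<close> iff \<open>T\<close> is
  outside of the ideal of \<open>S\<close> at \<open>a\<close>.
\<close>

lemma good_ops_arc: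
  assumes a: "a \<in> arcs Q" and S: "S \<in> lattice Q (head Q a)"
  shows "\<exists>n. \<forall>l. \<forall>F\<in>good_ops Q V l R C (head Q a) n S. \<exists>G.
    (\<forall>S'\<in>max_elems (ideal_at S a). G S' \<in> good_ops Q V l R C (tail Q a) r S') \<and>
    (\<forall>T\<in>tensor_space (scl V) l (spc V (tail Q a)).
      F (map_at (tensor_power Q l V) a T) = (\<Sum>S'\<in>max_elems (ideal_at S a). G S' T))"
proof -
  let ?A = "spc V (tail Q a)" and ?I = "ideal_at S a" and ?L = "lattice Q (tail Q a)"
  let ?K = "\<lambda>T. rank Q (tail Q a) T V"
  let ?U = "\<lambda>l. \<Union>S\<in>?I. {fs' \<in> map_lists (scl V) l ?A R. \<forall>T\<in>?L. \<not> T \<le> S \<longrightarrow> r \<le> kill_count fs' (?K T)}"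
  have t: "tail Q a \<in> verts Q" "head Q a \<in> verts Q" using a by auto
  have sub: "module.subspace (scl V) (?K T) \<and> ?K T \<subseteq> ?A" if "T \<in> ?L" for T
    using rank_subspace[OF Q(1) V t(1) that] rank_subset[OF Q(1) V t(1) that] by blast
  have join: "\<exists>J\<in>?L. S \<le> J \<and> T \<le> J \<and> ?K J = ?K S \<inter> ?K T" if "S \<in> ?L" "T \<in> ?L" for S T
    using join_lat_in_lattice[OF that] rank_join[OF Q(1) V t(1) that] le_join_lat by blast
  have I: "?I \<subseteq> ?L" "\<And>S' T. S' \<in> ?I \<Longrightarrow> T \<in> ?L \<Longrightarrow> T \<le> S' \<Longrightarrow> T \<in> ?I"
    using lattice_ideal(3,4)[OF S] by blast+
  have "\<exists>n. \<forall>l. \<forall>fs\<in>map_lists (scl V) l ?A R. (\<forall>T\<in>?L - ?I. n \<le> kill_count fs (?K T)) \<longrightarrow>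
    tensor_op (scl V) l ?A C fs \<in> sums_of (tensor_op (scl V) l ?A C ` ?U l)"
    by (rule tensor_op_split_ideal[where K = ?K and b = bot_lat and L = ?L and I = ?I, OF is_rep_simps(1)[OF V] is_rep_simps(3)[OF V t(1)] R C RC Q(3) _
        bot_lat_in_lattice rank_bot[OF Q(1) V t(1)] _ I(1)], erule sub, erule (1) join, erule (2) I(2))
  then obtain n where n: "\<forall>l. \<forall>fs\<in>map_lists (scl V) l ?A R. (\<forall>T\<in>?L - ?I. n \<le> kill_count fs (?K T)) \<longrightarrow>
    tensor_op (scl V) l ?A C fs \<in> sums_of (tensor_op (scl V) l ?A C ` ?U l)" ..
  have main: "\<exists>G. (\<forall>S'\<in>max_elems ?I. G S' \<in> good_ops Q V l R C (tail Q a) r S') \<and>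
    (\<forall>T\<in>tensor_space (scl V) l ?A. F (map_at (tensor_power Q l V) a T) = (\<Sum>S'\<in>max_elems ?I. G S' T))"
    if F: "F \<in> good_ops Q V l R C (head Q a) n S" for l F
  proof -
    let ?X = "tensor_space (scl V) l ?A"
    let ?Y = "\<Union>S'\<in>max_elems ?I. tensor_op (scl V) l ?A C ` good_lists Q V l R (tail Q a) r S'"
    have mem: "(\<lambda>T. if T \<in> ?X then F (map_at (tensor_power Q l V) a T) else 0) \<in> sums_of ?Y"
      using F unfolding good_ops_def
    proof (induction rule: sums_of.induct)
      case zero
      have "(\<lambda>T. if T \<in> ?X then (0 :: _ \<Rightarrow> ('m \<Rightarrow> 'k) list \<Rightarrow> 'k) (map_at (tensor_power Q l V) a T) else 0) = 0" by (simp add: fun_eq_iff)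
      then show ?case by (simp only: sums_of.zero)
    next
      case (add x y)
      obtain fs where fs: "fs \<in> good_lists Q V l R (head Q a) n S" "x = tensor_op (scl V) l (spc V (head Q a)) C fs"
        using add.hyps(1) by blast
      have fsm: "fs \<in> map_lists (scl V) l (spc V (head Q a)) R" using fs(1) by (simp add: good_lists_def)
      let ?gs = "map (\<lambda>f v. f (map_at V a v)) fs"
      have kc: "n \<le> kill_count ?gs (?K T)" if T: "T \<in> ?L - ?I" for T
      proof -
        have TL: "T \<in> ?L" using T by blast
        have "\<not> arc_lat Q a T \<le> S" using T arc_lat_le_iff[OF Q(3) TL S] by simp
        then have "n \<le> kill_count fs (rank Q (head Q a) (arc_lat Q a T) V)"
          using fs(1) arc_lat_in_lattice[OF Q(3) a, of T] unfolding good_lists_def by blast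
        then show ?thesis
          using tensor_op_arc(3)[OF a fsm, of "?K T"] rank_arc[OF Q(1) V a TL Q(3)] by simp
      qed
      \<comment> \<open>The summands come with an element of the ideal; pass to a maximal element above it.\<close>
      have "tensor_op (scl V) l ?A C ?gs \<in> sums_of (tensor_op (scl V) l ?A C ` ?U l)"
        using n tensor_op_arc(1)[OF a fsm] kc by blast
      moreover have "tensor_op (scl V) l ?A C ` ?U l \<subseteq> ?Y"
      proof
        fix y assume "y \<in> tensor_op (scl V) l ?A C ` ?U l"
        then obtain S1 fs' where S1: "S1 \<in> ?I" "fs' \<in> map_lists (scl V) l ?A R"
          "\<And>T. T \<in> ?L \<Longrightarrow> \<not> T \<le> S1 \<Longrightarrow> r \<le> kill_count fs' (?K T)" "y = tensor_op (scl V) l ?A C fs'" by blast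
        obtain S' where S': "S' \<in> max_elems ?I" "S1 \<le> S'" using below_max_elem[OF finite_ideal_at S1(1)] by blast
        have "fs' \<in> good_lists Q V l R (tail Q a) r S'"
        proof -
          have "r \<le> kill_count fs' (?K T)" if T: "T \<in> ?L" "\<not> T \<le> S'" for T
            by (rule S1(3)[OF T(1)]) (use T(2) S'(2) in \<open>meson order_trans\<close>)
          then show ?thesis unfolding good_lists_def using S1(2) by blast
        qed
        then show "y \<in> ?Y" using S' S1(4) by blast
      qed
      ultimately have x: "tensor_op (scl V) l ?A C ?gs \<in> sums_of ?Y" using sums_of_mono by blast
      have "(\<lambda>T. if T \<in> ?X then (x + y) (map_at (tensor_power Q l V) a T) else 0) =
          tensor_op (scl V) l ?A C ?gs + (\<lambda>T. if T \<in> ?X then y (map_at (tensor_power Q l V) a T) else 0)"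
        (is "?l = ?r")
      proof
        fix T
        show "?l T = ?r T"
        proof (cases "T \<in> ?X")
          case True
          then show ?thesis using tensor_op_arc(2)[OF a fsm True] fs(2) by simp
        next
          case False
          then show ?thesis by (simp add: tensor_op_def)
        qed
      qed
      then show ?case using x add.IH by (simp only: sums_of_add)
    qed
    obtain G where G: "\<And>S'. S' \<in> max_elems ?I \<Longrightarrow> G S' \<in> sums_of (tensor_op (scl V) l ?A C ` good_lists Q V l R (tail Q a) r S')"
      "(\<lambda>T. if T \<in> ?X then F (map_at (tensor_power Q l V) a T) else 0) = sum G (max_elems ?I)"
      using sums_of_UN[OF mem finite_max_elems] by blast
    have "F (map_at (tensor_power Q l V) a T) = (\<Sum>S'\<in>max_elems ?I. G S' T)" if "T \<in> ?X" for T
    proof -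
      have sum_apply: "sum G J T = (\<Sum>S'\<in>J. G S' T)" for J by (induction J rule: infinite_finite_induct) auto
      show ?thesis using fun_cong[OF G(2), of T] that by (simp add: sum_apply)
    qed
    then show ?thesis using G(1) unfolding good_ops_def by blast
  qed
  then show ?thesis by blast
qed

text \<open>
  The required number of factors at \<open>S\<close> is found from those at the elements of its ideals, so the
  recursion for \<open>n\<close> runs from the leaves to the root and that for \<open>\<pi>\<close> the other way round.
\<close>

lemma projection_family_exists:
  assumes "S \<in> lattice Q z"
  shows "\<exists>n. \<forall>l. \<forall>F\<in>good_ops Q V l R C z n S. \<exists>\<pi>. \<pi> [] = F \<and> projection_family Q V R C l z S \<pi>"
  using assms
proof (induction S arbitrary: z rule: lat_induct)
  case (ideal S)
  have "\<forall>a S'. \<exists>n. S' \<in> max_elems (ideal_at S a) \<longrightarrow>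
      (\<forall>l. \<forall>F\<in>good_ops Q V l R C (tail Q a) n S'. \<exists>\<pi>. \<pi> [] = F \<and> projection_family Q V R C l (tail Q a) S' \<pi>)"
  proof (intro allI)
    fix a S'
    show "\<exists>n. S' \<in> max_elems (ideal_at S a) \<longrightarrow>
      (\<forall>l. \<forall>F\<in>good_ops Q V l R C (tail Q a) n S'. \<exists>\<pi>. \<pi> [] = F \<and> projection_family Q V R C l (tail Q a) S' \<pi>)"
    proof (cases "S' \<in> max_elems (ideal_at S a)")
      case True
      have S': "S' \<in> ideal_at S a" using True by (rule max_elemsD)
      show ?thesis using ideal.IH[OF S' lattice_ideal(3)[OF ideal.prems S']] by blast
    qed simp
  qed
  then obtain m where m: "\<And>a S' l F. S' \<in> max_elems (ideal_at S a) \<Longrightarrow> F \<in> good_ops Q V l R C (tail Q a) (m a S') S' \<Longrightarrow>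
      \<exists>\<pi>. \<pi> [] = F \<and> projection_family Q V R C l (tail Q a) S' \<pi>"
    unfolding choice_iff by blast
  \<comment> \<open>Sums of natural numbers serve as upper bounds; the summand 1 in \<open>n\<close> below is for the path \<open>[]\<close>.\<close>
  define r where "r a = (\<Sum>S'\<in>max_elems (ideal_at S a). m a S')" for a
  let ?P = "\<lambda>l a F G. (\<forall>S'\<in>max_elems (ideal_at S a). G S' \<in> good_ops Q V l R C (tail Q a) (r a) S') \<and>
    (\<forall>T\<in>tensor_space (scl V) l (spc V (tail Q a)).
      F (map_at (tensor_power Q l V) a T) = (\<Sum>S'\<in>max_elems (ideal_at S a). G S' T))"
  have "\<forall>a. \<exists>n. a \<in> in_arcs Q z \<longrightarrow> (\<forall>l. \<forall>F\<in>good_ops Q V l R C z n S. \<exists>G. ?P l a F G)"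
  proof
    fix a
    show "\<exists>n. a \<in> in_arcs Q z \<longrightarrow> (\<forall>l. \<forall>F\<in>good_ops Q V l R C z n S. \<exists>G. ?P l a F G)"
    proof (cases "a \<in> in_arcs Q z")
      case True
      then have a: "a \<in> arcs Q" "head Q a = z" by (auto simp: in_arcs_def)
      show ?thesis using good_ops_arc[OF a(1), of S "r a"] ideal.prems unfolding a(2) by blast
    next
      case False
      then show ?thesis by blast
    qed
  qed
  then obtain k where k: "\<And>a l F. a \<in> in_arcs Q z \<Longrightarrow> F \<in> good_ops Q V l R C z (k a) S \<Longrightarrow> \<exists>G. ?P l a F G"
    unfolding choice_iff by blast
  define n where "n = 1 + (\<Sum>a\<in>in_arcs Q z. k a)"
  have fin: "finite (in_arcs Q z)" using Q(2) by (simp add: in_arcs_def)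
  have kn: "k a \<le> n" if "a \<in> in_arcs Q z" for a
    unfolding n_def using member_le_sum[OF that _ fin, of k] by simp
  have mr: "m a S' \<le> r a" if "S' \<in> max_elems (ideal_at S a)" for a S'
    unfolding r_def using member_le_sum[OF that _ finite_max_elems, of "m a"] by simp
  have "\<exists>\<pi>. \<pi> [] = F \<and> projection_family Q V R C l z S \<pi>" if F: "F \<in> good_ops Q V l R C z n S" for l F
  proof -
    have "\<forall>a. \<exists>G. a \<in> in_arcs Q z \<longrightarrow> ?P l a F G"
    proof
      fix a
      have "\<exists>G. ?P l a F G" if a: "a \<in> in_arcs Q z"
        by (rule k[OF a subsetD[OF good_ops_mono[OF kn[OF a] order_refl] F]])
      then show "\<exists>G. a \<in> in_arcs Q z \<longrightarrow> ?P l a F G" by blast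
    qed
    then obtain G where G: "\<And>a. a \<in> in_arcs Q z \<Longrightarrow> ?P l a F (G a)" unfolding choice_iff by blast
    have "\<forall>a S'. \<exists>\<pi>. S' \<in> max_elems (ideal_at S a) \<longrightarrow> \<pi> [] = G a S' \<and> projection_family Q V R C l (tail Q a) S' \<pi>"
    proof (intro allI)
      fix a S'
      show "\<exists>\<pi>. S' \<in> max_elems (ideal_at S a) \<longrightarrow> \<pi> [] = G a S' \<and> projection_family Q V R C l (tail Q a) S' \<pi>"
      proof (cases "S' \<in> max_elems (ideal_at S a)")
        case True
        have "a \<in> in_arcs Q z"
          using lattice_ideal(1,2)[OF ideal.prems max_elemsD[OF True]] by (simp add: in_arcs_def)
        then have "G a S' \<in> good_ops Q V l R C (tail Q a) (r a) S'" using G True by blast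
        then have "G a S' \<in> good_ops Q V l R C (tail Q a) (m a S') S'"
          by (rule subsetD[OF good_ops_mono[OF mr[OF True] order_refl]])
        then show ?thesis using m[OF True] by blast
      qed simp
    qed
    then obtain \<rho> where \<rho>: "\<And>a S'. S' \<in> max_elems (ideal_at S a) \<Longrightarrow>
        \<rho> a S' [] = G a S' \<and> projection_family Q V R C l (tail Q a) S' (\<rho> a S')"
      unfolding choice_iff by blast
    define \<pi> where "\<pi> p = (case p of [] \<Rightarrow> F | b # q \<Rightarrow> \<rho> (fst b) (snd b) q)" for p
    have p0: "\<pi> [] = F" and pc: "\<pi> ((a, S') # q) = \<rho> a S' q" for a S' q by (simp_all add: \<pi>_def)
    have "projection_family Q V R C l z S \<pi>"
      unfolding projection_family_def
    proof (intro conjI allI impI)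
      fix p assume p: "red_path S p"
      show "\<pi> p \<in> good_ops Q V l R C (red_vert Q z p) 1 (last_lat S p)"
      proof (cases p)
        case Nil
        have "1 \<le> n" by (simp add: n_def)
        then have "F \<in> good_ops Q V l R C z 1 S"
          using subsetD[OF good_ops_mono[OF _ order_refl] F] by blast
        then show ?thesis by (simp add: Nil p0)
      next
        case (Cons b q)
        obtain a S' where b: "b = (a, S')" by (cases b)
        have S': "S' \<in> max_elems (ideal_at S a)" "red_path S' q" using p Cons b by auto
        then show ?thesis
          using \<rho>[OF S'(1)] unfolding Cons b pc projection_family_def by simp
      qed
    next
      fix p a T assume p: "red_path S p" "a \<in> in_arcs Q (red_vert Q z p)" "T \<in> tensor_space (scl V) l (spc V (tail Q a))"
      show "\<pi> p (map_at (tensor_power Q l V) a T) = (\<Sum>S'\<in>max_elems (ideal_at (last_lat S p) a). \<pi> (p @ [(a, S')]) T)"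
      proof (cases p)
        case Nil
        have "a \<in> in_arcs Q z" using p(2) Nil by simp
        then have "F (map_at (tensor_power Q l V) a T) = (\<Sum>S'\<in>max_elems (ideal_at S a). G a S' T)"
          using G p(3) by blast
        also have "\<dots> = (\<Sum>S'\<in>max_elems (ideal_at S a). \<pi> [(a, S')] T)"
          using \<rho> by (intro sum.cong) (auto simp: pc)
        finally show ?thesis by (simp add: Nil p0)
      next
        case (Cons b q)
        obtain c S' where b: "b = (c, S')" by (cases b)
        have S': "S' \<in> max_elems (ideal_at S c)" "red_path S' q" using p Cons b by auto
        have "a \<in> in_arcs Q (red_vert Q (tail Q c) q)" using p(2) Cons b by simp
        then have "\<rho> c S' q (map_at (tensor_power Q l V) a T) = (\<Sum>U\<in>max_elems (ideal_at (last_lat S' q) a). \<rho> c S' (q @ [(a, U)]) T)"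
          using \<rho>[OF S'(1)] S'(2) p(3) unfolding projection_family_def by blast
        then show ?thesis by (simp add: Cons b pc)
      qed
    qed
    then show ?thesis using p0 by blast
  qed
  then show ?case by blast
qed

end

lemma kill_count_filter: "kill_count fs B = length (filter (\<lambda>f. \<forall>v\<in>B. f v = 0) fs)"
  by (simp add: kill_count_def length_filter_conv_card)

text \<open>
  For each \<open>T\<close> take \<open>n\<close> copies of a projector onto \<open>R\<close> that maps \<open>T\<close> into \<open>R \<inter> T\<close>, which is 0. One more
  projector makes the list nonempty even if there is no \<open>T\<close>.
\<close>

lemma exists_initial_list:
  assumes s: "vector_space s" and R: "module.subspace s R" "R \<subseteq> A" and "finite \<T>"
    and T: "\<And>T. T \<in> \<T> \<Longrightarrow> module.subspace s T \<and> R \<inter> T = {0}"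
  shows "\<exists>fs. fs \<noteq> [] \<and> fs \<in> map_lists s (length fs) A R \<and> (\<forall>f\<in>set fs. \<forall>v\<in>R. f v = v) \<and>
    (\<forall>T\<in>\<T>. n \<le> kill_count fs T)"
proof -
  interpret vector_space s by (rule s)
  have "\<forall>T. \<exists>e. subspace T \<longrightarrow> linear_on s s UNIV e \<and> (\<forall>v. e v \<in> R) \<and> (\<forall>v\<in>R. e v = v) \<and> (\<forall>v\<in>T. e v \<in> R \<inter> T)"
    using exists_projector[OF s R(1)] by metis
  then obtain e where e: "\<And>T. subspace T \<Longrightarrow> linear_on s s UNIV (e T) \<and> (\<forall>v. e T v \<in> R) \<and> (\<forall>v\<in>R. e T v = v) \<and> (\<forall>v\<in>T. e T v \<in> R \<inter> T)"
    unfolding choice_iff by blast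
  obtain Ts where Ts: "set Ts = \<T>" using finite_list[OF assms(4)] by blast
  define fs where "fs = e R # concat (map (\<lambda>T. replicate n (e T)) Ts)"
  have "\<exists>T. subspace T \<and> f = e T" if "f \<in> set fs" for f
    using that R(1) T Ts by (auto simp: fs_def)
  then have f: "linear_on s s UNIV f \<and> (\<forall>v. f v \<in> R) \<and> (\<forall>v\<in>R. f v = v)" if "f \<in> set fs" for f
    using that e by blast
  have "n \<le> kill_count fs T" if mem: "T \<in> \<T>" for T
  proof -
    obtain xs ys where "Ts = xs @ T # ys" using split_list[of T Ts] mem Ts by blast
    moreover have "\<forall>v\<in>T. e T v = 0" using e[of T] T[OF mem] by blast
    ultimately show ?thesis by (simp add: kill_count_filter fs_def)
  qed
  moreover have "fs \<in> map_lists s (length fs) A R"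
    using f linear_on_subset[OF _ subset_UNIV] unfolding map_lists_def by blast
  moreover have "fs \<noteq> []" by (simp add: fs_def)
  ultimately show ?thesis using f by blast
qed

section \<open>Splitting off a sum of copies of a reduced representation\<close>

lemma rep_iso_sym:
  assumes "rep_iso Q V W" and V: "module (scl V)" "\<And>x. x \<in> verts Q \<Longrightarrow> module.subspace (scl V) (spc V x)"
    and "wf_digraph Q" and "\<And>a v. a \<in> arcs Q \<Longrightarrow> v \<in> spc V (tail Q a) \<Longrightarrow> map_at V a v \<in> spc V (head Q a)"
  shows "rep_iso Q W V"
proof -
  interpret module "scl V" by (rule V(1))
  interpret wf_digraph Q by fact
  obtain \<phi> where lin: "\<And>x. x \<in> verts Q \<Longrightarrow> linear_on (scl V) (scl W) (spc V x) (\<phi> x)"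
    and bij: "\<And>x. x \<in> verts Q \<Longrightarrow> bij_betw (\<phi> x) (spc V x) (spc W x)"
    and arc: "\<And>a v. a \<in> arcs Q \<Longrightarrow> v \<in> spc V (tail Q a) \<Longrightarrow>
        \<phi> (head Q a) (map_at V a v) = map_at W a (\<phi> (tail Q a) v)"
    using assms(1) unfolding rep_iso_def by blast
  define \<psi> where "\<psi> x = inv_into (spc V x) (\<phi> x)" for x
  have \<psi>: "\<psi> x w \<in> spc V x" "\<phi> x (\<psi> x w) = w" if "x \<in> verts Q" "w \<in> spc W x" for x w
    using bij[OF that(1)] that(2) by (auto simp: \<psi>_def bij_betw_def inv_into_into f_inv_into_f)
  have \<psi>\<phi>: "\<psi> x (\<phi> x v) = v" if "x \<in> verts Q" "v \<in> spc V x" for x v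
    using bij[OF that(1)] that(2) by (auto simp: \<psi>_def bij_betw_def)
  show ?thesis
    unfolding rep_iso_def
  proof (intro exI[of _ \<psi>] conjI ballI)
    fix x assume x: "x \<in> verts Q"
    show "bij_betw (\<psi> x) (spc W x) (spc V x)"
      unfolding \<psi>_def by (rule bij_betw_inv_into[OF bij[OF x]])
    show "linear_on (scl W) (scl V) (spc W x) (\<psi> x)"
      unfolding linear_on_def
    proof (intro conjI ballI allI)
      fix u v assume uv: "u \<in> spc W x" "v \<in> spc W x"
      have "\<psi> x u + \<psi> x v \<in> spc V x" using \<psi>(1)[OF x] uv subspace_add[OF V(2)[OF x]] by blast
      moreover have "\<phi> x (\<psi> x u + \<psi> x v) = u + v"
        using linear_on_add[OF lin[OF x]] \<psi>[OF x] uv by simp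
      ultimately show "\<psi> x (u + v) = \<psi> x u + \<psi> x v" using \<psi>\<phi>[OF x] by metis
    next
      fix c u assume u: "u \<in> spc W x"
      have "scl V c (\<psi> x u) \<in> spc V x" using \<psi>(1)[OF x] u subspace_scale[OF V(2)[OF x]] by blast
      moreover have "\<phi> x (scl V c (\<psi> x u)) = scl W c u"
        using linear_on_scale[OF lin[OF x]] \<psi>[OF x] u by simp
      ultimately show "\<psi> x (scl W c u) = scl V c (\<psi> x u)" using \<psi>\<phi>[OF x] by metis
    qed
  next
    fix a w assume a: "a \<in> arcs Q" and w: "w \<in> spc W (tail Q a)"
    note v = \<psi>[OF tail_in_verts[OF a] w]
    have "\<phi> (head Q a) (map_at V a (\<psi> (tail Q a) w)) = map_at W a w" using arc[OF a v(1)] v(2) by simp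
    then show "\<psi> (head Q a) (map_at W a w) = map_at V a (\<psi> (tail Q a) w)"
      using \<psi>\<phi>[OF head_in_verts[OF a] assms(5)[OF a v(1)]] by simp
  qed
qed

text \<open>
  By the recursion for ranks, \<open>\<zeta> v\<close> is the image under \<open>a\<close> of a vector in the rank at each element of
  the ideal at \<open>a\<close>. Compose \<open>\<zeta>\<close> with a linear section of \<open>a\<close> on this rank and continue there.
\<close>

lemma exists_sections:
  assumes Q: "wf_digraph Q" and X: "is_rep Q X" and "x \<in> verts Q" "S \<in> lattice Q x"
    and "linear_on (scl X) (scl X) UNIV \<zeta>" "\<And>v. v \<in> Z \<Longrightarrow> \<zeta> v \<in> rank Q x S X"
  shows "\<exists>s. s [] = \<zeta> \<and> (\<forall>p. red_path S p \<longrightarrow> linear_on (scl X) (scl X) UNIV (s p) \<and>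
      (\<forall>v\<in>Z. s p v \<in> rank Q (red_vert Q x p) (last_lat S p) X)) \<and>
    (\<forall>p a T. red_path S (p @ [(a, T)]) \<longrightarrow> (\<forall>v\<in>Z. map_at X a (s (p @ [(a, T)]) v) = s p v))"
  using assms(3-)
proof (induction S arbitrary: x \<zeta> rule: lat_induct)
  case (ideal S)
  interpret wf_digraph Q by (rule Q)
  let ?P = "\<lambda>a T r. r [] = r [] \<and> (\<forall>p. red_path T p \<longrightarrow> linear_on (scl X) (scl X) UNIV (r p) \<and>
      (\<forall>v\<in>Z. r p v \<in> rank Q (red_vert Q (tail Q a) p) (last_lat T p) X)) \<and>
    (\<forall>p b T'. red_path T (p @ [(b, T')]) \<longrightarrow> (\<forall>v\<in>Z. map_at X b (r (p @ [(b, T')]) v) = r p v)) \<and>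
    (\<forall>v\<in>Z. map_at X a (r [] v) = \<zeta> v)"
  have "\<forall>a T. \<exists>r. T \<in> max_elems (ideal_at S a) \<longrightarrow> ?P a T r"
  proof (intro allI)
    fix a T
    have "\<exists>r. ?P a T r" if T: "T \<in> max_elems (ideal_at S a)"
    proof -
      have T': "T \<in> ideal_at S a" using T by (rule max_elemsD)
      note l = lattice_ideal(1,3)[OF ideal.prems(2) T']
      have t: "tail Q a \<in> verts Q" using l(1) by simp
      have le: "rank Q (tail Q a) T X \<subseteq> spc X (tail Q a)" by (rule rank_subset[OF Q X t l(2)])
      obtain g where g: "linear_on (scl X) (scl X) UNIV g" "\<And>v. g v \<in> rank Q (tail Q a) T X"
        "\<And>v. v \<in> map_at X a ` rank Q (tail Q a) T X \<Longrightarrow> map_at X a (g v) = v"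
        by (rule exists_section[OF is_rep_simps(1)[OF X] is_rep_simps(4)[OF X l(1)] rank_subspace[OF Q X t l(2)] le], rule that)
      have lin: "linear_on (scl X) (scl X) UNIV (\<lambda>v. g (\<zeta> v))"
        by (rule linear_on_compose[OF ideal.prems(3) g(1)]) simp
      have sec: "map_at X a (g (\<zeta> v)) = \<zeta> v" if "v \<in> Z" for v
        using g(3) ideal.prems(4)[OF that] T' unfolding rank_rec[OF Q X ideal.prems(1,2)] by blast
      obtain r where r: "r [] = (\<lambda>v. g (\<zeta> v))" "\<forall>p. red_path T p \<longrightarrow> linear_on (scl X) (scl X) UNIV (r p) \<and>
          (\<forall>v\<in>Z. r p v \<in> rank Q (red_vert Q (tail Q a) p) (last_lat T p) X)"
        "\<forall>p b T'. red_path T (p @ [(b, T')]) \<longrightarrow> (\<forall>v\<in>Z. map_at X b (r (p @ [(b, T')]) v) = r p v)"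
        using ideal.IH[OF T' t l(2) lin g(2)] by blast
      show ?thesis using r sec by (intro exI[of _ r]) simp
    qed
    then show "\<exists>r. T \<in> max_elems (ideal_at S a) \<longrightarrow> ?P a T r" by blast
  qed
  then obtain r where r: "\<And>a T. T \<in> max_elems (ideal_at S a) \<Longrightarrow> ?P a T (r a T)"
    unfolding choice_iff by blast
  define s where "s p = (case p of [] \<Rightarrow> \<zeta> | b # q \<Rightarrow> r (fst b) (snd b) q)" for p
  have s0: "s [] = \<zeta>" and sc: "s ((a, T) # q) = r a T q" for a T q by (simp_all add: s_def)
  have 1: "linear_on (scl X) (scl X) UNIV (s p) \<and> (\<forall>v\<in>Z. s p v \<in> rank Q (red_vert Q x p) (last_lat S p) X)"
    if p: "red_path S p" for p
  proof (cases p)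
    case Nil
    then show ?thesis using ideal.prems(3,4) by (simp add: s0)
  next
    case (Cons b q)
    obtain a T where b: "b = (a, T)" by (cases b)
    have "T \<in> max_elems (ideal_at S a)" "red_path T q" using p Cons b by auto
    then show ?thesis using r[of T a] unfolding Cons b sc by simp
  qed
  have 2: "map_at X a (s (p @ [(a, T)]) v) = s p v" if p: "red_path S (p @ [(a, T)])" and v: "v \<in> Z" for p a T v
  proof (cases p)
    case Nil
    then show ?thesis using p r[of T a] v by (simp add: s0 sc)
  next
    case (Cons b q)
    obtain c U where b: "b = (c, U)" by (cases b)
    have U: "U \<in> max_elems (ideal_at S c)" "red_path U (q @ [(a, T)])" using p Cons b by auto
    then have "map_at X a (r c U (q @ [(a, T)]) v) = r c U q v" using r[OF U(1)] v by blast
    then show ?thesis by (simp add: Cons b sc)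
  qed
  show ?case using s0 1 2 by blast
qed

text \<open>
  Sections \<open>s\<close> and projections \<open>\<pi>\<close> over the reduced quiver of \<open>N\<close> in an arbitrary representation \<open>X\<close>.
  They suffice to split off a sum of copies of the reduced representation.
\<close>

locale reduced_splitting =
  fixes Q :: "('v, 'e) pre_digraph" and \<sigma> :: 'v and X :: "('k::field, 'x::ab_group_add, 'v, 'e) rep"
    and N :: "'e lat" and Z :: "'x set" and s \<pi> :: "('e \<times> 'e lat) list \<Rightarrow> 'x \<Rightarrow> 'x"
  assumes tree: "rooted_tree Q \<sigma>" and X: "is_rep Q X" and N: "N \<in> lattice Q \<sigma>"
    and Z: "Z = rank Q \<sigma> N X"
    and s_root: "v \<in> Z \<Longrightarrow> s [] v = v"
    and s_lin: "red_path N p \<Longrightarrow> linear_on (scl X) (scl X) Z (s p)"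
    and s_rank: "red_path N p \<Longrightarrow> v \<in> Z \<Longrightarrow> s p v \<in> rank Q (red_vert Q \<sigma> p) (last_lat N p) X"
    and s_arc: "red_path N (p @ [(a, S)]) \<Longrightarrow> v \<in> Z \<Longrightarrow> map_at X a (s (p @ [(a, S)]) v) = s p v"
    and p_lin: "red_path N p \<Longrightarrow> linear_on (scl X) (scl X) (spc X (red_vert Q \<sigma> p)) (\<pi> p)"
    and p_Z: "red_path N p \<Longrightarrow> t \<in> spc X (red_vert Q \<sigma> p) \<Longrightarrow> \<pi> p t \<in> Z"
    and p_root: "v \<in> Z \<Longrightarrow> \<pi> [] v = v"
    and p_arc: "red_path N p \<Longrightarrow> a \<in> in_arcs Q (red_vert Q \<sigma> p) \<Longrightarrow> t \<in> spc X (tail Q a) \<Longrightarrow>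
      \<pi> p (map_at X a t) = (\<Sum>S\<in>max_elems (ideal_at (last_lat N p) a). \<pi> (p @ [(a, S)]) t)"
    and p_kill: "red_path N p \<Longrightarrow> T \<in> lattice Q (red_vert Q \<sigma> p) \<Longrightarrow> \<not> T \<le> last_lat N p \<Longrightarrow>
      t \<in> rank Q (red_vert Q \<sigma> p) T X \<Longrightarrow> \<pi> p t = 0"
begin

sublocale fin_digraph Q using tree by (simp add: rooted_tree_def)

sublocale vector_space "scl X" using X by (simp add: is_rep_def)

lemma root: "\<sigma> \<in> verts Q" by (rule tree_root(1)[OF tree])

definition over :: "'v \<Rightarrow> ('e \<times> 'e lat) list set" where
  "over y = {p. red_path N p \<and> red_vert Q \<sigma> p = y}"

lemma finite_over: "finite (over y)"
  unfolding over_def using finite_red_paths[OF finite_arcs N] by (rule rev_finite_subset) blast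

lemma over_snocD:
  assumes "p @ [(a, S)] \<in> over y"
  shows "a \<in> arcs Q" "tail Q a = y" "p \<in> over (head Q a)" "S \<in> max_elems (ideal_at (last_lat N p) a)"
  using assms red_path_arc[OF N, of p a S] by (auto simp: over_def)

lemma over_root: "over \<sigma> = {[]}"
proof -
  have "p = []" if "p \<in> over \<sigma>" for p
  proof (cases p rule: rev_cases)
    case (snoc q b)
    obtain a S where b: "b = (a, S)" by (cases b)
    have "a \<in> arcs Q" "tail Q a = \<sigma>" using over_snocD(1,2) that unfolding snoc b by blast+
    then show ?thesis using tree_root(2)[OF tree] by blast
  qed
  moreover have "[] \<in> over \<sigma>" by (simp add: over_def)
  ultimately show ?thesis by blast
qed

lemma over_tail:
  assumes "a \<in> arcs Q" "p \<in> over (tail Q a)"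
  obtains q S where "p = q @ [(a, S)]" "q \<in> over (head Q a)"
proof (cases p rule: rev_cases)
  case Nil
  then have "tail Q a = \<sigma>" using assms(2) by (simp add: over_def)
  then show ?thesis using tree_root(2)[OF tree assms(1)] by blast
next
  case (snoc q b)
  obtain c S where b: "b = (c, S)" by (cases b)
  have c: "c \<in> arcs Q" "tail Q c = tail Q a" "q \<in> over (head Q c)"
    using over_snocD(1-3)[of q c S] assms(2) unfolding snoc b by blast+
  have "c = a" using tree_tail_inj[OF tree c(1) assms(1) c(2)] .
  then show ?thesis using that[of q S] snoc b c(3) by simp
qed

lemma s_spc: "p \<in> over y \<Longrightarrow> v \<in> Z \<Longrightarrow> s p v \<in> spc X y"
proof -
  assume p: "p \<in> over y" and v: "v \<in> Z"
  have "red_path N p" "red_vert Q \<sigma> p = y" using p by (auto simp: over_def)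
  then show ?thesis
    using s_rank[OF _ v] rank_subset[OF wf_digraph X red_path_verts[OF wf_digraph root N] red_path_lattice[OF N]] by blast
qed

lemma over_verts: "p \<in> over y \<Longrightarrow> y \<in> verts Q"
  using red_path_verts[OF wf_digraph root N] by (auto simp: over_def)

text \<open>
  Lexicographic with the arrow nearest to the leaves first, because the last lattice elements of
  two paths decide first whether \<open>p_kill\<close> applies. Only paths over the same vertex are compared, which
  run through the same arrows, so the lattice elements alone matter.
\<close>

definition path_less :: "('e \<times> 'e lat) list \<Rightarrow> ('e \<times> 'e lat) list \<Rightarrow> bool" where
  "path_less p q \<longleftrightarrow> (rev p, rev q) \<in> lexord {(b, c). snd b < snd c}"

lemma path_less_snoc [simp]:
  "path_less (p @ [(a, S)]) (q @ [(a, T)]) \<longleftrightarrow> S < T \<or> (S = T \<and> path_less p q)"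
  by (simp add: path_less_def)

lemma path_less_order: "transp path_less" "asymp path_less"
proof -
  have "trans {(b, c :: 'e \<times> 'e lat). snd b < snd c}" by (auto simp: trans_def)
  then have t: "path_less p r" if "path_less p q" "path_less q r" for p q r
    using that lexord_trans unfolding path_less_def by blast
  then show "transp path_less" by (auto simp: transp_def)
  have "\<not> path_less p p" for p
    unfolding path_less_def by (rule lexord_irreflexive) auto
  then show "asymp path_less" using t by (intro asympI) blast
qed

text \<open>
  Let \<open>p\<close> and \<open>q\<close> end at \<open>S\<close> and \<open>S'\<close>. The section of \<open>q\<close> has values in the rank at \<open>S'\<close>, which \<open>\<pi> p\<close>
  kills unless \<open>S' \<le> S\<close>. If \<open>S' = S\<close>, then all siblings of \<open>p\<close> kill it as well, since maximal elements of
  an ideal are incomparable. Then \<open>p_arc\<close> reduces the claim to the parents of \<open>p\<close> and \<open>q\<close>.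
\<close>

lemma proj_section:
  assumes "p \<in> over y" "q \<in> over y" "v \<in> Z"
  shows "p = q \<Longrightarrow> \<pi> p (s q v) = v"
    and "p \<noteq> q \<Longrightarrow> \<pi> p (s q v) = 0 \<or> path_less q p"
proof -
  have "(p = q \<longrightarrow> \<pi> p (s q v) = v) \<and> (p \<noteq> q \<longrightarrow> \<pi> p (s q v) = 0 \<or> path_less q p)"
    using assms(1,2)
  proof (induction p arbitrary: q y rule: rev_induct)
    case Nil
    then have "y = \<sigma>" by (simp add: over_def)
    then have "q = []" using Nil(2) over_root by blast
    then show ?case using p_root s_root assms(3) by simp
  next
    case (snoc b p)
    obtain a S where b: "b = (a, S)" by (cases b)
    note p = over_snocD[OF snoc.prems(1)[unfolded b]]
    obtain q' S' where q: "q = q' @ [(a, S')]" "q' \<in> over (head Q a)"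
      using over_tail[OF p(1), of q] snoc.prems(2) p(2) by blast
    have rp: "red_path N (p @ [(a, S)])" "red_path N q" "red_path N p"
      and rv: "red_vert Q \<sigma> p = head Q a" "red_vert Q \<sigma> q = tail Q a"
      using snoc.prems b p(2,3) by (auto simp: over_def)
    have S'L: "S' \<in> lattice Q (tail Q a)" using red_path_lattice[OF N rp(2)] by (simp add: q(1))
    have sq: "s q v \<in> rank Q (tail Q a) S' X" using s_rank[OF rp(2) assms(3)] by (simp add: q(1))
    show ?case
    proof (cases "S' \<le> S")
      case False
      have "\<pi> (p @ [(a, S)]) (s q v) = 0"
        by (rule p_kill[OF rp(1), of S']) (use S'L False sq in simp_all)
      moreover have "p @ [(a, S)] \<noteq> q" using False q by auto
      ultimately show ?thesis by (simp add: b)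
    next
      case le: True
      show ?thesis
      proof (cases "S' = S")
        case False
        then have "path_less q (p @ [b])" using le by (simp add: q b)
        moreover have "p @ [b] \<noteq> q" using False by (simp add: q b)
        ultimately show ?thesis by simp
      next
        case True
        have ain: "a \<in> in_arcs Q (red_vert Q \<sigma> p)" using p(1) rv by simp
        have "\<pi> p (map_at X a (s q v)) = (\<Sum>T\<in>max_elems (ideal_at (last_lat N p) a). \<pi> (p @ [(a, T)]) (s q v))"
          by (rule p_arc[OF rp(3) ain]) (use s_spc[OF snoc.prems(2) assms(3)] p(2) in simp)
        also have "\<dots> = \<pi> (p @ [(a, S)]) (s q v)"
        proof (subst sum.remove[OF finite_max_elems p(4)], subst sum.neutral)
          show "\<forall>T\<in>max_elems (ideal_at (last_lat N p) a) - {S}. \<pi> (p @ [(a, T)]) (s q v) = 0"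
          proof
            fix T assume T: "T \<in> max_elems (ideal_at (last_lat N p) a) - {S}"
            then have "\<not> S \<le> T" using max_elems_le_eq[OF p(4), of T] by blast
            then show "\<pi> (p @ [(a, T)]) (s q v) = 0"
              using rp(3) T S'L sq True by (intro p_kill[of _ S']) simp_all
          qed
        qed simp
        finally have "\<pi> (p @ [b]) (s q v) = \<pi> p (s q' v)"
          using s_arc[of q' a S' v] rp(2) assms(3) by (simp add: q(1) b)
        then show ?thesis using snoc.IH[OF p(3) q(2)] by (cases "p = q'") (simp_all add: q(1) b True)
      qed
    qed
  qed
  then show "p = q \<Longrightarrow> \<pi> p (s q v) = v" "p \<noteq> q \<Longrightarrow> \<pi> p (s q v) = 0 \<or> path_less q p" by blast+
qed

lemma Z_subspace: "subspace Z"
  unfolding Z by (rule rank_subspace[OF wf_digraph X root N])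

lemma proj_linear:
  assumes "p \<in> over y"
  shows "linear_on (scl X) (scl X) (spc X y) (\<pi> p)" "t \<in> spc X y \<Longrightarrow> \<pi> p t \<in> Z"
  using p_lin p_Z assms by (auto simp: over_def)

lemma spc_subspace: "p \<in> over y \<Longrightarrow> subspace (spc X y)"
  using is_rep_simps(3)[OF X] over_verts by blast

lemma maximal_path:
  assumes "finite D" "D \<noteq> {}"
  obtains p where "p \<in> D" "\<And>q. q \<in> D \<Longrightarrow> \<not> path_less p q"
proof -
  have "\<exists>p\<in>D. \<forall>q\<in>D. q \<noteq> p \<longrightarrow> \<not> path_less p q"
    using assms path_less_order by (intro Finite_Set.bex_max_element) (auto intro: transp_on_subset asymp_on_subset)
  then obtain p where p: "p \<in> D" "\<forall>q\<in>D. q \<noteq> p \<longrightarrow> \<not> path_less p q" by blast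
  have irr: "\<not> path_less p p" using asympD[OF path_less_order(2), of p p] by blast
  show ?thesis
  proof (rule that[OF p(1)])
    show "\<not> path_less p q" if "q \<in> D" for q using p(2) irr that by (cases "q = p") auto
  qed
qed

lemma section_sum_spc:
  assumes "D \<subseteq> over y" "y \<in> verts Q" "\<And>p. p \<in> D \<Longrightarrow> z p \<in> Z"
  shows "(\<Sum>p\<in>D. s p (z p)) \<in> spc X y"
  using assms s_spc by (intro subspace_sum is_rep_simps(3)[OF X]) blast+

text \<open>
  The section of a maximal path \<open>m\<close> in \<open>D\<close> is not seen by the projections of the other paths in \<open>D\<close>, so
  these coefficients vanish by induction, and then that of \<open>m\<close> does.
\<close>

lemma section_sum_unique:
  assumes "finite D" "D \<subseteq> over y" "\<And>p. p \<in> D \<Longrightarrow> z p \<in> Z"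
    and "\<And>p. p \<in> D \<Longrightarrow> \<pi> p (\<Sum>q\<in>D. s q (z q)) = 0" and "p \<in> D"
  shows "z p = 0"
  using assms
proof (induction "card D" arbitrary: D p)
  case 0
  then show ?case by simp
next
  case (Suc n)
  obtain m where m: "m \<in> D" "\<And>q. q \<in> D \<Longrightarrow> \<not> path_less m q"
    using maximal_path[OF Suc.prems(1)] Suc.prems(5) by blast
  let ?D = "D - {m}"
  have my: "m \<in> over y" using m(1) Suc.prems(2) by blast
  have D: "finite ?D" "?D \<subseteq> over y" "n = card ?D" using Suc.prems Suc.hyps(2) m(1) by auto
  have sumD: "(\<Sum>q\<in>D. s q (z q)) = s m (z m) + (\<Sum>q\<in>?D. s q (z q))"
    by (rule sum.remove[OF Suc.prems(1) m(1)])
  have in': "s m (z m) \<in> spc X y" "(\<Sum>q\<in>?D. s q (z q)) \<in> spc X y"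
    using s_spc[OF my] section_sum_spc[OF D(2) over_verts[OF my], of z] Suc.prems(3) m(1) by auto
  have add: "\<pi> q (\<Sum>q\<in>D. s q (z q)) = \<pi> q (s m (z m)) + \<pi> q (\<Sum>q\<in>?D. s q (z q))" if "q \<in> D" for q
    unfolding sumD using linear_on_add[OF proj_linear(1) in'] Suc.prems(2) that by blast
  have z0: "z q = 0" if q: "q \<in> ?D" for q
  proof (rule Suc.hyps(1)[OF D(3,1,2) _ _ q])
    show "z p \<in> Z" if "p \<in> ?D" for p using Suc.prems(3) that by blast
    show "\<pi> p (\<Sum>q\<in>?D. s q (z q)) = 0" if p: "p \<in> ?D" for p
    proof -
      have "p \<in> over y" "p \<noteq> m" "\<not> path_less m p" using p Suc.prems(2) m(2) by auto
      then have "\<pi> p (s m (z m)) = 0" using proj_section(2)[OF _ my Suc.prems(3)[OF m(1)]] by blast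
      then show ?thesis using add[of p] Suc.prems(4)[of p] p by simp
    qed
  qed
  have "s q (z q) = 0" if "q \<in> ?D" for q
  proof -
    have "red_path N q" using that D(2) by (auto simp: over_def)
    then show ?thesis
      using linear_on_zero[OF s_lin module_axioms module_axioms Z_subspace] z0[OF that] by simp
  qed
  then have "\<pi> m (s m (z m)) = 0" using Suc.prems(4)[OF m(1)] unfolding sumD by simp
  then have "z m = 0" using proj_section(1)[OF my my Suc.prems(3)[OF m(1)] refl] by simp
  then show ?case using z0 Suc.prems(5) by blast
qed

text \<open>
  Forward substitution: adding a term at a maximal path \<open>m\<close> corrects the projection at \<open>m\<close> without
  disturbing the others.
\<close>

lemma section_sum_exists:
  assumes "finite D" "D \<subseteq> over y" "x \<in> spc X y" "y \<in> verts Q"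
  shows "\<exists>z. (\<forall>p. z p \<in> Z) \<and> (\<forall>p\<in>D. \<pi> p (x - (\<Sum>q\<in>D. s q (z q))) = 0)"
  using assms(1,2)
proof (induction "card D" arbitrary: D)
  case 0
  then show ?case using subspace_0[OF Z_subspace] by (intro exI[of _ "\<lambda>_. 0"]) simp
next
  case (Suc n)
  obtain m where m: "m \<in> D" "\<And>q. q \<in> D \<Longrightarrow> \<not> path_less m q"
    using maximal_path[OF Suc.prems(1)] Suc.hyps(2) by (metis card.empty Zero_not_Suc)
  let ?D = "D - {m}"
  have my: "m \<in> over y" using m(1) Suc.prems(2) by blast
  have D: "finite ?D" "?D \<subseteq> over y" "n = card ?D" using Suc.prems Suc.hyps(2) m(1) by auto
  obtain z where z: "\<And>p. z p \<in> Z" "\<And>p. p \<in> ?D \<Longrightarrow> \<pi> p (x - (\<Sum>q\<in>?D. s q (z q))) = 0"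
    using Suc.hyps(1)[OF D(3,1,2)] by blast
  let ?x = "x - (\<Sum>q\<in>?D. s q (z q))"
  have sub: "subspace (spc X y)" by (rule is_rep_simps(3)[OF X assms(4)])
  have x: "?x \<in> spc X y" using subspace_diff[OF sub assms(3) section_sum_spc[OF D(2) assms(4) z(1)]] .
  define w where "w = z(m := \<pi> m ?x)"
  have w: "w p \<in> Z" for p using z(1) proj_linear(2)[OF my x] by (simp add: w_def)
  have "(\<Sum>q\<in>D. s q (w q)) = s m (\<pi> m ?x) + (\<Sum>q\<in>?D. s q (z q))"
    unfolding sum.remove[OF Suc.prems(1) m(1)] by (simp add: w_def)
  then have eq: "x - (\<Sum>q\<in>D. s q (w q)) = ?x - s m (\<pi> m ?x)" by (simp add: algebra_simps)
  have sm: "s m (\<pi> m ?x) \<in> spc X y" by (rule s_spc[OF my proj_linear(2)[OF my x]])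
  have "\<pi> p (x - (\<Sum>q\<in>D. s q (w q))) = 0" if p: "p \<in> D" for p
  proof -
    have py: "p \<in> over y" using p Suc.prems(2) by blast
    have e: "\<pi> p (x - (\<Sum>q\<in>D. s q (w q))) = \<pi> p ?x - \<pi> p (s m (\<pi> m ?x))"
      unfolding eq by (rule linear_on_diff[OF proj_linear(1)[OF py] module_axioms module_axioms sub x sm])
    show ?thesis
    proof (cases "p = m")
      case True
      then show ?thesis unfolding e using proj_section(1)[OF my my proj_linear(2)[OF my x] refl] by simp
    next
      case False
      then have "\<pi> p (s m (\<pi> m ?x)) = 0"
        using proj_section(2)[OF py my proj_linear(2)[OF my x] False] m(2)[OF p] by blast
      then show ?thesis unfolding e using z(2)[of p] p False by simp
    qed
  qed
  then show ?case using w by blast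
qed

definition section_sum :: "'v \<Rightarrow> (('e \<times> 'e lat) list \<Rightarrow> 'x) \<Rightarrow> 'x" where
  "section_sum y z = (\<Sum>p\<in>over y. s p (z p))"

definition image_part :: "'v \<Rightarrow> 'x set" where
  "image_part y = {section_sum y z | z. \<forall>p. z p \<in> Z}"

definition kernel_part :: "'v \<Rightarrow> 'x set" where
  "kernel_part y = {t \<in> spc X y. \<forall>p\<in>over y. \<pi> p t = 0}"

lemma section_sum_add:
  assumes "\<And>p. z p \<in> Z" "\<And>p. w p \<in> Z"
  shows "section_sum y (\<lambda>p. z p + w p) = section_sum y z + section_sum y w"
  unfolding section_sum_def sum.distrib[symmetric]
  by (intro sum.cong refl linear_on_add[OF s_lin] assms) (simp add: over_def)

lemma section_sum_scale:
  assumes "\<And>p. z p \<in> Z"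
  shows "section_sum y (\<lambda>p. scl X c (z p)) = scl X c (section_sum y z)"
  unfolding section_sum_def scale_sum_right
  by (intro sum.cong refl linear_on_scale[OF s_lin] assms) (simp add: over_def)

lemma section_sum_inj:
  assumes "\<And>p. z p \<in> Z" "\<And>p. w p \<in> Z" "section_sum y z = section_sum y w" "p \<in> over y"
  shows "z p = w p"
proof -
  have d: "z q - w q \<in> Z" for q using subspace_diff[OF Z_subspace] assms(1,2) by blast
  have "section_sum y (\<lambda>q. (z q - w q) + w q) = section_sum y (\<lambda>q. z q - w q) + section_sum y w"
    by (rule section_sum_add[OF d assms(2)])
  then have 0: "(\<Sum>q\<in>over y. s q (z q - w q)) = 0" using assms(3) by (simp add: section_sum_def)
  have k: "\<pi> q (\<Sum>q\<in>over y. s q (z q - w q)) = 0" if "q \<in> over y" for q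
    unfolding 0 by (rule linear_on_zero[OF proj_linear(1)[OF that] module_axioms module_axioms spc_subspace[OF that]])
  have "z p - w p = 0" by (rule section_sum_unique[OF finite_over subset_refl d k assms(4)])
  then show ?thesis by simp
qed

text \<open>
  On coefficients, an arrow acts by summing over the fibres of \<^const>\<open>butlast\<close>, as it does in the
  reduced representation.
\<close>

lemma section_sum_arc:
  assumes a: "a \<in> arcs Q" and z: "\<And>p. z p \<in> Z"
  shows "map_at X a (section_sum (tail Q a) z) =
    section_sum (head Q a) (\<lambda>q. \<Sum>p\<in>{p \<in> over (tail Q a). butlast p = q}. z p)"
proof -
  have ov: "butlast p \<in> over (head Q a) \<and> map_at X a (s p (z p)) = s (butlast p) (z p)"
    if p: "p \<in> over (tail Q a)" for p
  proof -
    obtain q S where q: "p = q @ [(a, S)]" "q \<in> over (head Q a)" by (rule over_tail[OF a p])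
    then show ?thesis using s_arc[of q a S "z p"] p z by (simp add: over_def)
  qed
  have "map_at X a (section_sum (tail Q a) z) = (\<Sum>p\<in>over (tail Q a). map_at X a (s p (z p)))"
    unfolding section_sum_def
    using s_spc z by (intro linear_on_sum[OF is_rep_simps(4)[OF X a] module_axioms module_axioms is_rep_simps(3)[OF X]]) (use a in auto)
  also have "\<dots> = (\<Sum>p\<in>over (tail Q a). s (butlast p) (z p))"
    using ov by (intro sum.cong) auto
  also have "\<dots> = (\<Sum>q\<in>over (head Q a). \<Sum>p\<in>{p \<in> over (tail Q a). butlast p = q}. s (butlast p) (z p))"
    using ov by (intro sum.group[symmetric] finite_over) auto
  also have "\<dots> = (\<Sum>q\<in>over (head Q a). s q (\<Sum>p\<in>{p \<in> over (tail Q a). butlast p = q}. z p))"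
  proof (intro sum.cong refl)
    fix q assume q: "q \<in> over (head Q a)"
    have "s q (\<Sum>p\<in>{p \<in> over (tail Q a). butlast p = q}. z p) = (\<Sum>p\<in>{p \<in> over (tail Q a). butlast p = q}. s q (z p))"
      using q z by (intro linear_on_sum[OF s_lin module_axioms module_axioms Z_subspace]) (auto simp: over_def)
    then show "(\<Sum>p\<in>{p \<in> over (tail Q a). butlast p = q}. s (butlast p) (z p)) =
        s q (\<Sum>p\<in>{p \<in> over (tail Q a). butlast p = q}. z p)"
      by simp
  qed
  finally show ?thesis by (simp add: section_sum_def)
qed

lemma sum_in_Z: "(\<And>p. z p \<in> Z) \<Longrightarrow> (\<Sum>p\<in>A. z p) \<in> Z"
  by (rule subspace_sum[OF Z_subspace])

lemma image_part_subspace: "subspace (image_part y)"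
proof (rule subspaceI)
  have "section_sum y (\<lambda>p. scl X 0 0) = scl X 0 (section_sum y (\<lambda>p. 0))"
    using subspace_0[OF Z_subspace] by (rule section_sum_scale)
  then have "section_sum y (\<lambda>p. 0) = 0" by simp
  then show "0 \<in> image_part y" using subspace_0[OF Z_subspace] unfolding image_part_def
    by (intro CollectI exI[of _ "\<lambda>p. 0"]) simp
  show "u + v \<in> image_part y" if uv: "u \<in> image_part y" "v \<in> image_part y" for u v
  proof -
    obtain z w where "u = section_sum y z" "\<forall>p. z p \<in> Z" "v = section_sum y w" "\<forall>p. w p \<in> Z"
      using uv unfolding image_part_def by blast
    then show ?thesis unfolding image_part_def
      using section_sum_add[of z w y] subspace_add[OF Z_subspace] by (intro CollectI exI[of _ "\<lambda>p. z p + w p"]) simp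
  qed
  show "scl X c u \<in> image_part y" if u: "u \<in> image_part y" for c u
  proof -
    obtain z where "u = section_sum y z" "\<forall>p. z p \<in> Z" using u unfolding image_part_def by blast
    then show ?thesis unfolding image_part_def
      using section_sum_scale[of z y c] subspace_scale[OF Z_subspace] by (intro CollectI exI[of _ "\<lambda>p. scl X c (z p)"]) simp
  qed
qed

lemma image_part_subset: "y \<in> verts Q \<Longrightarrow> image_part y \<subseteq> spc X y"
  unfolding image_part_def section_sum_def using section_sum_spc[OF subset_refl] by blast

lemma image_part_subrep: "subrep Q X image_part"
  unfolding subrep_def
proof (intro conjI ballI image_subsetI)
  fix a u assume a: "a \<in> arcs Q" and "u \<in> image_part (tail Q a)"
  then obtain z where z: "u = section_sum (tail Q a) z" "\<And>p. z p \<in> Z" unfolding image_part_def by blast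
  show "map_at X a u \<in> image_part (head Q a)"
    unfolding z(1) section_sum_arc[OF a z(2)] image_part_def
    by (rule CollectI, rule exI, rule conjI, rule refl) (intro allI sum_in_Z z(2))
qed (use image_part_subspace image_part_subset in auto)

lemma image_part_root: "image_part \<sigma> = Z"
proof -
  have "section_sum \<sigma> z = z []" if "\<forall>p. z p \<in> Z" for z
    using that by (simp add: section_sum_def over_root s_root)
  moreover have "section_sum \<sigma> (\<lambda>_. v) = v" if "v \<in> Z" for v
    using that by (simp add: section_sum_def over_root s_root)
  ultimately show ?thesis unfolding image_part_def by (auto; metis)
qed

lemma kernel_part_subrep: "subrep Q X kernel_part"
  unfolding subrep_def
proof (intro conjI ballI image_subsetI)
  fix y assume y: "y \<in> verts Q"
  note sub = is_rep_simps(3)[OF X y]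
  show "subspace (kernel_part y)"
  proof (rule subspaceI)
    show "0 \<in> kernel_part y"
      using subspace_0[OF sub] linear_on_zero[OF proj_linear(1) module_axioms module_axioms sub] by (simp add: kernel_part_def)
    show "u + v \<in> kernel_part y" if "u \<in> kernel_part y" "v \<in> kernel_part y" for u v
      using that subspace_add[OF sub] linear_on_add[OF proj_linear(1)] by (simp add: kernel_part_def)
    show "scl X c u \<in> kernel_part y" if "u \<in> kernel_part y" for c u
      using that subspace_scale[OF sub] linear_on_scale[OF proj_linear(1)] by (simp add: kernel_part_def)
  qed
  show "kernel_part y \<subseteq> spc X y" by (auto simp: kernel_part_def)
next
  fix a t assume a: "a \<in> arcs Q" and t: "t \<in> kernel_part (tail Q a)"
  have tX: "t \<in> spc X (tail Q a)" using t by (simp add: kernel_part_def)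
  have "\<pi> q (map_at X a t) = 0" if q: "q \<in> over (head Q a)" for q
  proof -
    have q': "red_path N q" "a \<in> in_arcs Q (red_vert Q \<sigma> q)" using q a by (auto simp: over_def)
    have "\<pi> (q @ [(a, S)]) t = 0" if "S \<in> max_elems (ideal_at (last_lat N q) a)" for S
      using t q'(1) that by (simp add: kernel_part_def over_def)
    then show ?thesis unfolding p_arc[OF q' tX] by simp
  qed
  then show "map_at X a t \<in> kernel_part (head Q a)"
    using is_rep_simps(5)[OF X a tX] by (simp add: kernel_part_def)
qed

lemma direct_sum: "internal_direct_sum Q X image_part kernel_part"
  unfolding internal_direct_sum_def
proof (intro conjI ballI image_part_subrep kernel_part_subrep)
  fix y assume y: "y \<in> verts Q"
  show "image_part y \<inter> kernel_part y = {0}"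
  proof -
    have "u = 0" if u: "u \<in> image_part y" "u \<in> kernel_part y" for u
    proof -
      obtain z where z: "u = section_sum y z" "\<And>p. z p \<in> Z" using u unfolding image_part_def by blast
      have k: "\<pi> p (\<Sum>q\<in>over y. s q (z q)) = 0" if "p \<in> over y" for p
        using u(2) that unfolding z(1) kernel_part_def section_sum_def by blast
      have "z p = 0" if "p \<in> over y" for p
        by (rule section_sum_unique[OF finite_over subset_refl z(2) k that])
      then have "s p (z p) = 0" if "p \<in> over y" for p
        using that linear_on_zero[OF s_lin module_axioms module_axioms Z_subspace] by (simp add: over_def)
      then show "u = 0" unfolding z(1) section_sum_def by simp
    qed
    moreover have "0 \<in> image_part y" "0 \<in> kernel_part y"
      using image_part_subspace kernel_part_subrep y subspace_0 by (auto simp: subrep_def)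
    ultimately show ?thesis by blast
  qed
  show "spc X y = {u + w | u w. u \<in> image_part y \<and> w \<in> kernel_part y}"
  proof
    show "{u + w | u w. u \<in> image_part y \<and> w \<in> kernel_part y} \<subseteq> spc X y"
      using image_part_subset[OF y] subspace_add[OF is_rep_simps(3)[OF X y]] by (auto simp: kernel_part_def)
    show "spc X y \<subseteq> {u + w | u w. u \<in> image_part y \<and> w \<in> kernel_part y}"
    proof
      fix x assume x: "x \<in> spc X y"
      obtain z where z: "\<And>p. z p \<in> Z" "\<And>p. p \<in> over y \<Longrightarrow> \<pi> p (x - section_sum y z) = 0"
        using section_sum_exists[OF finite_over subset_refl x y] unfolding section_sum_def by blast
      have u: "section_sum y z \<in> image_part y" using z(1) unfolding image_part_def by blast
      then have "x - section_sum y z \<in> kernel_part y"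
        using z(2) image_part_subset[OF y] subspace_diff[OF is_rep_simps(3)[OF X y] x] by (auto simp: kernel_part_def)
      moreover have "x = section_sum y z + (x - section_sum y z)" by simp
      ultimately show "x \<in> {u + w | u w. u \<in> image_part y \<and> w \<in> kernel_part y}" using u by blast
    qed
  qed
qed

end

lemma reduced_rep_simps:
  "scl (reduced_rep Q x M) c f = (\<lambda>p. c * f p)"
  "spc (reduced_rep Q x M) y = {f. \<forall>p. \<not> (red_path M p \<and> red_vert Q x p = y) \<longrightarrow> f p = 0}"
  "map_at (reduced_rep Q x M) a f q = (\<Sum>p | red_path M p \<and> p \<noteq> [] \<and> red_arc p = a \<and> butlast p = q. f p)"
  by (auto simp: reduced_rep_def pushforward_def unit_rep_def conj_assoc)

lemma copies_simps:
  "scl (copies n V) c f = (\<lambda>i. scl V c (f i))"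
  "spc (copies n V) x = {f. (\<forall>i<n. f i \<in> spc V x) \<and> (\<forall>i\<ge>n. f i = 0)}"
  "map_at (copies n V) a f = (\<lambda>i. if i < n then map_at V a (f i) else 0)"
  by (simp_all add: copies_def)

context reduced_splitting
begin

lemma rank_complement:
  assumes "internal_direct_sum Q X image_part W"
  shows "rank Q \<sigma> N (restr X W) = {0}"
proof -
  have W: "subrep Q X W" "image_part \<sigma> \<inter> W \<sigma> = {0}"
    using assms root by (auto simp: internal_direct_sum_def)
  have "rank Q \<sigma> N (restr X W) \<subseteq> {0}"
    using rank_restr[OF wf_digraph X W(1) root N] W(2) image_part_root Z by blast
  moreover have "0 \<in> rank Q \<sigma> N (restr X W)"
    using module.subspace_0[OF _ rank_subspace[OF wf_digraph is_rep_restr[OF X W(1) wf_digraph] root N]]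
      is_rep_simps(2)[OF is_rep_restr[OF X W(1) wf_digraph]] by blast
  ultimately show ?thesis by blast
qed

lemma arrows_over:
  assumes a: "a \<in> arcs Q"
  shows "{p. red_path N p \<and> p \<noteq> [] \<and> red_arc p = a \<and> butlast p = q} = {p \<in> over (tail Q a). butlast p = q}"
proof (intro set_eqI iffI CollectI conjI)
  fix p assume p: "p \<in> {p. red_path N p \<and> p \<noteq> [] \<and> red_arc p = a \<and> butlast p = q}"
  show "p \<in> over (tail Q a)" using p by (auto simp: over_def red_vert_def red_arc_def)
  show "butlast p = q" using p by blast
next
  fix p assume p: "p \<in> {p \<in> over (tail Q a). butlast p = q}"
  then have po: "p \<in> over (tail Q a)" by blast
  obtain q' S where "p = q' @ [(a, S)]" by (rule over_tail[OF a po])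
  then show "red_path N p" "p \<noteq> []" "red_arc p = a" "butlast p = q"
    using p by (auto simp: over_def red_arc_def)
qed

text \<open>
  A basis \<open>b\<close> of \<open>Z\<close> identifies the families of scalars in the copies of the reduced representation
  with families of coefficients in \<open>Z\<close>, which \<^const>\<open>section_sum\<close> maps bijectively to the image part.
\<close>

lemma image_part_iso: "rep_iso Q (restr X image_part) (copies (dim Z) (reduced_rep Q \<sigma> N))"
proof -
  obtain B0 where B0: "finite B0" "span B0 = spc X \<sigma>"
    using X root unfolding is_rep_def by blast
  have ZB: "Z \<subseteq> span B0"
    unfolding Z B0(2) by (rule rank_subset[OF wf_digraph X root N])
  obtain B where B: "finite B" "independent B" "span B = Z" "card B = dim Z"
    by (rule finite_basis_of_subspace[OF vector_space_axioms B0(1) ZB Z_subspace])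
  obtain b where b: "bij_betw b {..<dim Z} B"
    using ex_bij_betw_nat_finite[OF B(1)] by (auto simp: B(4) atLeast0LessThan)
  let ?\<Omega> = "copies (dim Z) (reduced_rep Q \<sigma> N) :: ('k, nat \<Rightarrow> ('e \<times> 'e lat) list \<Rightarrow> 'k, 'v, 'e) rep"
  define comb where "comb g = (\<Sum>i<dim Z. scl X (g i) (b i))" for g
  have bB: "b i \<in> B" if "i < dim Z" for i using b that by (auto simp: bij_betw_def)
  have combZ: "comb g \<in> Z" for g
    unfolding comb_def using bB B(3) span_base by (intro subspace_sum[OF Z_subspace] subspace_scale[OF Z_subspace]) auto
  have comb_add: "comb (\<lambda>i. g i + h i) = comb g + comb h" for g h
    by (simp add: comb_def scale_left_distrib sum.distrib)
  have comb_scale: "comb (\<lambda>i. c * g i) = scl X c (comb g)" for c g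
    by (simp add: comb_def scale_sum_right)
  have comb_sum: "comb (\<lambda>i. \<Sum>p\<in>A. g i p) = (\<Sum>p\<in>A. comb (\<lambda>i. g i p))" for A and g :: "nat \<Rightarrow> ('e \<times> 'e lat) list \<Rightarrow> 'k"
    unfolding comb_def scale_sum_left by (rule sum.swap)
  have reindex: "(\<Sum>i<dim Z. scl X (g (b i)) (b i)) = (\<Sum>v\<in>B. scl X (g v) v)" for g
    using sum.reindex_bij_betw[OF b, of "\<lambda>v. scl X (g v) v"] .
  have comb_surj: "comb (\<lambda>i. representation B v (b i)) = v" if "v \<in> Z" for v
    unfolding comb_def reindex using sum_representation_eq[OF B(2) _ B(1) subset_refl] that B(3) by simp
  have comb_inj: "g i = h i" if eq: "comb g = comb h" and i: "i < dim Z" for g h i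
  proof -
    have inv: "inv_into {..<dim Z} b (b j) = j" if "j < dim Z" for j
      using b that by (simp add: bij_betw_def)
    have "comb (\<lambda>j. g j - h j) + comb h = comb g" by (simp add: comb_add[symmetric])
    then have "comb (\<lambda>j. g j - h j) = 0" using eq by simp
    moreover have "comb (\<lambda>j. g j - h j) = (\<Sum>i<dim Z. scl X ((\<lambda>v. g (inv_into {..<dim Z} b v) - h (inv_into {..<dim Z} b v)) (b i)) (b i))"
      unfolding comb_def using inv by (intro sum.cong) auto
    ultimately have "(\<Sum>v\<in>B. scl X (g (inv_into {..<dim Z} b v) - h (inv_into {..<dim Z} b v)) v) = 0"
      using reindex[of "\<lambda>v. g (inv_into {..<dim Z} b v) - h (inv_into {..<dim Z} b v)"] by simp
    then have "g (inv_into {..<dim Z} b (b i)) - h (inv_into {..<dim Z} b (b i)) = 0"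
      by (rule independentD[where u = "\<lambda>v. g (inv_into {..<dim Z} b v) - h (inv_into {..<dim Z} b v)",
            OF B(2,1) subset_refl _ bB[OF i]])
    then show ?thesis using inv[OF i] by simp
  qed
  define \<Psi> where "\<Psi> y f = section_sum y (\<lambda>p. comb (\<lambda>i. f i p))" for y and f :: "nat \<Rightarrow> ('e \<times> 'e lat) list \<Rightarrow> 'k"
  have spc\<Omega>: "f \<in> spc ?\<Omega> y \<longleftrightarrow> (\<forall>i p. i \<ge> dim Z \<or> p \<notin> over y \<longrightarrow> f i p = 0)" for f y
    by (auto simp: copies_simps reduced_rep_simps over_def fun_eq_iff not_less)
      (metis linorder_not_le)+
  have sub\<Omega>: "module.subspace (scl ?\<Omega>) (spc ?\<Omega> y)" and mod\<Omega>: "module (scl ?\<Omega>)" for y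
  proof -
    show m: "module (scl ?\<Omega>)"
      by unfold_locales (auto simp: copies_simps reduced_rep_simps fun_eq_iff algebra_simps)
    show "module.subspace (scl ?\<Omega>) (spc ?\<Omega> y)"
      by (rule module.subspaceI[OF m]; unfold spc\<Omega>)
        (auto simp: copies_simps(1) reduced_rep_simps(1))
  qed
  have map\<Omega>: "map_at ?\<Omega> a f i q = (if i < dim Z then \<Sum>p\<in>{p \<in> over (tail Q a). butlast p = q}. f i p else 0)"
    if "a \<in> arcs Q" for a f i q
    using arrows_over[OF that, of q] by (simp add: copies_simps reduced_rep_simps)
  have "rep_iso Q ?\<Omega> (restr X image_part)"
    unfolding rep_iso_def
  proof (intro exI[of _ \<Psi>] conjI ballI)
    fix y assume y: "y \<in> verts Q"
    show "linear_on (scl ?\<Omega>) (scl (restr X image_part)) (spc ?\<Omega> y) (\<Psi> y)"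
      unfolding linear_on_def
      by (auto simp: \<Psi>_def restr_def copies_simps reduced_rep_simps comb_add comb_scale
          section_sum_add section_sum_scale combZ)
    show "bij_betw (\<Psi> y) (spc ?\<Omega> y) (spc (restr X image_part) y)"
      unfolding bij_betw_def
    proof
      show "inj_on (\<Psi> y) (spc ?\<Omega> y)"
      proof (intro inj_onI ext)
        fix f g i p assume f: "f \<in> spc ?\<Omega> y" and g: "g \<in> spc ?\<Omega> y" and eq: "\<Psi> y f = \<Psi> y g"
        show "f i p = g i p"
        proof (cases "i < dim Z \<and> p \<in> over y")
          case True
          then have "comb (\<lambda>i. f i p) = comb (\<lambda>i. g i p)"
            using section_sum_inj[OF combZ combZ eq[unfolded \<Psi>_def]] by blast
          then show ?thesis by (rule comb_inj) (use True in blast)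
        next
          case False
          then have "i \<ge> dim Z \<or> p \<notin> over y" by auto
          then have "f i p = 0" "g i p = 0" using f g unfolding spc\<Omega> by blast+
          then show ?thesis by simp
        qed
      qed
      show "\<Psi> y ` spc ?\<Omega> y = spc (restr X image_part) y"
      proof
        show "\<Psi> y ` spc ?\<Omega> y \<subseteq> spc (restr X image_part) y"
          using combZ by (auto simp: \<Psi>_def restr_def image_part_def)
        show "spc (restr X image_part) y \<subseteq> \<Psi> y ` spc ?\<Omega> y"
        proof
          fix u assume "u \<in> spc (restr X image_part) y"
          then obtain z where z: "u = section_sum y z" "\<And>p. z p \<in> Z"
            by (auto simp: restr_def image_part_def)
          define f where "f i p = (if i < dim Z \<and> p \<in> over y then representation B (z p) (b i) else 0)" for i p
          have "comb (\<lambda>i. f i p) = z p" if p: "p \<in> over y" for p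
          proof -
            have "comb (\<lambda>i. f i p) = comb (\<lambda>i. representation B (z p) (b i))"
              unfolding comb_def f_def using p by (intro sum.cong) auto
            then show ?thesis using comb_surj[OF z(2)] by simp
          qed
          then have "\<Psi> y f = u" unfolding \<Psi>_def z(1) section_sum_def by (intro sum.cong) auto
          moreover have "f \<in> spc ?\<Omega> y" unfolding spc\<Omega> f_def by auto
          ultimately show "u \<in> \<Psi> y ` spc ?\<Omega> y" by blast
        qed
      qed
    qed
  next
    fix a f assume a: "a \<in> arcs Q" and f: "f \<in> spc ?\<Omega> (tail Q a)"
    have "comb (\<lambda>i. map_at ?\<Omega> a f i q) = (\<Sum>p\<in>{p \<in> over (tail Q a). butlast p = q}. comb (\<lambda>i. f i p))" for q
    proof -
      have "comb (\<lambda>i. map_at ?\<Omega> a f i q) = comb (\<lambda>i. \<Sum>p\<in>{p \<in> over (tail Q a). butlast p = q}. f i p)"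
        unfolding comb_def map\<Omega>[OF a] by (intro sum.cong) auto
      then show ?thesis by (simp only: comb_sum)
    qed
    then show "\<Psi> (head Q a) (map_at ?\<Omega> a f) = map_at (restr X image_part) a (\<Psi> (tail Q a) f)"
      using section_sum_arc[OF a, of "\<lambda>p. comb (\<lambda>i. f i p)"] combZ by (simp add: \<Psi>_def restr_def)
  qed
  then show ?thesis
  proof (rule rep_iso_sym[OF _ mod\<Omega> sub\<Omega> wf_digraph])
    fix a f assume a: "a \<in> arcs Q" and f: "f \<in> spc ?\<Omega> (tail Q a)"
    have "map_at ?\<Omega> a f i q = 0" if iq: "i \<ge> dim Z \<or> q \<notin> over (head Q a)" for i q
    proof (cases "i < dim Z")
      case True
      then have q: "q \<notin> over (head Q a)" using iq by simp
      have "{p \<in> over (tail Q a). butlast p = q} = {}"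
      proof (rule ccontr)
        assume "\<not> ?thesis"
        then obtain p where p: "p \<in> over (tail Q a)" "butlast p = q" by blast
        obtain q' S where "p = q' @ [(a, S)]" "q' \<in> over (head Q a)" by (rule over_tail[OF a p(1)])
        then show False using p(2) q by simp
      qed
      then show ?thesis by (simp only: map\<Omega>[OF a] sum.empty if_cancel)
    qed (simp add: map\<Omega>[OF a])
    then show "map_at ?\<Omega> a f \<in> spc ?\<Omega> (head Q a)" unfolding spc\<Omega> by blast
  qed
qed

lemma image_part_iso_tensor: "iso_reduced_tensor Q \<sigma> X image_part N Z"
  unfolding iso_reduced_tensor_def using image_part_iso image_part_root by blast

end

section \<open>The splitting theorem\<close>

theorem theorem40:
  fixes Q :: "('v, 'e) pre_digraph" and \<sigma> :: 'v
    and V :: "('k::field, 'm::ab_group_add, 'v, 'e) rep"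
    and N :: "'e lat"
  assumes "rooted_tree Q \<sigma>"
    and "is_rep Q V"
    and "N \<in> lattice Q \<sigma>"
    and "rank Q \<sigma> N V \<noteq> {0}"
    and "\<And>M. M \<in> lattice Q \<sigma> \<Longrightarrow> N < M \<Longrightarrow> rank Q \<sigma> M V = {0}"
  shows "\<exists>l>0. \<exists>U. subrep Q (tensor_power Q l V) U \<and>
    iso_reduced_tensor Q \<sigma> (tensor_power Q l V) U N (rank Q \<sigma> N (tensor_power Q l V)) \<and>
    (\<exists>W. internal_direct_sum Q (tensor_power Q l V) U W) \<and>
    (\<forall>W. internal_direct_sum Q (tensor_power Q l V) U W \<longrightarrow>
       rank Q \<sigma> N (restr (tensor_power Q l V) W) = {0})"
proof -
  note tree = assms(1) and V = assms(2) and N = assms(3)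
  interpret fin_digraph Q using tree by (simp add: rooted_tree_def)
  note Q = wf_digraph finite_arcs finite_lattice[OF tree_arcs_wf[OF tree] finite_arcs]
  have \<sigma>: "\<sigma> \<in> verts Q" by (rule tree_root(1)[OF tree])
  let ?R = "rank Q \<sigma> N V" and ?C = "spc V \<sigma>"
  have R: "module.subspace (scl V) ?R" "?R \<subseteq> ?C"
    by (rule rank_subspace[OF Q(1) V \<sigma> N], rule rank_subset[OF Q(1) V \<sigma> N])
  have C: "module.subspace (scl V) ?C" by (rule is_rep_simps(3)[OF V \<sigma>])
  obtain n where n: "\<And>l F. F \<in> good_ops Q V l ?R ?C \<sigma> n N \<Longrightarrow> \<exists>\<pi>. \<pi> [] = F \<and> projection_family Q V ?R ?C l \<sigma> N \<pi>"
    using projection_family_exists[OF Q V R(1) C R(2) N] by blast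
  let ?T = "(\<lambda>T. rank Q \<sigma> T V) ` {T \<in> lattice Q \<sigma>. \<not> T \<le> N}"
  have T: "module.subspace (scl V) T \<and> ?R \<inter> T = {0}" if mem: "T \<in> ?T" for T
  proof -
    obtain M where M: "M \<in> lattice Q \<sigma>" "\<not> M \<le> N" "T = rank Q \<sigma> M V" using mem by blast
    have "N < join_lat N M"
      using le_join_lat(1)[of N M] le_join_lat(2)[of M N] M(2) by (auto simp: less_le)
    then have "?R \<inter> T = {0}"
      using assms(5)[OF join_lat_in_lattice[OF N M(1)]] rank_join[OF Q(1) V \<sigma> N M(1)] M(3) by simp
    then show ?thesis using rank_subspace[OF Q(1) V \<sigma> M(1)] M(3) by simp
  qed
  \<comment> \<open>A projector onto the rank at \<open>N\<close> can be chosen for each of these \<open>T\<close> separately; their product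
    is the projection at the root, and its number of factors is the tensor exponent.\<close>
  have "finite ?T" using Q(3)[of \<sigma>] by simp
  from exists_initial_list[OF is_rep_simps(1)[OF V] R this T, of n]
  obtain fs where fs: "fs \<noteq> []" "fs \<in> map_lists (scl V) (length fs) ?C ?R"
    "\<forall>f\<in>set fs. \<forall>v\<in>?R. f v = v" "\<forall>T\<in>?T. n \<le> kill_count fs T"
    by blast
  define l where "l = length fs"
  let ?X = "tensor_power Q l V"
  note X = is_rep_tensor_power[OF Q(1) V, of l]
  have rankX: "rank Q y M ?X = tensor_sub (scl V) l (spc V y) (rank Q y M V)"
    if "y \<in> verts Q" "M \<in> lattice Q y" for y M
    by (rule rank_tensor_power[OF Q(1,2) V that])
  have "fs \<in> good_lists Q V l ?R \<sigma> n N" using fs unfolding good_lists_def l_def by auto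
  then have "tensor_op (scl V) l ?C ?C fs \<in> good_ops Q V l ?R ?C \<sigma> n N"
    unfolding good_ops_def by (intro sums_of_base imageI)
  then obtain \<pi> where \<pi>: "\<pi> [] = tensor_op (scl V) l ?C ?C fs" "projection_family Q V ?R ?C l \<sigma> N \<pi>"
    using n by blast
  have good: "\<pi> p \<in> good_ops Q V l ?R ?C (red_vert Q \<sigma> p) 1 (last_lat N p)" if "red_path N p" for p
    using \<pi>(2) that unfolding projection_family_def by blast
  have yv: "red_vert Q \<sigma> p \<in> verts Q" if "red_path N p" for p by (rule red_path_verts[OF Q(1) \<sigma> N that])
  note props = good_ops_properties[OF Q(1) V yv R(2) good]
  let ?Z = "rank Q \<sigma> N ?X"
  have id: "linear_on (scl ?X) (scl ?X) UNIV (\<lambda>v. v)" by (simp add: linear_on_def)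
  from exists_sections[OF Q(1) X \<sigma> N id, of ?Z]
  obtain s where s: "s [] = (\<lambda>v. v)"
    "\<forall>p. red_path N p \<longrightarrow> linear_on (scl ?X) (scl ?X) UNIV (s p) \<and>
      (\<forall>v\<in>?Z. s p v \<in> rank Q (red_vert Q \<sigma> p) (last_lat N p) ?X)"
    "\<forall>p a S. red_path N (p @ [(a, S)]) \<longrightarrow> (\<forall>v\<in>?Z. map_at ?X a (s (p @ [(a, S)]) v) = s p v)"
    by blast
  interpret reduced_splitting Q \<sigma> ?X N ?Z s \<pi>
  proof
    show "rooted_tree Q \<sigma>" "is_rep Q ?X" "N \<in> lattice Q \<sigma>" "?Z = ?Z" by (fact tree X N refl)+
    show "s [] v = v" for v by (simp add: s(1))
    show "\<pi> [] v = v" if v: "v \<in> ?Z" for v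
    proof -
      have v': "v \<in> tensor_sub (scl V) l ?C ?R" using v unfolding rankX[OF \<sigma> N] .
      then have "v \<in> tensor_space (scl V) l ?C" using tensor_sub_mono[OF R(2)] unfolding tensor_space_eq_sub by blast
      then have "\<pi> [] v = tensor_maps (scl V) ?C ?C fs v" by (simp add: \<pi>(1) tensor_op_def)
      also have "\<dots> = v"
      proof (rule tensor_maps_id[OF is_rep_simps(1)[OF V] _ _ C R(2) _ v'])
        show "length fs = l" by (simp add: l_def)
        show "linear_on (scl V) (scl V) ?C f \<and> f ` ?C \<subseteq> ?C" if "f \<in> set fs" for f
          using fs(2) that R(2) unfolding map_lists_def by blast
        show "f v = v" if "f \<in> set fs" "v \<in> ?R" for f v using fs(3) that by blast
      qed
      finally show ?thesis .
    qed
    fix p assume p: "red_path N p"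
    show "linear_on (scl ?X) (scl ?X) ?Z (s p)"
      using linear_on_subset[OF _ subset_UNIV] s(2) p by blast
    show "s p v \<in> rank Q (red_vert Q \<sigma> p) (last_lat N p) ?X" if "v \<in> ?Z" for v using s(2) p that by blast
    show "linear_on (scl ?X) (scl ?X) (spc ?X (red_vert Q \<sigma> p)) (\<pi> p)" using props(1)[OF p p] by simp
    show "\<pi> p t \<in> ?Z" if "t \<in> spc ?X (red_vert Q \<sigma> p)" for t
      unfolding rankX[OF \<sigma> N] using props(2)[OF p p] that by simp
    show "\<pi> p (map_at ?X a t) = (\<Sum>S\<in>max_elems (ideal_at (last_lat N p) a). \<pi> (p @ [(a, S)]) t)"
      if "a \<in> in_arcs Q (red_vert Q \<sigma> p)" "t \<in> spc ?X (tail Q a)" for a t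
      using \<pi>(2) p that unfolding projection_family_def by simp
    show "\<pi> p t = 0" if T: "T \<in> lattice Q (red_vert Q \<sigma> p)" "\<not> T \<le> last_lat N p" "t \<in> rank Q (red_vert Q \<sigma> p) T ?X" for T t
      using props(3)[OF p p T(1,2)] T(3) unfolding rankX[OF yv[OF p] T(1)] .
  next
    show "map_at ?X a (s (p @ [(a, S)]) v) = s p v" if "red_path N (p @ [(a, S)])" "v \<in> ?Z" for p a S v
      using s(3) that by blast
  qed
  have "l > 0" using fs(1) by (simp add: l_def)
  then show ?thesis
    using image_part_subrep image_part_iso_tensor direct_sum rank_complement by blast
qed

end
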